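(* Let $h\in(0,1)$, $K\in C^h([0,T])$, let $K_n(t)=\sum_{k=0}^n\kappa_{n,k}t^k$ be its Bernstein polynomial approximation of order $n$, and let $$\hat u_n(t)=\frac{\alpha a_2}{2a_1}\langle g_n,e^{(T-t)\bar{\mathcal A}_n}\nu\rangle,\quad t\in[0,T],$$ with $\mathbb H=L^2(\mathbb R)$, $(\mathcal Af)(x)=f(x+1)$, $\nu=\mathbb 1_{[0,1]}$, $g_n=\sum_{k=0}^nk!\,\kappa_{n,k}\mathbb 1_{[-k,-k+1]}$, $\bar{\mathcal A}_n=\mathcal A-\beta\langle g_n,\cdot\rangle\nu$. Then the problem of maximizing $$J(u)=\mathbb E\left[-\int_0^Ta_1u^2(s)ds+a_2X^u(T)\right]$$ over $u\in L^2_a$, where $X^u(t)=X(0)+\int_0^tK(t-s)(\alpha u(s)-\beta X^u(s))ds+\sigma\int_0^tK(t-s)dW(s)$, has a unique solution $\hat u\in L^2_a$, and $\hat u_n\to\hat u$ as $n\to\infty$ in the weak topology of $L^2(\Omega\times[0,T])$.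
   Context: Fix $T>0$ and constants $\alpha,\beta,\sigma>0$, $a_1,a_2>0$, $X(0)\in\mathbb R$. $W$ is a standard one-dimensional Brownian motion; $L^2_a$ is the space of real-valued square-integrable processes on $\Omega\times[0,T]$ adapted to the filtration generated by $W$. $C^h([0,T])$ is the set of $h$-Hölder continuous functions on $[0,T]$. The Bernstein polynomial approximation is $K_n(t)=\frac{1}{T^n}\sum_{k=0}^nK\big(\frac{Tk}{n}\big)\binom nk t^k(T-t)^{n-k}=\sum_{k=0}^n\kappa_{n,k}t^k$ with $\kappa_{n,k}=\frac{1}{T^k}\sum_{i=0}^k(-1)^{k-i}K\big(\frac{iT}{n}\big)\binom ni\binom{n-i}{k-i}$. *)

theory Defs
  imports "HOL-Probability.Probability"
begin

definition std_BM :: "'a measure \<Rightarrow> (real \<Rightarrow> 'a \<Rightarrow> real) \<Rightarrow> bool" where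
  "std_BM M W \<longleftrightarrow> prob_space M
     \<and> (\<forall>t\<ge>0. W t \<in> borel_measurable M)
     \<and> (\<forall>\<omega>\<in>space M. W 0 \<omega> = 0)
     \<and> (\<forall>\<omega>\<in>space M. continuous_on {0..} (\<lambda>t. W t \<omega>))
     \<and> (\<forall>s t. 0 \<le> s \<and> s < t \<longrightarrow>
          distributed M lborel (\<lambda>\<omega>. W t \<omega> - W s \<omega>)
            (\<lambda>x. ennreal (normal_density 0 (sqrt (t - s)) x)))
     \<and> (\<forall>(ts::nat \<Rightarrow> real) k. 0 \<le> ts 0 \<and> (\<forall>i<k. ts i \<le> ts (Suc i)) \<longrightarrow>
          prob_space.indep_vars M (\<lambda>_. borel) (\<lambda>i \<omega>. W (ts (Suc i)) \<omega> - W (ts i) \<omega>) {..<k})"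

definition natF :: "'a measure \<Rightarrow> (real \<Rightarrow> 'a \<Rightarrow> real) \<Rightarrow> real \<Rightarrow> 'a measure" where
  "natF M W t = sigma (space M)
     {W s -` B \<inter> space M | s B. s \<in> {0..t} \<and> B \<in> sets (borel :: real measure)}"

definition OT :: "'a measure \<Rightarrow> real \<Rightarrow> ('a \<times> real) measure" where
  "OT M T = M \<Otimes>\<^sub>M restrict_space lborel {0..T}"

definition L2a :: "'a measure \<Rightarrow> (real \<Rightarrow> 'a \<Rightarrow> real) \<Rightarrow> real \<Rightarrow> (real \<Rightarrow> 'a \<Rightarrow> real) \<Rightarrow> bool" where
  "L2a M W T u \<longleftrightarrow>
      (\<lambda>z. u (snd z) (fst z)) \<in> borel_measurable (OT M T)
    \<and> integrable (OT M T) (\<lambda>z. (u (snd z) (fst z))\<^sup>2)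
    \<and> (\<forall>t\<in>{0..T}. u t \<in> borel_measurable (natF M W t))"

text \<open>Wiener integral of a deterministic continuous integrand f over [0,t]:
  the L^2(M)-limit of the (left-point) Riemann--Ito sums on uniform partitions.\<close>
definition riemann_ito_sum :: "(real \<Rightarrow> 'a \<Rightarrow> real) \<Rightarrow> (real \<Rightarrow> real) \<Rightarrow> real \<Rightarrow> nat \<Rightarrow> 'a \<Rightarrow> real" where
  "riemann_ito_sum W f t m \<omega> =
     (\<Sum>i<m. f (t * real i / real m) * (W (t * real (Suc i) / real m) \<omega> - W (t * real i / real m) \<omega>))"

definition wiener_integral ::
  "'a measure \<Rightarrow> (real \<Rightarrow> 'a \<Rightarrow> real) \<Rightarrow> (real \<Rightarrow> real) \<Rightarrow> real \<Rightarrow> ('a \<Rightarrow> real) \<Rightarrow> bool" where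
  "wiener_integral M W f t Y \<longleftrightarrow>
      Y \<in> borel_measurable M \<and> integrable M (\<lambda>\<omega>. (Y \<omega>)\<^sup>2)
    \<and> (\<lambda>m. \<integral>\<omega>. (Y \<omega> - riemann_ito_sum W f t m \<omega>)\<^sup>2 \<partial>M) \<longlonglongrightarrow> 0"

definition state_sol ::
  "'a measure \<Rightarrow> (real \<Rightarrow> 'a \<Rightarrow> real) \<Rightarrow> real \<Rightarrow> (real \<Rightarrow> real) \<Rightarrow> real \<Rightarrow> real \<Rightarrow> real \<Rightarrow> real
   \<Rightarrow> (real \<Rightarrow> 'a \<Rightarrow> real) \<Rightarrow> (real \<Rightarrow> 'a \<Rightarrow> real) \<Rightarrow> bool" where
  "state_sol M W T K \<alpha> \<beta> \<sigma> X0 u X \<longleftrightarrow>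
      (\<lambda>z. X (snd z) (fst z)) \<in> borel_measurable (OT M T)
    \<and> integrable (OT M T) (\<lambda>z. (X (snd z) (fst z))\<^sup>2)
    \<and> (\<forall>t\<in>{0..T}. X t \<in> borel_measurable M \<and>
         (\<exists>Z. wiener_integral M W (\<lambda>s. K (t - s)) t Z \<and>
           (AE \<omega> in M.
              set_integrable lborel {0..t} (\<lambda>s. K (t - s) * (\<alpha> * u s \<omega> - \<beta> * X s \<omega>))
            \<and> X t \<omega> = X0 + (LINT s:{0..t}|lborel. K (t - s) * (\<alpha> * u s \<omega> - \<beta> * X s \<omega>))
                       + \<sigma> * Z \<omega>)))"

definition Jfun ::
  "'a measure \<Rightarrow> (real \<Rightarrow> 'a \<Rightarrow> real) \<Rightarrow> real \<Rightarrow> (real \<Rightarrow> real) \<Rightarrow> real \<Rightarrow> real \<Rightarrow> real \<Rightarrow> real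
   \<Rightarrow> real \<Rightarrow> real \<Rightarrow> (real \<Rightarrow> 'a \<Rightarrow> real) \<Rightarrow> real" where
  "Jfun M W T K \<alpha> \<beta> \<sigma> X0 a1 a2 u =
     (let X = (SOME X. state_sol M W T K \<alpha> \<beta> \<sigma> X0 u X) in
      \<integral>\<omega>. (- (LINT s:{0..T}|lborel. a1 * (u s \<omega>)\<^sup>2) + a2 * X T \<omega>) \<partial>M)"

definition holder_on :: "real \<Rightarrow> real set \<Rightarrow> (real \<Rightarrow> real) \<Rightarrow> bool" where
  "holder_on h S f \<longleftrightarrow> (\<exists>C. \<forall>s\<in>S. \<forall>t\<in>S. \<bar>f s - f t\<bar> \<le> C * \<bar>s - t\<bar> powr h)"

definition kappa :: "real \<Rightarrow> (real \<Rightarrow> real) \<Rightarrow> nat \<Rightarrow> nat \<Rightarrow> real" where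
  "kappa T K n k = (1 / T ^ k) *
     (\<Sum>i=0..k. (-1) ^ (k - i) * K (real i * T / real n) * real (n choose i) * real ((n - i) choose (k - i)))"

definition L2fun :: "(real \<Rightarrow> real) \<Rightarrow> bool" where
  "L2fun f \<longleftrightarrow> f \<in> borel_measurable lborel \<and> integrable lborel (\<lambda>x. (f x)\<^sup>2)"

definition inner_L2 :: "(real \<Rightarrow> real) \<Rightarrow> (real \<Rightarrow> real) \<Rightarrow> real" where
  "inner_L2 f g = (\<integral>x. f x * g x \<partial>lborel)"

definition shiftA :: "(real \<Rightarrow> real) \<Rightarrow> real \<Rightarrow> real" where
  "shiftA f = (\<lambda>x. f (x + 1))"

definition nu :: "real \<Rightarrow> real" where
  "nu = indicator {0..1}"

definition g_fun :: "real \<Rightarrow> (real \<Rightarrow> real) \<Rightarrow> nat \<Rightarrow> real \<Rightarrow> real" where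
  "g_fun T K n = (\<lambda>x. \<Sum>k=0..n. fact k * kappa T K n k * indicator {- real k .. - real k + 1} x)"

definition Abar :: "real \<Rightarrow> (real \<Rightarrow> real) \<Rightarrow> (real \<Rightarrow> real) \<Rightarrow> real \<Rightarrow> real" where
  "Abar \<beta> g f = (\<lambda>x. shiftA f x - \<beta> * inner_L2 g f * nu x)"

definition opexp :: "((real \<Rightarrow> real) \<Rightarrow> (real \<Rightarrow> real)) \<Rightarrow> real \<Rightarrow> (real \<Rightarrow> real) \<Rightarrow> real \<Rightarrow> real" where
  "opexp B \<tau> v = (SOME f. L2fun f \<and>
      (\<lambda>N. \<integral>x. (f x - (\<Sum>j<N. \<tau> ^ j / fact j * (B ^^ j) v x))\<^sup>2 \<partial>lborel) \<longlonglongrightarrow> 0)"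

definition u_hat_n :: "real \<Rightarrow> (real \<Rightarrow> real) \<Rightarrow> real \<Rightarrow> real \<Rightarrow> real \<Rightarrow> real \<Rightarrow> nat \<Rightarrow> real \<Rightarrow> real" where
  "u_hat_n T K \<alpha> \<beta> a1 a2 n t =
     \<alpha> * a2 / (2 * a1) * inner_L2 (g_fun T K n) (opexp (Abar \<beta> (g_fun T K n)) (T - t) nu)"

end

theory Submission
  imports Defs
begin

text \<open>
  Let \<open>r\<close> solve \<open>r = K - \<beta> K * r\<close> on \<open>[0, T]\<close>, with \<open>*\<close> the Volterra convolution. The mean
  of the state solves a deterministic Volterra equation, which \<open>r\<close> inverts: \<open>E X(T) = c + \<alpha> \<integral> r(T - s) E u(s) ds\<close>.
  So \<open>J\<close> is a strictly concave quadratic functional of \<open>u\<close>, and completing the square shows that its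
  unique maximiser is the deterministic control \<open>\<alpha> a\<^sub>2 / (2 a\<^sub>1) r(T - t)\<close>. The pairing
  \<open>\<langle>g\<^sub>n, exp(\<tau> A\<^sub>n) \<nu>\<rangle>\<close> is a power series in \<open>\<tau>\<close> whose coefficients satisfy the recursion of the
  resolvent of the Bernstein polynomial \<open>K\<^sub>n\<close>. Since \<open>K\<^sub>n \<rightarrow> K\<close> uniformly, Gronwall's inequality
  gives uniform convergence of the resolvents, which is more than weak convergence.
\<close>

section \<open>Volterra convolution and resolvents\<close>

text \<open>Two obstacles shape the development. \<open>Jfun\<close> picks its state by
  \<open>SOME\<close>, so a state must be constructed for every control, and all states of one
  control must share the mean terminal value. The construction needs a version of the noise that is
  jointly measurable in \<omega> and time and square integrable on the product space. The Hoelder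
  condition supplies it: Riemann-Ito sums along dyadic partitions have summable L2 differences and
  so converge almost surely for each fixed time. On the operator side, \<open>shiftA\<close> applied
  j times to \<open>nu\<close> is the indicator of [-j, -j+1], which pairs with the n-th functional
  to j! times the j-th Bernstein coefficient. Hence the Bernstein polynomial at t is the pairing of
  that functional with exp(t A) applied to \<open>nu\<close>. Subtracting the rank-one term from A
  turns this, by Duhamel's formula, into the Volterra equation of the resolvent.\<close>

definition vconv :: "(real \<Rightarrow> real) \<Rightarrow> (real \<Rightarrow> real) \<Rightarrow> real \<Rightarrow> real" where
  "vconv f g t = (LINT s:{0..t}|lborel. f (t - s) * g s)"

lemma continuous_on_Icc_bounded:
  fixes f :: "real \<Rightarrow> real"
  assumes "continuous_on {a..b} f"
  shows "\<exists>B\<ge>0. \<forall>s\<in>{a..b}. \<bar>f s\<bar> \<le> B"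
proof -
  obtain B where B: "\<forall>x\<in>f ` {a..b}. norm x \<le> B"
    using compact_imp_bounded[OF compact_continuous_image[OF assms compact_Icc]]
    unfolding bounded_iff by blast
  \<comment> \<open>The interval may be empty, and then \<open>B\<close> may be negative.\<close>
  then have "\<forall>s\<in>{a..b}. \<bar>f s\<bar> \<le> max B 0" by (auto simp: le_max_iff_disj)
  then show ?thesis by (intro exI[of _ "max B 0"]) simp
qed

lemma set_integrable_mult_continuous:
  fixes f g :: "real \<Rightarrow> real"
  assumes "continuous_on {a..b} f" and g: "set_integrable lborel {a..b} g"
  shows "set_integrable lborel {a..b} (\<lambda>s. f s * g s)"
proof -
  obtain B where B: "\<And>s. s \<in> {a..b} \<Longrightarrow> \<bar>f s\<bar> \<le> B"
    using continuous_on_Icc_bounded[OF assms(1)] by blast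
  have f: "(\<lambda>s. indicator {a..b} s *\<^sub>R f s) \<in> borel_measurable borel"
    by (rule borel_measurable_continuous_on_indicator[OF _ assms(1)]) simp
  have g': "(\<lambda>s. indicator {a..b} s *\<^sub>R g s) \<in> borel_measurable borel"
    using g by (auto simp: set_integrable_def)
  have eq: "(\<lambda>s. indicator {a..b} s *\<^sub>R (f s * g s)) =
      (\<lambda>s. (indicator {a..b} s *\<^sub>R f s) * (indicator {a..b} s *\<^sub>R g s))"
    by (auto simp: indicator_def)
  show ?thesis
    unfolding set_integrable_def
  proof (rule Bochner_Integration.integrable_bound)
    show "integrable lborel (\<lambda>s. B * (indicator {a..b} s *\<^sub>R g s))"
      using g unfolding set_integrable_def by (rule integrable_mult_right)
    show "(\<lambda>s. indicator {a..b} s *\<^sub>R (f s * g s)) \<in> borel_measurable lborel"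
      unfolding eq using f g' by measurable
    show "AE s in lborel. norm (indicator {a..b} s *\<^sub>R (f s * g s))
        \<le> norm (B * (indicator {a..b} s *\<^sub>R g s))"
    proof (rule AE_I2)
      fix s show "norm (indicator {a..b} s *\<^sub>R (f s * g s)) \<le> norm (B * (indicator {a..b} s *\<^sub>R g s))"
        using B[of s] by (auto simp: indicator_def abs_mult intro!: mult_right_mono)
    qed
  qed
qed

lemma set_integrable_vconv:
  fixes f g :: "real \<Rightarrow> real"
  assumes "continuous_on {0..T} f" "set_integrable lborel {0..T} g" "t \<in> {0..T}"
  shows "set_integrable lborel {0..t} (\<lambda>s. f (t - s) * g s)"
proof (rule set_integrable_mult_continuous)
  show "continuous_on {0..t} (\<lambda>s. f (t - s))"
    by (rule continuous_on_compose2[OF assms(1)]) (use assms(3) in \<open>auto intro!: continuous_intros\<close>)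
  show "set_integrable lborel {0..t} g"
    by (rule set_integrable_subset[OF assms(2)]) (use assms(3) in auto)
qed

lemma set_integrable_continuous_Icc:
  fixes f :: "real \<Rightarrow> real"
  assumes "continuous_on {a..b} f"
  shows "set_integrable lborel {a..b} f"
  unfolding set_integrable_def using borel_integrable_compact[OF compact_Icc assms] by simp

lemma vconv_bound:
  assumes "continuous_on {0..T} f" "set_integrable lborel {0..T} g" "t \<in> {0..T}"
    and B: "\<And>s. s \<in> {0..T} \<Longrightarrow> \<bar>f s\<bar> \<le> B"
  shows "\<bar>vconv f g t\<bar> \<le> B * (LINT s:{0..t}|lborel. \<bar>g s\<bar>)"
proof -
  note i = set_integrable_vconv[OF assms(1-3)]
  have g: "set_integrable lborel {0..t} (\<lambda>s. \<bar>g s\<bar>)"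
    by (rule set_integrable_abs, rule set_integrable_subset[OF assms(2)]) (use assms(3) in auto)
  have "\<bar>vconv f g t\<bar> \<le> (LINT s:{0..t}|lborel. \<bar>f (t - s) * g s\<bar>)"
    unfolding vconv_def using set_integral_norm_bound[OF i] by simp
  also have "\<dots> \<le> (LINT s:{0..t}|lborel. B * \<bar>g s\<bar>)"
  proof (rule set_integral_mono)
    show "set_integrable lborel {0..t} (\<lambda>s. \<bar>f (t - s) * g s\<bar>)"
      by (rule set_integrable_abs[OF i])
    show "set_integrable lborel {0..t} (\<lambda>s. B * \<bar>g s\<bar>)" using g by simp
    fix s assume "s \<in> {0..t}"
    then show "\<bar>f (t - s) * g s\<bar> \<le> B * \<bar>g s\<bar>"
      using B[of "t - s"] assms(3) by (auto simp: abs_mult intro!: mult_right_mono)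
  qed
  finally show ?thesis by simp
qed

text \<open>Extending both factors by zero replaces the moving limits by a fixed domain: for t \<le>
  T the two indicators are both nonzero exactly when 0 \<le> s \<le> t. Fubini and translation
  invariance can be applied to this form.\<close>

lemma vconv_full_line:
  assumes "t \<le> T"
  shows "vconv f g t = (\<integral>s. (indicator {0..T} (t - s) * f (t - s)) * (indicator {0..T} s * g s) \<partial>lborel)"
  unfolding vconv_def set_lebesgue_integral_def
  by (rule Bochner_Integration.integral_cong) (use assms in \<open>auto simp: indicator_def\<close>)

lemma vconv_commute: "vconv f g t = vconv g f t"
proof -
  have "vconv f g t = (\<integral>s. indicator {0..t} s *\<^sub>R (f (t - s) * g s) \<partial>lborel)"
    by (simp add: vconv_def set_lebesgue_integral_def)
  also have "\<dots> = (\<integral>s. indicator {0..t} (t - s) *\<^sub>R (f (t - (t - s)) * g (t - s)) \<partial>lborel)"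
    using lborel_integral_real_affine[of "-1" "\<lambda>s. indicator {0..t} s *\<^sub>R (f (t - s) * g s)" t] by simp
  also have "\<dots> = vconv g f t"
    unfolding vconv_def set_lebesgue_integral_def
    by (rule Bochner_Integration.integral_cong) (auto simp: indicator_def)
  finally show ?thesis .
qed

lemma vconv_neg: "t < 0 \<Longrightarrow> vconv f g t = 0"
  by (simp add: vconv_def set_lebesgue_integral_def)

lemma vconv_measurable_indicator:
  assumes f: "continuous_on {0..T} f" and g: "set_integrable lborel {0..T} g"
  shows "(\<lambda>t. indicator {0..T} t * vconv f g t) \<in> borel_measurable borel"
proof -
  have [measurable]: "(\<lambda>s. indicator {0..T} s * f s) \<in> borel_measurable borel"
    using borel_measurable_continuous_on_indicator[OF _ f] by simp
  have [measurable]: "(\<lambda>s. indicator {0..T} s * g s) \<in> borel_measurable borel"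
    using g by (auto simp: set_integrable_def)
  have "(\<lambda>t. indicator {0..T} t * (\<integral>s. (indicator {0..T} (t - s) * f (t - s)) * (indicator {0..T} s * g s) \<partial>lborel))
     \<in> borel_measurable borel"
    by measurable
  also have "?this \<longleftrightarrow> ?thesis"
    by (rule arg_cong[where f="\<lambda>h. h \<in> borel_measurable borel"])
      (auto simp: fun_eq_iff indicator_def[of "{0..T}" "_::real"] vconv_full_line[of _ T])
  finally show ?thesis .
qed

lemma vconv_integrable:
  assumes f: "continuous_on {0..T} f" and g: "set_integrable lborel {0..T} g"
  shows "set_integrable lborel {0..T} (vconv f g)"
proof -
  obtain B where B: "\<And>s. s \<in> {0..T} \<Longrightarrow> \<bar>f s\<bar> \<le> B"
    using continuous_on_Icc_bounded[OF assms(1)] by blast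
  have bound: "\<bar>vconv f g t\<bar> \<le> B * (LINT s:{0..T}|lborel. \<bar>g s\<bar>)" if t: "t \<in> {0..T}" for t
  proof -
    have "\<bar>vconv f g t\<bar> \<le> B * (LINT s:{0..t}|lborel. \<bar>g s\<bar>)"
      by (rule vconv_bound[OF f g t B])
    also have "\<dots> \<le> B * (LINT s:{0..T}|lborel. \<bar>g s\<bar>)"
    proof (rule mult_left_mono)
      show "0 \<le> B" using B[OF t] by simp
      show "(LINT s:{0..t}|lborel. \<bar>g s\<bar>) \<le> (LINT s:{0..T}|lborel. \<bar>g s\<bar>)"
        unfolding set_lebesgue_integral_def
      proof (rule integral_mono)
        show "integrable lborel (\<lambda>s. indicator {0..T} s *\<^sub>R \<bar>g s\<bar>)"
          using set_integrable_abs[OF g] by (simp add: set_integrable_def)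
        show "integrable lborel (\<lambda>s. indicator {0..t} s *\<^sub>R \<bar>g s\<bar>)"
          using set_integrable_subset[OF set_integrable_abs[OF g], of "{0..t}"] t by (simp add: set_integrable_def)
        show "indicator {0..t} s *\<^sub>R \<bar>g s\<bar> \<le> indicator {0..T} s *\<^sub>R \<bar>g s\<bar>" for s
          using t by (auto simp: indicator_def)
      qed
    qed
    finally show ?thesis .
  qed
  show ?thesis
    unfolding set_integrable_def
  proof (rule Bochner_Integration.integrable_bound)
    show "integrable lborel (\<lambda>t. indicator {0..T} t *\<^sub>R (B * (LINT s:{0..T}|lborel. \<bar>g s\<bar>)))"
      using set_integrable_continuous_Icc[OF continuous_on_const] by (simp add: set_integrable_def)
    show "(\<lambda>t. indicator {0..T} t *\<^sub>R vconv f g t) \<in> borel_measurable lborel"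
      using vconv_measurable_indicator[OF f g] by simp
    show "AE t in lborel. norm (indicator {0..T} t *\<^sub>R vconv f g t)
        \<le> norm (indicator {0..T} t *\<^sub>R (B * (LINT s:{0..T}|lborel. \<bar>g s\<bar>)))"
      using bound by (intro AE_I2) (fastforce simp: indicator_def)
  qed
qed

text \<open>Both sides are the planar integral of \<open>F (t - s) * G (s - v) * H v\<close>, with
  the factors extended by zero. Fubini exchanges the order, and the shift of s by v turns the inner
  integral into a convolution at t - v. The last factor is merely integrable so that paths and means
  of processes are covered.\<close>

lemma vconv_assoc:
  assumes f: "continuous_on {0..T} f" and g: "continuous_on {0..T} g"
    and h: "set_integrable lborel {0..T} h" and t: "t \<in> {0..T}"
  shows "vconv f (vconv g h) t = vconv (vconv f g) h t"
proof -
  define F where "F = (\<lambda>s. indicator {0..T} s * f s)"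
  define G where "G = (\<lambda>s. indicator {0..T} s * g s)"
  define H where "H = (\<lambda>s. indicator {0..T} s * h s)"
  have [measurable]: "F \<in> borel_measurable borel" "G \<in> borel_measurable borel"
    unfolding F_def G_def
    using borel_measurable_continuous_on_indicator[OF _ f] borel_measurable_continuous_on_indicator[OF _ g] by simp_all
  have H: "integrable lborel H"
    using h by (simp add: set_integrable_def H_def)
  then have [measurable]: "H \<in> borel_measurable borel"
    by auto
  obtain A where A: "\<And>s. s \<in> {0..T} \<Longrightarrow> \<bar>f s\<bar> \<le> A"
    using continuous_on_Icc_bounded[OF f] by blast
  obtain B where B: "\<And>s. s \<in> {0..T} \<Longrightarrow> \<bar>g s\<bar> \<le> B"
    using continuous_on_Icc_bounded[OF g] by blast
  have A0: "0 \<le> A" and B0: "0 \<le> B" using A[OF t] B[OF t] by auto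
  \<comment> \<open>Boundedness alone would not make the planar integrand integrable in s.
    \<open>F (t - s)\<close> vanishes unless t - T \<le> s \<le> t, and this range lies in
    \<open>{-T..T}\<close>.\<close>
  have F_le: "\<bar>F (t - s)\<bar> \<le> A * indicator {-T..T} s" for s
    using A[of "t - s"] A0 t by (auto simp: F_def indicator_def)
  have G_le: "\<bar>G s\<bar> \<le> B" for s
    using B[of s] B0 by (auto simp: G_def indicator_def)
  let ?\<Phi> = "\<lambda>(s, v). F (t - s) * (G (s - v) * H v)"
  have int: "integrable (lborel \<Otimes>\<^sub>M lborel) ?\<Phi>"
  proof (rule Bochner_Integration.integrable_bound)
    have 1: "integrable lborel (\<lambda>s. A * indicator {-T..T} s :: real)"
      by (intro integrable_mult_right integrable_real_indicator) (auto simp: emeasure_lborel_Icc_eq)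
    show "integrable (lborel \<Otimes>\<^sub>M lborel) (\<lambda>(s, v). (A * indicator {-T..T} s) * (B * H v))"
    proof (rule lborel_pair.Fubini_integrable)
      show "(\<lambda>(s, v). (A * indicator {-T..T} s) * (B * H v)) \<in> borel_measurable (lborel \<Otimes>\<^sub>M lborel)"
        by measurable
      show "integrable lborel (\<lambda>s. LINT v|lborel. norm (case (s, v) of (s, v) \<Rightarrow> (A * indicator {-T..T} s) * (B * H v)))"
        using 1 A0 by (simp add: abs_mult)
      show "AE s in lborel. integrable lborel (\<lambda>v. case (s, v) of (s, v) \<Rightarrow> (A * indicator {-T..T} s) * (B * H v))"
        using H by (intro AE_I2) simp
    qed
    show "?\<Phi> \<in> borel_measurable (lborel \<Otimes>\<^sub>M lborel)"
      by measurable
    show "AE x in lborel \<Otimes>\<^sub>M lborel. norm (?\<Phi> x) \<le> norm (case x of (s, v) \<Rightarrow> (A * indicator {-T..T} s) * (B * H v))"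
    proof (rule AE_I2, clarsimp simp: abs_mult)
      fix s v
      have "\<bar>F (t - s)\<bar> * (\<bar>G (s - v)\<bar> * \<bar>H v\<bar>) \<le> (A * indicator {-T..T} s) * (B * \<bar>H v\<bar>)"
        using F_le[of s] G_le[of "s - v"] A0 B0 by (intro mult_mono mult_nonneg_nonneg) auto
      then show "\<bar>F (t - s)\<bar> * (\<bar>G (s - v)\<bar> * \<bar>H v\<bar>) \<le> \<bar>A\<bar> * indicat_real {-T..T} s * (\<bar>B\<bar> * \<bar>H v\<bar>)"
        using A0 B0 by simp
    qed
  qed
  have "vconv f (vconv g h) t = (\<integral>s. F (t - s) * (indicator {0..T} s * vconv g h s) \<partial>lborel)"
    using t by (subst vconv_full_line[of _ T]) (auto simp: F_def)
  also have "\<dots> = (\<integral>s. (\<integral>v. F (t - s) * (G (s - v) * H v) \<partial>lborel) \<partial>lborel)"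
  proof (rule Bochner_Integration.integral_cong[OF refl])
    fix s
    show "F (t - s) * (indicator {0..T} s * vconv g h s) = (\<integral>v. F (t - s) * (G (s - v) * H v) \<partial>lborel)"
    \<comment> \<open>For s > t the factor \<open>F (t - s)\<close> is zero. For s \<le> t the
      whole-line formula applies, and at negative s the convolution vanishes together with the
      indicator.\<close>
    proof (cases "0 \<le> t - s")
      case True
      with t have sT: "s \<le> T" by auto
      then have "(\<integral>v. G (s - v) * H v \<partial>lborel) = vconv g h s"
        by (subst vconv_full_line[of _ T]) (auto simp: G_def H_def)
      also have "\<dots> = indicator {0..T} s * vconv g h s"
        using sT by (auto simp: indicator_def vconv_neg)
      finally show ?thesis by simp
    qed (simp add: F_def)
  qed
  also have "\<dots> = (\<integral>v. (\<integral>s. F (t - s) * (G (s - v) * H v) \<partial>lborel) \<partial>lborel)"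
    using lborel_pair.Fubini_integral[OF int] by simp
  also have "\<dots> = (\<integral>v. (indicator {0..T} (t - v) * vconv f g (t - v)) * H v \<partial>lborel)"
  proof (rule Bochner_Integration.integral_cong[OF refl])
    fix v
    have "(\<integral>s. F (t - s) * (G (s - v) * H v) \<partial>lborel) = (\<integral>s. F (t - s) * G (s - v) \<partial>lborel) * H v"
      by (simp flip: mult.assoc)
    also have "(\<integral>s. F (t - s) * G (s - v) \<partial>lborel) = (\<integral>s. F (t - v - s) * G s \<partial>lborel)"
      using lborel_integral_real_affine[of 1 "\<lambda>s. F (t - s) * G (s - v)" v]
      by (simp add: algebra_simps)
    finally have *: "(\<integral>s. F (t - s) * (G (s - v) * H v) \<partial>lborel) = (\<integral>s. F (t - v - s) * G s \<partial>lborel) * H v" .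
    show "(\<integral>s. F (t - s) * (G (s - v) * H v) \<partial>lborel) = (indicator {0..T} (t - v) * vconv f g (t - v)) * H v"
    proof (cases "0 \<le> v")
      case True
      with t have "t - v \<le> T" by auto
      then have "(\<integral>s. F (t - v - s) * G s \<partial>lborel) = vconv f g (t - v)"
        by (subst vconv_full_line[of _ T]) (auto simp: F_def G_def)
      also have "\<dots> = indicator {0..T} (t - v) * vconv f g (t - v)"
        using \<open>t - v \<le> T\<close> by (auto simp: indicator_def vconv_neg)
      finally show ?thesis using * by simp
    qed (simp add: H_def *)
  qed
  also have "\<dots> = vconv (vconv f g) h t"
    using t by (subst vconv_full_line[of _ T]) (auto simp: H_def)
  finally show ?thesis .
qed

lemma vconv_cong:
  assumes "\<And>s. s \<in> {0..t} \<Longrightarrow> f s = f' s" "\<And>s. s \<in> {0..t} \<Longrightarrow> g s = g' s"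
  shows "vconv f g t = vconv f' g' t"
  unfolding vconv_def by (rule set_lebesgue_integral_cong) (use assms in auto)

lemma vconv_add_right:
  assumes "continuous_on {0..T} f" "set_integrable lborel {0..T} g" "set_integrable lborel {0..T} h" "t \<in> {0..T}"
  shows "vconv f (\<lambda>s. g s + h s) t = vconv f g t + vconv f h t"
  using set_integral_add(2)[OF set_integrable_vconv[OF assms(1,2,4)] set_integrable_vconv[OF assms(1,3,4)]]
  by (simp add: vconv_def algebra_simps)

lemma vconv_diff_right:
  assumes "continuous_on {0..T} f" "set_integrable lborel {0..T} g" "set_integrable lborel {0..T} h" "t \<in> {0..T}"
  shows "vconv f (\<lambda>s. g s - h s) t = vconv f g t - vconv f h t"
  using set_integral_diff(2)[OF set_integrable_vconv[OF assms(1,2,4)] set_integrable_vconv[OF assms(1,3,4)]]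
  by (simp add: vconv_def algebra_simps)

lemma vconv_scale_right: "vconv f (\<lambda>s. c * g s) t = c * vconv f g t"
  by (simp add: vconv_def mult.left_commute[of _ c])

lemma vconv_diff_left:
  assumes "continuous_on {0..T} f" "continuous_on {0..T} g" "set_integrable lborel {0..T} h" "t \<in> {0..T}"
  shows "vconv (\<lambda>s. f s - g s) h t = vconv f h t - vconv g h t"
  using set_integral_diff(2)[OF set_integrable_vconv[OF assms(1,3,4)] set_integrable_vconv[OF assms(2,3,4)]]
  by (simp add: vconv_def algebra_simps)

lemma vconv_scale_left: "vconv (\<lambda>s. c * f s) g t = c * vconv f g t"
  by (simp add: vconv_def mult.assoc)

text \<open>With this normalisation \<open>x + \<beta> K * x = f\<close> is equivalent to \<open>x = f - \<beta> r * f\<close>.\<close>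

definition resolvent_on :: "real \<Rightarrow> real \<Rightarrow> (real \<Rightarrow> real) \<Rightarrow> (real \<Rightarrow> real) \<Rightarrow> bool" where
  "resolvent_on T \<beta> K r \<longleftrightarrow> continuous_on {0..T} r \<and> (\<forall>t\<in>{0..T}. r t = K t - \<beta> * vconv K r t)"

text \<open>Convolve the resolvent equation with f and regroup K * r * f, either as K * (r * f) or,
  after commuting K and r, as r * (K * f). The first form shows that the resolvent formula solves a
  Volterra equation, the second that it is the only solution.\<close>

lemma vconv_resolvent:
  assumes K: "continuous_on {0..T} K" and r: "resolvent_on T \<beta> K r"
    and f: "set_integrable lborel {0..T} f" and t: "t \<in> {0..T}"
  shows "vconv K f t = vconv r f t + \<beta> * vconv K (vconv r f) t"
    and "vconv K f t = vconv r f t + \<beta> * vconv r (vconv K f) t"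
proof -
  have rc: "continuous_on {0..T} r" and req: "\<And>t. t \<in> {0..T} \<Longrightarrow> r t = K t - \<beta> * vconv K r t"
    using r by (auto simp: resolvent_on_def)
  have "vconv (\<lambda>s. K s - r s) f t = vconv K f t - vconv r f t"
    by (rule vconv_diff_left[OF K rc f t])
  moreover have "vconv (\<lambda>s. K s - r s) f t = vconv (\<lambda>s. \<beta> * vconv K r s) f t"
    by (rule vconv_cong) (use req t in auto)
  ultimately have *: "vconv K f t = vconv r f t + \<beta> * vconv (vconv K r) f t"
    by (simp add: vconv_scale_left)
  then show "vconv K f t = vconv r f t + \<beta> * vconv K (vconv r f) t"
    by (simp add: vconv_assoc[OF K rc f t])
  have "vconv (vconv K r) f t = vconv (vconv r K) f t"
    by (rule vconv_cong) (simp_all add: vconv_commute)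
  then show "vconv K f t = vconv r f t + \<beta> * vconv r (vconv K f) t"
    using * by (simp add: vconv_assoc[OF rc K f t])
qed

lemma volterra_solution:
  assumes K: "continuous_on {0..T} K" and r: "resolvent_on T \<beta> K r"
    and f: "set_integrable lborel {0..T} f" and t: "t \<in> {0..T}"
  shows "f t - \<beta> * vconv r f t = f t - \<beta> * vconv K (\<lambda>s. f s - \<beta> * vconv r f s) t"
proof -
  have rc: "continuous_on {0..T} r" using r by (auto simp: resolvent_on_def)
  have "vconv K (\<lambda>s. f s - \<beta> * vconv r f s) t = vconv K f t - vconv K (\<lambda>s. \<beta> * vconv r f s) t"
    by (rule vconv_diff_right[OF K f _ t]) (simp add: vconv_integrable[OF rc f])
  then show ?thesis
    using vconv_resolvent(1)[OF assms] by (simp add: vconv_scale_right)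
qed

text \<open>Inserting f = x + \<beta> K * x into r * f and using the second resolvent identity
  leaves r * f = K * x.\<close>

lemma volterra_unique:
  assumes K: "continuous_on {0..T} K" and r: "resolvent_on T \<beta> K r"
    and x: "set_integrable lborel {0..T} x" and t: "t \<in> {0..T}"
    and eq: "\<And>s. s \<in> {0..T} \<Longrightarrow> x s = f s - \<beta> * vconv K x s"
  shows "x t = f t - \<beta> * vconv r f t"
proof -
  have rc: "continuous_on {0..T} r" using r by (auto simp: resolvent_on_def)
  have "vconv r f t = vconv r (\<lambda>s. x s + \<beta> * vconv K x s) t"
    by (rule vconv_cong) (use eq t in auto)
  also have "\<dots> = vconv r x t + \<beta> * vconv r (vconv K x) t"
    by (subst vconv_add_right[OF rc x _ t]) (simp_all add: vconv_integrable[OF K x] vconv_scale_right)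
  also have "\<dots> = vconv K x t"
    using vconv_resolvent(2)[OF K r x t] by simp
  finally show ?thesis using eq[OF t] by simp
qed

text \<open>Weighted maximum argument: let \<bar>\<phi> t\<bar> exp(-l t) be maximal at u. Bounding
  \<phi> under the integral by this maximum makes the integral term at u at most b / l times
  \<bar>\<phi> u\<bar>. With l = 2 b + 1 the ratio is at most 1/2, so the term is absorbed on the
  left at the price of the factor 2; the summand 1 keeps l positive when b = 0.\<close>

lemma gronwall_Icc:
  fixes \<phi> :: "real \<Rightarrow> real"
  assumes \<phi>: "continuous_on {0..T} \<phi>" and "0 \<le> b" and "0 \<le> a"
    and le: "\<And>t. t \<in> {0..T} \<Longrightarrow> \<bar>\<phi> t\<bar> \<le> a + b * (LINT s:{0..t}|lborel. \<bar>\<phi> s\<bar>)"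
    and t: "t \<in> {0..T}"
  shows "\<bar>\<phi> t\<bar> \<le> 2 * a * exp ((2 * b + 1) * T)"
proof -
  define l where "l = 2 * b + 1"
  have l: "0 < l" "b / l \<le> 1/2" using \<open>0 \<le> b\<close> by (auto simp: l_def field_simps)
  have "continuous_on {0..T} (\<lambda>t. \<bar>\<phi> t\<bar> * exp (- l * t))"
    using \<phi> by (intro continuous_intros)
  then obtain u where u: "u \<in> {0..T}" and max: "\<And>s. s \<in> {0..T} \<Longrightarrow> \<bar>\<phi> s\<bar> * exp (- l * s) \<le> \<bar>\<phi> u\<bar> * exp (- l * u)"
    using continuous_attains_sup[OF compact_Icc, of 0 T "\<lambda>t. \<bar>\<phi> t\<bar> * exp (- l * t)"] t by blast
  define m where "m = \<bar>\<phi> u\<bar> * exp (- l * u)"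
  have m0: "0 \<le> m" by (simp add: m_def)
  have le_m: "\<bar>\<phi> s\<bar> \<le> m * exp (l * s)" if "s \<in> {0..T}" for s
    using max[OF that] by (simp add: m_def exp_minus field_simps)
  have sub: "continuous_on {0..u} \<phi>" by (rule continuous_on_subset[OF \<phi>]) (use u in auto)
  have "((\<lambda>s. m * exp (l * s)) has_integral (m * exp (l * u) / l - m * exp (l * 0) / l)) {0..u}"
    using u l by (intro fundamental_theorem_of_calculus)
      (auto intro!: derivative_eq_intros simp flip: has_real_derivative_iff_has_vector_derivative)
  from integral_unique[OF this]
  have I: "(LINT s:{0..u}|lborel. m * exp (l * s)) = m * exp (l * u) / l - m * exp (l * 0) / l"
    by (subst set_borel_integral_eq_integral(2)[OF set_integrable_continuous_Icc])
      (auto intro!: continuous_intros simp only:)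
  have "(LINT s:{0..u}|lborel. \<bar>\<phi> s\<bar>) \<le> (LINT s:{0..u}|lborel. m * exp (l * s))"
    using sub u by (intro set_integral_mono set_integrable_continuous_Icc le_m continuous_intros) auto
  also have "\<dots> \<le> m * exp (l * u) / l"
    unfolding I using m0 l by simp
  finally have "b * (LINT s:{0..u}|lborel. \<bar>\<phi> s\<bar>) \<le> b * (m * exp (l * u) / l)"
    using \<open>0 \<le> b\<close> by (rule mult_left_mono)
  then have "\<bar>\<phi> u\<bar> \<le> a + b * (m * exp (l * u) / l)"
    using le[OF u] by linarith
  also have "b * (m * exp (l * u) / l) = (b / l) * (m * exp (l * u))" by simp
  also have "\<dots> \<le> (1/2) * (m * exp (l * u))"
    using l m0 by (intro mult_right_mono) auto
  also have "m * exp (l * u) = \<bar>\<phi> u\<bar>"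
    by (simp add: m_def exp_minus field_simps)
  finally have "\<bar>\<phi> u\<bar> \<le> 2 * a" by simp
  moreover have "m \<le> \<bar>\<phi> u\<bar>"
    unfolding m_def using u l by (intro mult_left_le) auto
  ultimately have "m \<le> 2 * a" by simp
  have "\<bar>\<phi> t\<bar> \<le> m * exp (l * t)" by (rule le_m[OF t])
  also have "\<dots> \<le> (2 * a) * exp (l * T)"
    using \<open>m \<le> 2 * a\<close> m0 t l by (intro mult_mono) auto
  finally show ?thesis by (simp add: l_def)
qed

lemma vconv_uniform_limit:
  assumes K: "continuous_on {0..T} K" and f: "\<And>n. continuous_on {0..T} (f n)"
    and lim: "uniform_limit {0..T} f g sequentially" and t: "t \<in> {0..T}"
  shows "(\<lambda>n. vconv K (f n) t) \<longlonglongrightarrow> vconv K g t"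
proof -
  have g: "continuous_on {0..T} g"
    by (rule uniform_limit_theorem[OF _ lim]) (use f in auto)
  obtain B where B: "\<And>s. s \<in> {0..T} \<Longrightarrow> \<bar>K s\<bar> \<le> B"
    using continuous_on_Icc_bounded[OF K] by blast
  have B0: "0 \<le> B" using B[OF t] by simp
  show ?thesis
  proof (rule LIMSEQ_I)
    fix e :: real assume e: "0 < e"
    \<comment> \<open>The summand 1 keeps the denominator positive when \<open>B * T\<close> is
      zero, and it yields the strict inequality at the end.\<close>
    define d where "d = e / (B * T + 1)"
    have BT: "0 \<le> B * T" using B0 t by auto
    then have d: "0 < d" using e by (simp add: d_def)
    obtain N where N: "\<And>n s. N \<le> n \<Longrightarrow> s \<in> {0..T} \<Longrightarrow> \<bar>f n s - g s\<bar> < d"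
      using uniform_limitD[OF lim d] unfolding eventually_sequentially dist_real_def by blast
    have "norm (vconv K (f n) t - vconv K g t) < e" if n: "N \<le> n" for n
    proof -
      have fg: "continuous_on {0..T} (\<lambda>s. f n s - g s)" using f g by (intro continuous_intros)
      have "vconv K (f n) t - vconv K g t = vconv K (\<lambda>s. f n s - g s) t"
        by (rule vconv_diff_right[OF K _ _ t, symmetric]; rule set_integrable_continuous_Icc) (use f g in auto)
      also have "\<bar>\<dots>\<bar> \<le> B * (LINT s:{0..t}|lborel. \<bar>f n s - g s\<bar>)"
        by (rule vconv_bound[OF K set_integrable_continuous_Icc[OF fg] t B])
      also have "\<dots> \<le> B * (LINT s:{0..t}|lborel. d)"
      proof (intro mult_left_mono set_integral_mono set_integrable_continuous_Icc)
        show "continuous_on {0..t} (\<lambda>s. \<bar>f n s - g s\<bar>)"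
          by (rule continuous_on_rabs, rule continuous_on_subset[OF fg]) (use t in auto)
      qed (use N[OF n] t B0 in \<open>auto intro!: less_imp_le\<close>)
      also have "(LINT s:{0..t}|lborel. d) = t * d"
        using t by (subst set_integral_const) (auto simp: measure_def)
      also have "B * (t * d) \<le> (B * T) * d"
        using t B0 d by (auto simp: mult.assoc intro!: mult_left_mono mult_right_mono)
      also have "\<dots> < (B * T + 1) * d" using d by simp
      also have "\<dots> = e" using BT by (simp add: d_def)
      finally show ?thesis by simp
    qed
    then show "\<exists>N. \<forall>n\<ge>N. norm (vconv K (f n) t - vconv K g t) < e" by blast
  qed
qed

section \<open>Power series solutions of the resolvent equation\<close>

lemma vconv_sum_right:
  assumes f: "continuous_on {0..T} f" and t: "t \<in> {0..T}" and "finite I"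
    and g: "\<And>i. i \<in> I \<Longrightarrow> set_integrable lborel {0..T} (g i)"
  shows "vconv f (\<lambda>s. \<Sum>i\<in>I. g i s) t = (\<Sum>i\<in>I. vconv f (g i) t)"
  using \<open>finite I\<close> g
proof (induction I rule: finite_induct)
  case empty
  then show ?case by (simp add: vconv_def)
next
  case (insert i I)
  have "set_integrable lborel {0..T} (\<lambda>s. \<Sum>i\<in>I. g i s)"
    using insert.prems unfolding set_integrable_def scaleR_sum_right
    by (intro Bochner_Integration.integrable_sum) auto
  then have "vconv f (\<lambda>s. g i s + (\<Sum>i\<in>I. g i s)) t = vconv f (g i) t + vconv f (\<lambda>s. \<Sum>i\<in>I. g i s) t"
    using insert.prems by (intro vconv_add_right[OF f _ _ t]) auto
  then show ?case using insert by simp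
qed

lemma DERIV_power_div_fact:
  "((\<lambda>s::real. s ^ Suc j / fact (Suc j)) has_real_derivative s ^ j / fact j) (at s within S)"
  by (rule DERIV_cong[OF DERIV_cdivide[OF DERIV_pow]]) (simp del: of_nat_Suc)

text \<open>The Beta integral in normalised form. Integration by parts moves one degree from the
  left factor to the right one, hence the induction on i with k arbitrary; the boundary terms vanish
  because one of the two positive powers is taken at 0 at either end.\<close>

lemma vconv_powers:
  assumes "0 \<le> t"
  shows "vconv (\<lambda>s. s ^ i / fact i) (\<lambda>s. s ^ k / fact k) t = t ^ (i + k + 1) / fact (i + k + 1)"
proof (induction i arbitrary: k)
  case 0
  have "(LINT s:{0..t}|lborel. s ^ k / fact k) = t ^ (k + 1) / fact (k + 1) - 0 ^ (k + 1) / fact (k + 1)"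
    unfolding set_lebesgue_integral_def
    using assms DERIV_power_div_fact[of k]
    by (intro integral_FTC_Icc)
      (auto intro!: continuous_intros simp flip: has_real_derivative_iff_has_vector_derivative)
  then show ?case by (simp add: vconv_def)
next
  case (Suc i)
  let ?p = "\<lambda>j s. s ^ j / fact j :: real"
  have int: "set_integrable lborel {0..t} (\<lambda>s. ?p j (t - s) * ?p l s)" for j l
    by (intro set_integrable_continuous_Icc continuous_intros) auto
  have "(LINT s:{0..t}|lborel. ?p (Suc i) (t - s) * ?p k s - ?p i (t - s) * ?p (Suc k) s)
      = ?p (Suc i) (t - t) * ?p (Suc k) t - ?p (Suc i) (t - 0) * ?p (Suc k) 0"
    unfolding set_lebesgue_integral_def
  proof (rule integral_FTC_Icc[OF assms])
    fix s
    have "((\<lambda>s. t - s) has_real_derivative - 1) (at s)"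
      by (auto intro!: derivative_eq_intros)
    from DERIV_chain2[OF DERIV_power_div_fact this]
    have "((\<lambda>s. ?p (Suc i) (t - s)) has_real_derivative ?p i (t - s) * - 1) (at s)" .
    from DERIV_mult[OF this DERIV_power_div_fact[of k s UNIV]]
    have "((\<lambda>s. ?p (Suc i) (t - s) * ?p (Suc k) s) has_real_derivative
        ?p (Suc i) (t - s) * ?p k s - ?p i (t - s) * ?p (Suc k) s) (at s)"
      by (rule DERIV_cong) (simp only: mult_minus_right mult_1_right mult_minus_left mult.commute diff_conv_add_uminus add.commute)
    then show "((\<lambda>s. ?p (Suc i) (t - s) * ?p (Suc k) s) has_vector_derivative
        ?p (Suc i) (t - s) * ?p k s - ?p i (t - s) * ?p (Suc k) s) (at s within {0..t})"
      unfolding has_real_derivative_iff_has_vector_derivative by (rule has_vector_derivative_at_within)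
  qed (intro continuous_intros; simp)
  then have "vconv (?p (Suc i)) (?p k) t - vconv (?p i) (?p (Suc k)) t = 0"
    unfolding vconv_def by (subst (asm) set_integral_diff(2)[OF int int]) simp
  then show ?case using Suc.IH[of "Suc k"] by simp
qed

text \<open>Comparison of coefficients. Normalised powers convolve by adding exponents plus one, so
  the coefficient of t^j / j! in K * r is the sum in \<open>rec\<close>, and \<open>rec\<close> is
  the resolvent equation in degree j. The geometric bound on b gives uniform convergence on the
  interval, which allows the series to be convolved term by term.\<close>

lemma power_series_resolvent:
  fixes b c :: "nat \<Rightarrow> real"
  assumes rec: "\<And>j. b j = c j - \<beta> * (\<Sum>i<j. b i * c (j - 1 - i))"
    and c0: "\<And>j. n < j \<Longrightarrow> c j = 0"
    and bound: "\<And>j. \<bar>b j\<bar> \<le> A * D ^ j" and "0 \<le> D"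
  shows "resolvent_on T \<beta> (\<lambda>t. \<Sum>k\<le>n. c k / fact k * t ^ k) (\<lambda>t. \<Sum>j. t ^ j / fact j * b j)"
    (is "resolvent_on T \<beta> ?K ?r")
proof -
  let ?p = "\<lambda>j s. s ^ j / fact j :: real"
  define P where "P N t = (\<Sum>j<N. ?p j t * b j)" for N t
  have A0: "0 \<le> A" using bound[of 0] by simp
  have le: "norm (?p j t * b j) \<le> A * ((T * D) ^ j / fact j)" if "t \<in> {0..T}" for t j
  proof -
    have "norm (?p j t * b j) \<le> ?p j t * (A * D ^ j)"
      using that bound[of j] by (auto simp: abs_mult intro!: mult_left_mono divide_right_mono)
    also have "\<dots> \<le> ?p j T * (A * D ^ j)"
      using that A0 \<open>0 \<le> D\<close> by (intro mult_right_mono divide_right_mono power_mono) auto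
    finally show ?thesis by (simp add: power_mult_distrib mult_ac)
  qed
  have sm: "summable (\<lambda>j. A * ((T * D) ^ j / fact j))"
    using summable_exp[of "T * D"] by (intro summable_mult) (simp add: divide_inverse mult.commute)
  have lim: "uniform_limit {0..T} P ?r sequentially"
    unfolding P_def by (rule Weierstrass_m_test[OF le sm])
  have Pc: "continuous_on {0..T} (P N)" for N
    unfolding P_def by (intro continuous_intros) auto
  have rc: "continuous_on {0..T} ?r"
    by (rule uniform_limit_theorem[OF _ lim]) (use Pc in auto)
  have "?r t = ?K t - \<beta> * vconv ?K ?r t" if t: "t \<in> {0..T}" for t
  proof -
    have pc: "continuous_on {0..T} (?p i)" for i
      by (intro continuous_intros) auto
    \<comment> \<open>Zeros in front index the series by total degree, so that the finitely many
      series for different i can be added termwise.\<close>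
    have conv_p: "(\<lambda>m. if i \<le> m then b (m - i) * ?p (m + 1) t else 0) sums vconv (?p i) ?r t" for i
    proof -
      have "vconv (?p i) (P N) t = (\<Sum>j<N. b j * ?p (j + i + 1) t)" for N
      proof -
        have "vconv (?p i) (P N) t = (\<Sum>j<N. vconv (?p i) (\<lambda>s. b j * ?p j s) t)"
          unfolding P_def mult.commute[of _ "b _"]
          by (rule vconv_sum_right[OF pc t]) (auto intro!: set_integrable_continuous_Icc continuous_intros)
        also have "\<dots> = (\<Sum>j<N. b j * ?p (j + i + 1) t)"
          unfolding vconv_scale_right using t by (subst vconv_powers) (auto simp: add.commute)
        finally show ?thesis .
      qed
      with vconv_uniform_limit[OF pc Pc lim t, of i]
      have "(\<lambda>j. b j * ?p (j + i + 1) t) sums vconv (?p i) ?r t"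
        by (simp add: sums_def)
      then have *: "(\<lambda>j. if i \<le> j + i then b (j + i - i) * ?p (j + i + 1) t else 0) sums vconv (?p i) ?r t"
        by simp
      show ?thesis
        by (rule iffD1[OF sums_zero_iff_shift[of i] *]) simp
    qed
    have "vconv ?K ?r t = vconv ?r (\<lambda>s. \<Sum>k\<le>n. c k * ?p k s) t"
      by (subst vconv_commute) (simp add: mult.commute)
    also have "\<dots> = (\<Sum>k\<le>n. vconv ?r (\<lambda>s. c k * ?p k s) t)"
      by (rule vconv_sum_right[OF rc t]) (auto intro!: set_integrable_continuous_Icc continuous_intros)
    also have "\<dots> = (\<Sum>k\<le>n. c k * vconv (?p k) ?r t)"
      by (simp only: vconv_scale_right vconv_commute[of ?r])
    finally have V: "vconv ?K ?r t = (\<Sum>k\<le>n. c k * vconv (?p k) ?r t)" .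
    have "(\<lambda>m. \<Sum>k\<le>n. c k * (if k \<le> m then b (m - k) * ?p (m + 1) t else 0)) sums vconv ?K ?r t"
      unfolding V by (intro sums_sum sums_mult conv_p)
    then have "(\<lambda>m. \<beta> * (\<Sum>k\<le>n. c k * (if k \<le> m then b (m - k) * ?p (m + 1) t else 0))) sums (\<beta> * vconv ?K ?r t)"
      by (rule sums_mult)
    moreover have "\<beta> * (\<Sum>k\<le>n. c k * (if k \<le> m then b (m - k) * ?p (m + 1) t else 0))
        = ?p (Suc m) t * (c (Suc m) - b (Suc m))" for m
    proof -
      \<comment> \<open>The ranges up to n and up to m are compared inside their union: c vanishes
        beyond n, and the conditional vanishes beyond m.\<close>
      have "(\<Sum>k\<le>n. c k * (if k \<le> m then b (m - k) * ?p (m + 1) t else 0))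
          = (\<Sum>k\<le>max n m. c k * (if k \<le> m then b (m - k) * ?p (m + 1) t else 0))"
        by (rule sum.mono_neutral_left) (auto intro: c0)
      also have "\<dots> = (\<Sum>k\<le>m. c k * (if k \<le> m then b (m - k) * ?p (m + 1) t else 0))"
        by (rule sum.mono_neutral_right) auto
      also have "\<dots> = ?p (Suc m) t * (\<Sum>k<Suc m. c k * b (m - k))"
        unfolding sum_distrib_left lessThan_Suc_atMost by (intro sum.cong) (auto simp: mult_ac)
      also have "(\<Sum>k<Suc m. c k * b (m - k)) = (\<Sum>k<Suc m. c (Suc m - Suc k) * b (m - (Suc m - Suc k)))"
        by (rule sum.nat_diff_reindex[symmetric])
      also have "\<dots> = (\<Sum>k<Suc m. b k * c (Suc m - 1 - k))"
        by (intro sum.cong) auto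
      finally show ?thesis using rec[of "Suc m"] by simp
    qed
    ultimately have "(\<lambda>m. ?p (Suc m) t * (c (Suc m) - b (Suc m))) sums (\<beta> * vconv ?K ?r t)"
      by simp
    \<comment> \<open>The convolution has no term of degree 0; the one inserted here is zero because
      \<open>rec\<close> at 0 says \<open>b 0 = c 0\<close>.\<close>
    then have "(\<lambda>m. ?p m t * (c m - b m)) sums (\<beta> * vconv ?K ?r t + ?p 0 t * (c 0 - b 0))"
      by (rule sums_Suc)
    then have 1: "(\<lambda>m. ?p m t * c m - ?p m t * b m) sums (\<beta> * vconv ?K ?r t)"
      using rec[of 0] by (simp only: right_diff_distrib) simp
    have "summable (\<lambda>m. ?p m t * b m)"
      by (rule summable_comparison_test'[OF sm]) (rule le[OF t])
    then have 2: "(\<lambda>m. ?p m t * b m) sums ?r t" by (rule summable_sums)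
    have "(\<lambda>m. ?p m t * c m) sums (\<Sum>m\<le>n. ?p m t * c m)"
      by (rule sums_finite) (auto intro: c0)
    also have "(\<Sum>m\<le>n. ?p m t * c m) = ?K t" by (simp add: mult.commute)
    finally have 3: "(\<lambda>m. ?p m t * c m) sums ?K t" .
    from sums_unique2[OF sums_diff[OF 3 2] 1] show ?thesis by simp
  qed
  with rc show ?thesis by (auto simp: resolvent_on_def)
qed

lemma Cauchy_Schwarz_integral:
  fixes f g :: "'a \<Rightarrow> real"
  assumes [measurable]: "f \<in> borel_measurable M" "g \<in> borel_measurable M"
    and f: "integrable M (\<lambda>x. (f x)\<^sup>2)" and g: "integrable M (\<lambda>x. (g x)\<^sup>2)"
  shows "integrable M (\<lambda>x. f x * g x)"
    and "(\<integral>x. f x * g x \<partial>M)\<^sup>2 \<le> (\<integral>x. (f x)\<^sup>2 \<partial>M) * (\<integral>x. (g x)\<^sup>2 \<partial>M)"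
proof -
  have "\<bar>a * b\<bar> \<le> a\<^sup>2 + b\<^sup>2" for a b :: real
  proof -
    have "2 * \<bar>a * b\<bar> \<le> a\<^sup>2 + b\<^sup>2"
      using sum_squares_bound[of "\<bar>a\<bar>" "\<bar>b\<bar>"] by (simp add: abs_mult mult.assoc)
    then show ?thesis using abs_ge_zero[of "a * b"] by linarith
  qed
  then show fg: "integrable M (\<lambda>x. f x * g x)"
    by (intro Bochner_Integration.integrable_bound[OF Bochner_Integration.integrable_add[OF f g]]) (auto intro!: AE_I2)
  let ?A = "\<integral>x. (f x)\<^sup>2 \<partial>M" and ?B = "\<integral>x. f x * g x \<partial>M" and ?C = "\<integral>x. (g x)\<^sup>2 \<partial>M"
  have q: "0 \<le> z\<^sup>2 * ?A + 2 * z * ?B + ?C" for z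
  proof -
    have "0 \<le> (\<integral>x. (z * f x + g x)\<^sup>2 \<partial>M)" by simp
    also have "\<dots> = (\<integral>x. z\<^sup>2 * (f x)\<^sup>2 + 2 * z * (f x * g x) + (g x)\<^sup>2 \<partial>M)"
      by (simp add: power2_eq_square algebra_simps)
    also have "\<dots> = z\<^sup>2 * ?A + 2 * z * ?B + ?C"
      using f g fg by simp
    finally show ?thesis .
  qed
  have A0: "0 \<le> ?A" by simp
  show "?B\<^sup>2 \<le> ?A * ?C"
  proof (cases "?A = 0")
    case True
    have "?B = 0"
    proof (rule ccontr)
      assume "?B \<noteq> 0"
      \<comment> \<open>With \<open>?A = 0\<close> the quadratic is affine in z, and this z would
        give it the value -1.\<close>
      then have "2 * (- (?C + 1) / (2 * ?B)) * ?B = - (?C + 1)" by simp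
      then show False using q[of "- (?C + 1) / (2 * ?B)"] True by simp
    qed
    then show ?thesis using True by simp
  next
    case False
    then have "0 < ?A" using A0 by linarith
    then show ?thesis using q[of "- ?B / ?A"] by (simp add: field_simps power2_eq_square)
  qed
qed

section \<open>Operator exponential and Bernstein approximation\<close>

text \<open>Decay weight for the iterates of \<open>Abar \<beta> g\<close> on \<open>nu\<close>: it is square integrable, dominates
  \<open>nu\<close>, and grows at most by the factor 3 under the shift.\<close>

definition wgt :: "real \<Rightarrow> real" where
  "wgt x = 2 / (1 + x\<^sup>2)"

lemma wgt_pos: "0 < wgt x"
  by (simp add: wgt_def add_pos_nonneg)

lemma wgt_le_2: "wgt x \<le> 2"
  by (simp add: wgt_def divide_le_eq add_pos_nonneg)

lemma wgt_shift: "wgt (x + 1) \<le> 3 * wgt x"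
proof -
  \<comment> \<open>Twice the difference of the two sides is (2x + 3)^2 + 1.\<close>
  have "1 + x\<^sup>2 \<le> 3 * (1 + (x + 1)\<^sup>2)"
    using zero_le_power2[of "2 * x + 3"] by (simp add: power2_eq_square algebra_simps)
  then show ?thesis
    by (simp add: wgt_def divide_le_eq le_divide_eq add_pos_nonneg field_simps)
qed

lemma nu_le_wgt: "\<bar>nu x\<bar> \<le> wgt x"
proof (cases "x \<in> {0..1}")
  case True
  \<comment> \<open>This is why the numerator of \<open>wgt\<close> is 2: it makes the weight at
    least 1 on [0, 1].\<close>
  then have "x\<^sup>2 \<le> 1" by (simp add: power_le_one)
  then show ?thesis using True by (simp add: nu_def wgt_def le_divide_eq add_pos_nonneg)
qed (use wgt_pos[of x] in \<open>simp add: nu_def\<close>)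

lemma wgt_measurable [measurable]: "wgt \<in> borel_measurable borel"
  unfolding wgt_def by measurable

lemma wgt_square_integrable: "integrable lborel (\<lambda>x. (wgt x)\<^sup>2)"
proof (rule Bochner_Integration.integrable_bound)
  have "integrable lborel (\<lambda>x::real. inverse (1 + x\<^sup>2))"
    using integrable_inverse_1_plus_square by (simp add: set_integrable_def einterval_def)
  then show "integrable lborel (\<lambda>x::real. 4 * inverse (1 + x\<^sup>2))"
    by simp
  show "AE x in lborel. norm ((wgt x)\<^sup>2) \<le> norm (4 * inverse (1 + x\<^sup>2))"
  proof (rule AE_I2)
    fix x :: real
    have "wgt x * wgt x \<le> 2 * wgt x"
      using wgt_le_2 wgt_pos[of x] by (intro mult_right_mono) auto
    then show "norm ((wgt x)\<^sup>2) \<le> norm (4 * inverse (1 + x\<^sup>2))"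
      by (simp add: power2_eq_square[of "wgt x"]) (simp add: wgt_def divide_inverse)
  qed
qed measurable

lemma nu_measurable [measurable]: "nu \<in> borel_measurable borel"
  unfolding nu_def by measurable

text \<open>Discrete Duhamel formula for a rank-one perturbation of the shift. Every application
  shifts what is already there and injects a new multiple of \<open>nu\<close>; the multiple
  injected in step i has been shifted j - 1 - i times after j steps.\<close>

lemma Abar_pow_nu:
  "(Abar \<beta> g ^^ j) nu x = nu (x + real j) -
     \<beta> * (\<Sum>i<j. inner_L2 g ((Abar \<beta> g ^^ i) nu) * nu (x + real (j - 1 - i)))"
proof (induction j arbitrary: x)
  case (Suc j)
  have "(\<Sum>i<j. inner_L2 g ((Abar \<beta> g ^^ i) nu) * nu (x + 1 + real (j - 1 - i)))
      = (\<Sum>i<j. inner_L2 g ((Abar \<beta> g ^^ i) nu) * nu (x + real (j - i)))"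
  proof (intro sum.cong refl)
    fix i assume "i \<in> {..<j}"
    then have "x + 1 + real (j - 1 - i) = x + real (j - i)" by (simp add: of_nat_diff)
    then show "inner_L2 g ((Abar \<beta> g ^^ i) nu) * nu (x + 1 + real (j - 1 - i))
      = inner_L2 g ((Abar \<beta> g ^^ i) nu) * nu (x + real (j - i))" by (simp only:)
  qed
  moreover have "(Abar \<beta> g ^^ Suc j) nu x = (Abar \<beta> g ^^ j) nu (x + 1) - \<beta> * inner_L2 g ((Abar \<beta> g ^^ j) nu) * nu x"
    by (simp add: Abar_def shiftA_def)
  ultimately show ?case
    by (simp add: Suc.IH algebra_simps)
qed simp

lemma Abar_pow_nu_measurable [measurable]: "(Abar \<beta> g ^^ j) nu \<in> borel_measurable borel"
proof -
  have "(\<lambda>x. nu (x + real j) - \<beta> * (\<Sum>i<j. inner_L2 g ((Abar \<beta> g ^^ i) nu) * nu (x + real (j - 1 - i))))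
    \<in> borel_measurable borel"
    by measurable
  then show ?thesis by (subst Abar_pow_nu[abs_def])
qed

text \<open>Everything needed of \<open>g_fun T K n\<close> besides the values \<open>\<langle>g, \<nu>(\<cdot> + l)\<rangle>\<close> is that it is
  measurable, bounded and compactly supported.\<close>

locale bounded_support_functional =
  fixes g :: "real \<Rightarrow> real" and G a b \<beta> :: real
  assumes g_meas [measurable]: "g \<in> borel_measurable borel"
    and g_le: "\<And>x. \<bar>g x\<bar> \<le> G * indicator {a..b} x"
    and beta_pos: "0 < \<beta>" and G0: "0 \<le> G" and ab: "a \<le> b"
begin

text \<open>As \<open>wgt\<close> is at most 2, \<open>Cg\<close> bounds the pairing of g with any
  function dominated by \<open>wgt\<close>. \<open>D\<close> is the growth per application of
  \<open>Abar \<beta> g\<close>, measured against \<open>wgt\<close>: 3 for the shift and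
  \<open>\<beta> * Cg\<close> for the rank-one term.\<close>

definition Cg :: real where "Cg = 2 * G * (b - a)"
definition D :: real where "D = 3 + \<beta> * Cg"

lemma Cg0: "0 \<le> Cg" using G0 ab by (simp add: Cg_def)

lemma D0: "0 \<le> D" using Cg0 beta_pos by (auto simp: D_def)

lemma indicator_integrable: "integrable lborel (\<lambda>x. c * indicator {a..b} x :: real)"
  by (intro integrable_mult_right integrable_real_indicator) (auto simp: emeasure_lborel_Icc_eq)

lemma integrable_g_mult:
  assumes [measurable]: "f \<in> borel_measurable borel" and "\<And>x. \<bar>f x\<bar> \<le> c * wgt x"
  shows "integrable lborel (\<lambda>x. g x * f x)" and "\<bar>inner_L2 g f\<bar> \<le> c * Cg"
proof -
  have "0 \<le> c * wgt 0" using assms(2)[of 0] by (rule order_trans[OF abs_ge_zero])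
  then have c0: "0 \<le> c" using wgt_pos[of 0] by (simp add: zero_le_mult_iff)
  have le: "\<bar>g x * f x\<bar> \<le> (c * (2 * G)) * indicator {a..b} x" for x
  proof -
    have "\<bar>f x\<bar> \<le> c * 2"
      using assms(2)[of x] wgt_le_2[of x] c0 by (meson mult_left_mono order_trans)
    then have "\<bar>g x\<bar> * \<bar>f x\<bar> \<le> (G * indicator {a..b} x) * (c * 2)"
      using g_le[of x] G0 by (intro mult_mono) auto
    then show ?thesis by (simp add: abs_mult mult_ac)
  qed
  show "integrable lborel (\<lambda>x. g x * f x)"
  proof (rule Bochner_Integration.integrable_bound[OF indicator_integrable[of "c * (2 * G)"]])
    show "AE x in lborel. norm (g x * f x) \<le> norm (c * (2 * G) * indicat_real {a..b} x)"
      using le by (intro AE_I2) (metis abs_ge_self order_trans real_norm_def)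
  qed measurable
  have "\<bar>inner_L2 g f\<bar> \<le> (\<integral>x. \<bar>g x * f x\<bar> \<partial>lborel)"
    unfolding inner_L2_def by (rule integral_abs_bound)
  also have "\<dots> \<le> (\<integral>x. (c * (2 * G)) * indicator {a..b} x \<partial>lborel)"
    using le c0 G0 by (intro integral_mono'[OF indicator_integrable]) auto
  also have "\<dots> = c * Cg"
    using ab by (simp add: Cg_def)
  finally show "\<bar>inner_L2 g f\<bar> \<le> c * Cg" .
qed

text \<open>A pointwise substitute for an operator norm bound: all iterates stay below multiples of
  one square integrable profile, so the exponential series can be summed pointwise and its tails
  estimated in L2 at the same time.\<close>

lemma Abar_pow_nu_le: "\<bar>(Abar \<beta> g ^^ j) nu x\<bar> \<le> D ^ j * wgt x"
proof (induction j arbitrary: x)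
  case 0
  then show ?case by (simp add: nu_le_wgt)
next
  case (Suc j)
  let ?V = "(Abar \<beta> g ^^ j) nu"
  have "\<bar>(Abar \<beta> g ^^ Suc j) nu x\<bar> \<le> \<bar>?V (x + 1)\<bar> + \<beta> * (\<bar>inner_L2 g ?V\<bar> * \<bar>nu x\<bar>)"
    using beta_pos abs_triangle_ineq4[of "?V (x + 1)" "\<beta> * inner_L2 g ?V * nu x"]
    by (simp add: Abar_def shiftA_def abs_mult mult.assoc)
  also have "\<bar>?V (x + 1)\<bar> \<le> D ^ j * wgt (x + 1)" by (rule Suc.IH)
  also have "D ^ j * wgt (x + 1) \<le> D ^ j * (3 * wgt x)"
    using D0 by (intro mult_left_mono wgt_shift) auto
  also have "\<bar>inner_L2 g ?V\<bar> * \<bar>nu x\<bar> \<le> (D ^ j * Cg) * wgt x"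
    using D0 Cg0 integrable_g_mult(2)[OF _ Suc.IH] nu_le_wgt[of x] by (intro mult_mono) auto
  finally have "\<bar>(Abar \<beta> g ^^ Suc j) nu x\<bar> \<le> D ^ j * (3 * wgt x) + \<beta> * ((D ^ j * Cg) * wgt x)"
    using beta_pos by simp
  also have "\<dots> = D ^ Suc j * wgt x" by (simp add: D_def algebra_simps)
  finally show ?case .
qed

lemma inner_le: "\<bar>inner_L2 g ((Abar \<beta> g ^^ j) nu)\<bar> \<le> Cg * D ^ j"
  using integrable_g_mult(2)[OF _ Abar_pow_nu_le, of j] by (simp add: mult.commute)

text \<open>Pairing the Duhamel formula with g closes it into a scalar recursion, in the shape that
  \<open>power_series_resolvent\<close> expects.\<close>

lemma inner_rec:
  "inner_L2 g ((Abar \<beta> g ^^ j) nu) = inner_L2 g (\<lambda>x. nu (x + real j)) -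
     \<beta> * (\<Sum>i<j. inner_L2 g ((Abar \<beta> g ^^ i) nu) * inner_L2 g (\<lambda>x. nu (x + real (j - 1 - i))))"
proof -
  have I: "integrable lborel (\<lambda>x. g x * nu (x + y))" for y
  proof (rule Bochner_Integration.integrable_bound[OF indicator_integrable[of G]])
    show "AE x in lborel. norm (g x * nu (x + y)) \<le> norm (G * indicat_real {a..b} x)"
    proof (rule AE_I2)
      fix x
      have "\<bar>g x\<bar> * \<bar>nu (x + y)\<bar> \<le> G * indicat_real {a..b} x * 1"
        using g_le[of x] G0 by (intro mult_mono) (auto simp: nu_def indicator_def)
      then show "norm (g x * nu (x + y)) \<le> norm (G * indicat_real {a..b} x)"
        using G0 by (simp add: abs_mult)
    qed
  qed measurable
  have "inner_L2 g ((Abar \<beta> g ^^ j) nu) = (\<integral>x. g x * nu (x + real j) -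
     \<beta> * (\<Sum>i<j. inner_L2 g ((Abar \<beta> g ^^ i) nu) * (g x * nu (x + real (j - 1 - i)))) \<partial>lborel)"
    by (subst inner_L2_def, subst Abar_pow_nu[abs_def])
      (simp add: right_diff_distrib sum_distrib_left mult_ac)
  also have "\<dots> = (\<integral>x. g x * nu (x + real j) \<partial>lborel) -
     \<beta> * (\<Sum>i<j. inner_L2 g ((Abar \<beta> g ^^ i) nu) * (\<integral>x. g x * nu (x + real (j - 1 - i)) \<partial>lborel))"
    using I by simp
  finally show ?thesis by (simp add: inner_L2_def)
qed

lemma square_integrable_g: "integrable lborel (\<lambda>x. (g x)\<^sup>2)"
proof (rule Bochner_Integration.integrable_bound[OF indicator_integrable[of "G\<^sup>2"]])
  show "AE x in lborel. norm ((g x)\<^sup>2) \<le> norm (G\<^sup>2 * indicat_real {a..b} x)"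
  proof (rule AE_I2)
    fix x
    have "\<bar>g x\<bar>\<^sup>2 \<le> (G * indicat_real {a..b} x)\<^sup>2"
      by (rule power_mono[OF g_le]) simp
    also have "\<dots> = G\<^sup>2 * indicat_real {a..b} x" by (auto simp: indicator_def)
    finally show "norm ((g x)\<^sup>2) \<le> norm (G\<^sup>2 * indicat_real {a..b} x)"
      by simp
  qed
qed measurable

text \<open>\<open>opexp\<close> is defined by choice and says nothing until a limit is exhibited.
  The pointwise sum of the series is one: its tails are dominated by the tails of a scalar
  exponential series times \<open>wgt\<close>, whose square is integrable.\<close>

lemma opexp_exists:
  assumes "0 \<le> \<tau>"
  shows "\<exists>f. L2fun f \<and>
      (\<lambda>N. \<integral>x. (f x - (\<Sum>j<N. \<tau> ^ j / fact j * (Abar \<beta> g ^^ j) nu x))\<^sup>2 \<partial>lborel) \<longlonglongrightarrow> 0"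
proof (intro exI conjI)
  let ?V = "\<lambda>j x. \<tau> ^ j / fact j * (Abar \<beta> g ^^ j) nu x"
  let ?f = "\<lambda>x. \<Sum>j. ?V j x"
  let ?e = "\<lambda>j. (\<tau> * D) ^ j / fact j"
  have le: "norm (?V j x) \<le> ?e j * wgt x" for j x
  proof -
    have "norm (?V j x) \<le> \<tau> ^ j / fact j * (D ^ j * wgt x)"
      using assms Abar_pow_nu_le[of j x] by (auto simp: abs_mult intro!: divide_right_mono mult_left_mono)
    then show ?thesis by (simp add: power_mult_distrib mult_ac)
  qed
  have e: "summable ?e"
    using summable_exp[of "\<tau> * D"] by (simp add: divide_inverse mult.commute)
  have [measurable]: "?f \<in> borel_measurable borel" by measurable
  have tail: "\<bar>?f x - (\<Sum>j<N. ?V j x)\<bar> \<le> (suminf ?e - (\<Sum>j<N. ?e j)) * wgt x" for x N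
  proof -
    have s: "summable (\<lambda>j. norm (?V j x))"
      by (rule summable_comparison_test'[OF summable_mult2[OF e]]) (use le in simp)
    have eq: "?f x - (\<Sum>j<N. ?V j x) = (\<Sum>j. ?V (j + N) x)"
      using suminf_minus_initial_segment[OF summable_norm_cancel[OF s], of N] by simp
    have "\<bar>\<Sum>j. ?V (j + N) x\<bar> \<le> (\<Sum>j. norm (?V (j + N) x))"
      using summable_norm[of "\<lambda>j. ?V (j + N) x"] summable_ignore_initial_segment[OF s] by simp
    also have "\<dots> \<le> (\<Sum>j. ?e (j + N) * wgt x)"
      using le e summable_ignore_initial_segment[OF s, of N] summable_ignore_initial_segment[OF e, of N]
      by (intro suminf_le summable_mult2) auto
    also have "\<dots> = (\<Sum>j. ?e (j + N)) * wgt x"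
      by (rule suminf_mult2[symmetric]) (rule summable_ignore_initial_segment[OF e])
    also have "(\<Sum>j. ?e (j + N)) = suminf ?e - (\<Sum>j<N. ?e j)"
      by (rule suminf_minus_initial_segment[OF e])
    finally show ?thesis unfolding eq .
  qed
  have tail2: "(?f x - (\<Sum>j<N. ?V j x))\<^sup>2 \<le> (suminf ?e - (\<Sum>j<N. ?e j))\<^sup>2 * (wgt x)\<^sup>2" for x N
    using power_mono[OF tail[of x N], of 2] by (simp add: power_mult_distrib)
  show "L2fun ?f"
    unfolding L2fun_def
  proof (intro conjI Bochner_Integration.integrable_bound[OF integrable_mult_right[OF wgt_square_integrable]])
    show "AE x in lborel. norm ((?f x)\<^sup>2) \<le> norm ((suminf ?e)\<^sup>2 * (wgt x)\<^sup>2)"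
      using tail2[of _ 0] by (intro AE_I2) simp
  qed auto
  show "(\<lambda>N. \<integral>x. (?f x - (\<Sum>j<N. ?V j x))\<^sup>2 \<partial>lborel) \<longlonglongrightarrow> 0"
  proof (rule tendsto_sandwich[OF _ _ tendsto_const])
    show "\<forall>\<^sub>F N in sequentially. 0 \<le> (\<integral>x. (?f x - (\<Sum>j<N. ?V j x))\<^sup>2 \<partial>lborel)"
      by simp
    show "\<forall>\<^sub>F N in sequentially. (\<integral>x. (?f x - (\<Sum>j<N. ?V j x))\<^sup>2 \<partial>lborel)
        \<le> (\<integral>x. (suminf ?e - (\<Sum>j<N. ?e j))\<^sup>2 * (wgt x)\<^sup>2 \<partial>lborel)"
      by (intro always_eventually allI integral_mono'[OF integrable_mult_right[OF wgt_square_integrable]] tail2) simp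
    have "(\<lambda>N. (suminf ?e - (\<Sum>j<N. ?e j))\<^sup>2 * (\<integral>x. (wgt x)\<^sup>2 \<partial>lborel)) \<longlonglongrightarrow> (suminf ?e - suminf ?e)\<^sup>2 * (\<integral>x. (wgt x)\<^sup>2 \<partial>lborel)"
      by (intro tendsto_intros summable_LIMSEQ e)
    then show "(\<lambda>N. \<integral>x. (suminf ?e - (\<Sum>j<N. ?e j))\<^sup>2 * (wgt x)\<^sup>2 \<partial>lborel) \<longlonglongrightarrow> 0"
      by simp
  qed
qed

text \<open>The chosen limit is fixed only up to null sets, but its pairing with g does not see
  this: by Cauchy-Schwarz, L2 convergence of the partial sums forces convergence of their
  pairings.\<close>

lemma inner_opexp_sums:
  assumes "0 \<le> \<tau>"
  shows "(\<lambda>j. \<tau> ^ j / fact j * inner_L2 g ((Abar \<beta> g ^^ j) nu)) sums inner_L2 g (opexp (Abar \<beta> g) \<tau> nu)"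
proof -
  define f where "f = opexp (Abar \<beta> g) \<tau> nu"
  define S where "S N x = (\<Sum>j<N. \<tau> ^ j / fact j * (Abar \<beta> g ^^ j) nu x)" for N x
  have f: "L2fun f" and lim: "(\<lambda>N. \<integral>x. (f x - S N x)\<^sup>2 \<partial>lborel) \<longlonglongrightarrow> 0"
    using someI_ex[OF opexp_exists[OF assms]] unfolding f_def opexp_def S_def by auto
  have [measurable]: "f \<in> borel_measurable borel"
    using f by (simp add: L2fun_def)
  have [measurable]: "S N \<in> borel_measurable borel" for N
    unfolding S_def[abs_def] by measurable
  have V2: "integrable lborel (\<lambda>x. ((Abar \<beta> g ^^ j) nu x)\<^sup>2)" for j
  proof (rule Bochner_Integration.integrable_bound[OF integrable_mult_right[OF wgt_square_integrable]])
    show "AE x in lborel. norm (((Abar \<beta> g ^^ j) nu x)\<^sup>2) \<le> norm ((D ^ j)\<^sup>2 * (wgt x)\<^sup>2)"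
      using power_mono[OF Abar_pow_nu_le[of j] abs_ge_zero, where n = 2]
      by (intro AE_I2) (simp add: power_mult_distrib)
  qed measurable
  have S2: "integrable lborel (\<lambda>x. (S N x)\<^sup>2)" for N
  proof (induction N)
    case (Suc N)
    let ?v = "\<lambda>x. \<tau> ^ N / fact N * (Abar \<beta> g ^^ N) nu x"
    have v: "integrable lborel (\<lambda>x. (?v x)\<^sup>2)" using V2[of N] by (simp only: power_mult_distrib integrable_mult_right)
    have "integrable lborel (\<lambda>x. (S N x)\<^sup>2 + 2 * (S N x * ?v x) + (?v x)\<^sup>2)"
      by (intro Bochner_Integration.integrable_add integrable_mult_right Suc.IH v
          Cauchy_Schwarz_integral(1)[OF _ _ Suc.IH v]) measurable
    then show ?case by (simp only: S_def sum.lessThan_Suc power2_sum) (simp add: algebra_simps)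
  qed (simp add: S_def)
  \<comment> \<open>This cannot be read off from \<open>lim\<close>, since the Bochner integral of a
    nonintegrable function is 0; it comes from the square integrability of both terms.\<close>
  have fS2: "integrable lborel (\<lambda>x. (f x - S N x)\<^sup>2)" for N
  proof -
    have f2: "integrable lborel (\<lambda>x. (f x)\<^sup>2)" using f by (simp add: L2fun_def)
    have "integrable lborel (\<lambda>x. (f x)\<^sup>2 - 2 * (f x * S N x) + (S N x)\<^sup>2)"
      by (intro Bochner_Integration.integrable_add Bochner_Integration.integrable_diff integrable_mult_right S2 f2
          Cauchy_Schwarz_integral(1)[OF _ _ f2 S2]) measurable
    then show ?thesis by (simp only: power2_diff) (simp add: algebra_simps)
  qed
  have gf: "integrable lborel (\<lambda>x. g x * f x)"
    using f by (intro Cauchy_Schwarz_integral(1)[OF _ _ square_integrable_g]) (auto simp: L2fun_def)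
  have gV: "integrable lborel (\<lambda>x. g x * (Abar \<beta> g ^^ j) nu x)" for j
    by (intro integrable_g_mult(1)[OF _ Abar_pow_nu_le]) measurable
  have gS: "inner_L2 g f - (\<Sum>j<N. \<tau> ^ j / fact j * inner_L2 g ((Abar \<beta> g ^^ j) nu)) = (\<integral>x. g x * (f x - S N x) \<partial>lborel)" for N
  proof -
    have "(\<integral>x. g x * (f x - S N x) \<partial>lborel) = (\<integral>x. g x * f x - (\<Sum>j<N. \<tau> ^ j / fact j * (g x * (Abar \<beta> g ^^ j) nu x)) \<partial>lborel)"
      by (simp add: S_def right_diff_distrib sum_distrib_left mult_ac)
    also have "\<dots> = (\<integral>x. g x * f x \<partial>lborel) - (\<integral>x. (\<Sum>j<N. \<tau> ^ j / fact j * (g x * (Abar \<beta> g ^^ j) nu x)) \<partial>lborel)"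
      by (intro Bochner_Integration.integral_diff gf Bochner_Integration.integrable_sum integrable_mult_right gV)
    also have "(\<integral>x. (\<Sum>j<N. \<tau> ^ j / fact j * (g x * (Abar \<beta> g ^^ j) nu x)) \<partial>lborel)
        = (\<Sum>j<N. \<tau> ^ j / fact j * (\<integral>x. g x * (Abar \<beta> g ^^ j) nu x \<partial>lborel))"
      by (subst Bochner_Integration.integral_sum) (auto intro!: integrable_mult_right gV simp del: times_divide_eq_left)
    finally show ?thesis by (simp add: inner_L2_def)
  qed
  have "(\<lambda>N. inner_L2 g f - (\<Sum>j<N. \<tau> ^ j / fact j * inner_L2 g ((Abar \<beta> g ^^ j) nu))) \<longlonglongrightarrow> 0"
  proof (rule Lim_null_comparison)
    show "\<forall>\<^sub>F N in sequentially. norm (inner_L2 g f - (\<Sum>j<N. \<tau> ^ j / fact j * inner_L2 g ((Abar \<beta> g ^^ j) nu)))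
        \<le> sqrt ((\<integral>x. (g x)\<^sup>2 \<partial>lborel) * (\<integral>x. (f x - S N x)\<^sup>2 \<partial>lborel))"
      unfolding gS real_norm_def
      by (intro always_eventually allI real_le_rsqrt)
        (simp, intro Cauchy_Schwarz_integral(2)[OF _ _ square_integrable_g fS2], measurable)
    have "(\<lambda>N. sqrt ((\<integral>x. (g x)\<^sup>2 \<partial>lborel) * (\<integral>x. (f x - S N x)\<^sup>2 \<partial>lborel))) \<longlonglongrightarrow> sqrt ((\<integral>x. (g x)\<^sup>2 \<partial>lborel) * 0)"
      by (intro tendsto_intros lim)
    then show "(\<lambda>N. sqrt ((\<integral>x. (g x)\<^sup>2 \<partial>lborel) * (\<integral>x. (f x - S N x)\<^sup>2 \<partial>lborel))) \<longlonglongrightarrow> 0" by simp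
  qed
  from tendsto_diff[OF tendsto_const this, of "inner_L2 g f"]
  show ?thesis by (simp add: sums_def f_def)
qed

end

section \<open>The functionals of the Bernstein coefficients\<close>

lemma inner_indicator_unit:
  "(\<integral>x. indicator {- real k .. - real k + 1} x * nu (x + real j) \<partial>lborel) = (if k = j then 1 else 0 :: real)"
proof (cases "k = j")
  case True
  have "(\<integral>x. indicator {- real k .. - real k + 1} x * nu (x + real j) \<partial>lborel)
      = (\<integral>x. indicat_real {- real k .. - real k + 1} x \<partial>lborel)"
    by (rule Bochner_Integration.integral_cong) (auto simp: True nu_def indicator_def)
  also have "\<dots> = 1" by simp
  finally show ?thesis using True by simp
next
  case False
  \<comment> \<open>The intervals are closed, so for k and j differing by one they share an end
    point, and the integrand vanishes only almost everywhere.\<close>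
  have "AE x in lborel. x \<noteq> - real k \<and> x \<noteq> - real k + 1"
    using AE_lborel_singleton[of "- real k"] AE_lborel_singleton[of "- real k + 1"] by eventually_elim auto
  then have "AE x in lborel. indicator {- real k .. - real k + 1} x * nu (x + real j) = 0"
  proof eventually_elim
    case (elim x)
    show ?case
    proof (rule ccontr)
      assume "indicator {- real k .. - real k + 1} x * nu (x + real j) \<noteq> 0"
      then have "- real k < x" "x < - real k + 1" "- real j \<le> x" "x \<le> - real j + 1"
        using elim by (auto simp: nu_def indicator_def split: if_splits)
      then have "real k < real j + 1" "real j < real k + 1" by linarith+
      then show False using False by linarith
    qed
  qed
  then show ?thesis using False by (simp add: integral_eq_zero_AE)
qed

lemma g_fun_functional:
  assumes "0 < \<beta>"
  obtains G where "bounded_support_functional (g_fun T K n) G (- real n) 1 \<beta>"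
proof
  let ?G = "\<Sum>k=0..n. \<bar>fact k * kappa T K n k\<bar>"
  show "bounded_support_functional (g_fun T K n) ?G (- real n) 1 \<beta>"
  proof
    show "g_fun T K n \<in> borel_measurable borel" unfolding g_fun_def by measurable
    show "\<bar>g_fun T K n x\<bar> \<le> ?G * indicator {- real n..1} x" for x
      unfolding g_fun_def sum_distrib_right
      by (rule order_trans[OF sum_abs]) (auto intro!: sum_mono simp: indicator_def)
  qed (use assms in \<open>auto intro!: sum_nonneg\<close>)
qed

text \<open>The factor \<open>fact k\<close> in \<open>g_fun\<close> cancels the
  \<open>1 / fact k\<close> of the exponential series, and the vanishing beyond degree n makes the
  associated kernel a polynomial.\<close>

lemma inner_g_fun_shift_nu:
  "inner_L2 (g_fun T K n) (\<lambda>x. nu (x + real j)) = (if j \<le> n then fact j * kappa T K n j else 0)"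
proof -
  have I: "integrable lborel (\<lambda>x. indicator {- real k .. - real k + 1} x * nu (x + real j))" for k
  proof (rule Bochner_Integration.integrable_bound)
    show "integrable lborel (indicat_real {- real k .. - real k + 1})"
      by (rule integrable_real_indicator) (auto simp: emeasure_lborel_Icc_eq)
  qed (auto intro!: AE_I2 simp: nu_def indicator_def)
  have "inner_L2 (g_fun T K n) (\<lambda>x. nu (x + real j))
      = (\<integral>x. (\<Sum>k=0..n. fact k * kappa T K n k * (indicator {- real k .. - real k + 1} x * nu (x + real j))) \<partial>lborel)"
    unfolding inner_L2_def g_fun_def by (simp only: sum_distrib_right mult.assoc)
  also have "\<dots> = (\<Sum>k=0..n. fact k * kappa T K n k * (if k = j then 1 else 0))"
    using I by (simp add: inner_indicator_unit[simplified])
  finally show ?thesis by (simp add: if_distrib[of "\<lambda>x. _ * x"] cong: if_cong)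
qed

text \<open>\<open>u_hat_n\<close> at time t is a constant multiple of this function at T -
  t.\<close>

definition resolvent_bernstein :: "real \<Rightarrow> (real \<Rightarrow> real) \<Rightarrow> real \<Rightarrow> nat \<Rightarrow> real \<Rightarrow> real" where
  "resolvent_bernstein T K \<beta> n \<tau> = inner_L2 (g_fun T K n) (opexp (Abar \<beta> (g_fun T K n)) \<tau> nu)"

lemma resolvent_bernstein:
  assumes "0 < \<beta>"
  shows "resolvent_on T \<beta> (\<lambda>t. \<Sum>k\<le>n. kappa T K n k * t ^ k) (resolvent_bernstein T K \<beta> n)"
proof -
  obtain G where "bounded_support_functional (g_fun T K n) G (- real n) 1 \<beta>"
    using g_fun_functional[OF assms] .
  then interpret bounded_support_functional "g_fun T K n" G "- real n" 1 \<beta> .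
  let ?b = "\<lambda>j. inner_L2 (g_fun T K n) ((Abar \<beta> (g_fun T K n) ^^ j) nu)"
  let ?c = "\<lambda>j. inner_L2 (g_fun T K n) (\<lambda>x. nu (x + real j))"
  let ?s = "\<lambda>t. \<Sum>j. t ^ j / fact j * ?b j"
  have R: "resolvent_on T \<beta> (\<lambda>t. \<Sum>k\<le>n. ?c k / fact k * t ^ k) ?s"
    by (rule power_series_resolvent[OF inner_rec _ inner_le D0]) (simp add: inner_g_fun_shift_nu)
  have K: "(\<lambda>t. \<Sum>k\<le>n. ?c k / fact k * t ^ k) = (\<lambda>t. \<Sum>k\<le>n. kappa T K n k * t ^ k)"
    by (simp add: inner_g_fun_shift_nu)
  \<comment> \<open>The exponential is identified with its series only for nonnegative times, so
    continuity and convolutions are transferred by congruence on the interval.\<close>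
  have s: "resolvent_bernstein T K \<beta> n t = ?s t" if "t \<in> {0..T}" for t
    unfolding resolvent_bernstein_def using sums_unique[OF inner_opexp_sums[of t]] that by simp
  have "continuous_on {0..T} (resolvent_bernstein T K \<beta> n)"
    using R s by (subst continuous_on_cong[OF refl s]) (auto simp: resolvent_on_def)
  moreover have "vconv k (resolvent_bernstein T K \<beta> n) t = vconv k ?s t" if "t \<in> {0..T}" for t k
    by (rule vconv_cong) (use s that in auto)
  ultimately show ?thesis
    using R s unfolding K resolvent_on_def by auto
qed

section \<open>Uniform approximation by Bernstein polynomials\<close>

lemma kappa_bernstein:
  assumes "T \<noteq> 0"
  shows "(\<Sum>k\<le>n. kappa T K n k * t ^ k) = (\<Sum>k\<le>n. K (real k * T / real n) * Bernstein n k (t / T))"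
proof -
  let ?x = "t / T"
  let ?a = "\<lambda>i m. K (real i * T / real n) * real (n choose i) * real ((n - i) choose m) * (-1) ^ m * ?x ^ (i + m)"
  have "(\<Sum>k\<le>n. K (real k * T / real n) * Bernstein n k ?x) = (\<Sum>i\<le>n. \<Sum>m\<le>n - i. ?a i m)"
  proof (intro sum.cong refl)
    fix i
    have "(1 - ?x) ^ (n - i) = (\<Sum>m\<le>n - i. real ((n - i) choose m) * (- ?x) ^ m * 1 ^ (n - i - m))"
      using binomial_ring[of "- ?x" 1 "n - i"] by simp
    also have "\<dots> = (\<Sum>m\<le>n - i. real ((n - i) choose m) * ((-1) ^ m * ?x ^ m))"
      by (simp add: power_minus[of ?x] del: power_divide)
    finally have *: "(1 - ?x) ^ (n - i) = (\<Sum>m\<le>n - i. real ((n - i) choose m) * ((-1) ^ m * ?x ^ m))" .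
    show "K (real i * T / real n) * Bernstein n i ?x = (\<Sum>m\<le>n - i. ?a i m)"
      unfolding Bernstein_def * sum_distrib_left power_add by (intro sum.cong refl) (simp only: mult_ac)
  qed
  also have "\<dots> = (\<Sum>(i, m)\<in>(SIGMA i:{..n}. {..n - i}). ?a i m)"
    by (rule sum.Sigma) auto
  also have "(SIGMA i:{..n}. {..n - i}) = {(i, m). i + m \<le> n}" by auto
  \<comment> \<open>Here i is the Bernstein index and m the degree contributed by the expanded (1 -
    x)^(n - i); summing along i + m = k collects the coefficient of x^k.\<close>
  also have "(\<Sum>(i, m)\<in>{(i, m). i + m \<le> n}. ?a i m) = (\<Sum>k\<le>n. \<Sum>i\<le>k. ?a i (k - i))"
    by (rule sum.triangle_reindex_eq)
  also have "\<dots> = (\<Sum>k\<le>n. kappa T K n k * t ^ k)"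
  proof (intro sum.cong refl)
    fix k
    have "(\<Sum>i\<le>k. ?a i (k - i)) = (\<Sum>i\<le>k. ?x ^ k * ((-1) ^ (k - i) * K (real i * T / real n) * real (n choose i) * real ((n - i) choose (k - i))))"
      by (intro sum.cong refl) (auto simp: mult_ac simp del: power_divide)
    also have "\<dots> = ?x ^ k * (\<Sum>i=0..k. (-1) ^ (k - i) * K (real i * T / real n) * real (n choose i) * real ((n - i) choose (k - i)))"
      unfolding atMost_atLeast0 by (rule sum_distrib_left[symmetric])
    finally show "(\<Sum>i\<le>k. ?a i (k - i)) = kappa T K n k * t ^ k"
      unfolding kappa_def by (simp add: power_divide)
  qed
  finally show ?thesis by simp
qed

lemma bernstein_uniform_limit:
  assumes T: "0 < T" and K: "continuous_on {0..T} K"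
  shows "uniform_limit {0..T} (\<lambda>n t. \<Sum>k\<le>n. kappa T K n k * t ^ k) K sequentially"
proof (rule uniform_limitI)
  fix e :: real assume e: "0 < e"
  have "continuous_on {0..1} (\<lambda>x. K (x * T))"
    by (rule continuous_on_compose2[OF K]) (use T in \<open>auto intro!: continuous_intros mult_left_le_one_le\<close>)
  from Bernstein_Weierstrass[OF this e] obtain N where N: "\<And>n x. N \<le> n \<Longrightarrow> x \<in> {0..1} \<Longrightarrow>
     \<bar>K (x * T) - (\<Sum>k\<le>n. K (real k / real n * T) * Bernstein n k x)\<bar> < e" by blast
  show "\<forall>\<^sub>F n in sequentially. \<forall>t\<in>{0..T}. dist (\<Sum>k\<le>n. kappa T K n k * t ^ k) (K t) < e"
    unfolding eventually_sequentially
  proof (intro exI allI impI ballI)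
    fix n t assume "N \<le> n" "t \<in> {0..T}"
    then show "dist (\<Sum>k\<le>n. kappa T K n k * t ^ k) (K t) < e"
      using N[of n "t / T"] T by (simp add: kappa_bernstein dist_real_def abs_minus_commute)
  qed
qed

section \<open>A priori bound, stability and limit of the resolvents\<close>

lemma resolvent_bound:
  assumes K: "continuous_on {0..T} K" and r: "resolvent_on T \<beta> K r" and "0 \<le> \<beta>"
    and B: "\<And>t. t \<in> {0..T} \<Longrightarrow> \<bar>K t\<bar> \<le> B" and t: "t \<in> {0..T}"
  shows "\<bar>r t\<bar> \<le> 2 * B * exp ((2 * (\<beta> * B) + 1) * T)"
proof (rule gronwall_Icc[OF _ _ _ _ t])
  have B0: "0 \<le> B" using B[OF t] by simp
  then show "0 \<le> B" "0 \<le> \<beta> * B" using \<open>0 \<le> \<beta>\<close> by simp_all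
  show rc: "continuous_on {0..T} r" using r by (simp add: resolvent_on_def)
  fix t assume t: "t \<in> {0..T}"
  have "\<bar>r t\<bar> \<le> \<bar>K t\<bar> + \<beta> * \<bar>vconv K r t\<bar>"
    using r t \<open>0 \<le> \<beta>\<close> abs_triangle_ineq4[of "K t" "\<beta> * vconv K r t"] by (simp add: resolvent_on_def abs_mult)
  also have "\<bar>vconv K r t\<bar> \<le> B * (LINT s:{0..t}|lborel. \<bar>r s\<bar>)"
    by (rule vconv_bound[OF K set_integrable_continuous_Icc[OF rc] t B])
  finally show "\<bar>r t\<bar> \<le> B + \<beta> * B * (LINT s:{0..t}|lborel. \<bar>r s\<bar>)"
    using B[OF t] \<open>0 \<le> \<beta>\<close> by (simp add: mult.assoc mult_left_mono)
qed

text \<open>Writing K * r - L * q as (K - L) * r + L * (r - q) leaves a Gronwall inequality for r -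
  q. The constant depends on L and r only through their bounds B and C, so it is the same for all
  Bernstein resolvents from some index on.\<close>

lemma resolvent_stable:
  assumes K: "continuous_on {0..T} K" and r: "resolvent_on T \<beta> K r" and "0 \<le> \<beta>"
    and L: "continuous_on {0..T} L" and q: "resolvent_on T \<beta> L q"
    and B: "\<And>t. t \<in> {0..T} \<Longrightarrow> \<bar>L t\<bar> \<le> B"
    and C: "\<And>t. t \<in> {0..T} \<Longrightarrow> \<bar>r t\<bar> \<le> C"
    and d: "\<And>t. t \<in> {0..T} \<Longrightarrow> \<bar>K t - L t\<bar> \<le> d" and t: "t \<in> {0..T}"
  shows "\<bar>r t - q t\<bar> \<le> 2 * (d * (1 + \<beta> * (C * T))) * exp ((2 * (\<beta> * B) + 1) * T)"
proof (rule gronwall_Icc[OF _ _ _ _ t])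
  have B0: "0 \<le> B" and C0: "0 \<le> C" and d0: "0 \<le> d" and T0: "0 \<le> T"
    using B[OF t] C[OF t] d[OF t] t by auto
  show "0 \<le> \<beta> * B" "0 \<le> d * (1 + \<beta> * (C * T))"
    using \<open>0 \<le> \<beta>\<close> B0 C0 d0 T0 by simp_all
  have rc: "continuous_on {0..T} r" and qc: "continuous_on {0..T} q"
    using r q by (simp_all add: resolvent_on_def)
  then show rq: "continuous_on {0..T} (\<lambda>t. r t - q t)" by (intro continuous_intros)
  fix t assume t: "t \<in> {0..T}"
  have KL: "continuous_on {0..T} (\<lambda>s. K s - L s)" using K L by (intro continuous_intros)
  have "vconv (\<lambda>s. K s - L s) r t = vconv K r t - vconv L r t"
    by (rule vconv_diff_left[OF K L set_integrable_continuous_Icc[OF rc] t])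
  moreover have "vconv L (\<lambda>s. r s - q s) t = vconv L r t - vconv L q t"
    by (rule vconv_diff_right[OF L set_integrable_continuous_Icc[OF rc] set_integrable_continuous_Icc[OF qc] t])
  ultimately have *: "vconv (\<lambda>s. K s - L s) r t + vconv L (\<lambda>s. r s - q s) t = vconv K r t - vconv L q t"
    by simp
  have "r t = K t - \<beta> * vconv K r t" "q t = L t - \<beta> * vconv L q t"
    using r q t by (simp_all add: resolvent_on_def)
  then have eq: "r t - q t = (K t - L t) - \<beta> * (vconv (\<lambda>s. K s - L s) r t + vconv L (\<lambda>s. r s - q s) t)"
    unfolding * right_diff_distrib by linarith
  have "\<bar>r t - q t\<bar> \<le> \<bar>K t - L t\<bar> + \<beta> * (\<bar>vconv (\<lambda>s. K s - L s) r t\<bar> + \<bar>vconv L (\<lambda>s. r s - q s) t\<bar>)"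
    unfolding eq by (rule order_trans[OF abs_triangle_ineq4]) (use \<open>0 \<le> \<beta>\<close> in \<open>auto simp: abs_mult intro!: mult_left_mono\<close>)
  also have "\<dots> \<le> d + \<beta> * (d * (C * T) + B * (LINT s:{0..t}|lborel. \<bar>r s - q s\<bar>))"
  proof (intro add_mono mult_left_mono)
    have "\<bar>vconv (\<lambda>s. K s - L s) r t\<bar> \<le> d * (LINT s:{0..t}|lborel. \<bar>r s\<bar>)"
      by (rule vconv_bound[OF KL set_integrable_continuous_Icc[OF rc] t d])
    also have "(LINT s:{0..t}|lborel. \<bar>r s\<bar>) \<le> (LINT s:{0..t}|lborel. C)"
      using t C by (intro set_integral_mono set_integrable_continuous_Icc continuous_intros continuous_on_subset[OF rc]) auto
    also have "\<dots> = C * t" using t by (subst set_integral_const) (auto simp: measure_def)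
    also have "\<dots> \<le> C * T" using t C0 by (intro mult_left_mono) auto
    finally show "\<bar>vconv (\<lambda>s. K s - L s) r t\<bar> \<le> d * (C * T)" using d0 by (simp add: mult_left_mono)
    show "\<bar>vconv L (\<lambda>s. r s - q s) t\<bar> \<le> B * (LINT s:{0..t}|lborel. \<bar>r s - q s\<bar>)"
      by (rule vconv_bound[OF L set_integrable_continuous_Icc[OF rq] t B])
  qed (use d t \<open>0 \<le> \<beta>\<close> in auto)
  finally show "\<bar>r t - q t\<bar> \<le> d * (1 + \<beta> * (C * T)) + \<beta> * B * (LINT s:{0..t}|lborel. \<bar>r s - q s\<bar>)"
    by (simp add: algebra_simps)
qed

text \<open>The resolvents of the Bernstein polynomials are uniformly Cauchy by stability; their limit
  is the resolvent of \<open>K\<close>, so no fixed-point argument is needed for its existence.\<close>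

lemma resolvent_bernstein_limit:
  assumes T: "0 < T" and K: "continuous_on {0..T} K" and \<beta>: "0 < \<beta>"
  obtains r where "resolvent_on T \<beta> K r" "uniform_limit {0..T} (resolvent_bernstein T K \<beta>) r sequentially"
proof -
  let ?K = "\<lambda>n t. \<Sum>k\<le>n. kappa T K n k * t ^ k" and ?r = "resolvent_bernstein T K \<beta>"
  note lim = bernstein_uniform_limit[OF T K]
  have Kc: "continuous_on {0..T} (?K n)" for n by (intro continuous_intros)
  have R: "resolvent_on T \<beta> (?K n) (?r n)" for n by (rule resolvent_bernstein[OF \<beta>])
  then have rc: "continuous_on {0..T} (?r n)" for n by (simp add: resolvent_on_def)
  obtain B0 where B0: "\<And>t. t \<in> {0..T} \<Longrightarrow> \<bar>K t\<bar> \<le> B0"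
    using continuous_on_Icc_bounded[OF K] by blast
  \<comment> \<open>From \<open>N0\<close> on the Bernstein polynomials lie within 1 of K, hence
    below this common bound.\<close>
  define B where "B = B0 + 1"
  obtain N0 where N0: "\<And>n t. N0 \<le> n \<Longrightarrow> t \<in> {0..T} \<Longrightarrow> \<bar>?K n t - K t\<bar> < 1"
    using uniform_limitD[OF lim zero_less_one] unfolding eventually_sequentially dist_real_def by blast
  have KB: "\<bar>?K n t\<bar> \<le> B" if "N0 \<le> n" "t \<in> {0..T}" for n t
  proof -
    have "\<bar>?K n t\<bar> \<le> \<bar>?K n t - K t\<bar> + \<bar>K t\<bar>"
      using abs_triangle_ineq[of "?K n t - K t" "K t"] by simp
    also have "\<dots> \<le> 1 + B0"
      by (intro add_mono less_imp_le[OF N0] B0 that)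
    finally show ?thesis by (simp add: B_def)
  qed
  define C where "C = 2 * B * exp ((2 * (\<beta> * B) + 1) * T)"
  have rC: "\<bar>?r n t\<bar> \<le> C" if "N0 \<le> n" "t \<in> {0..T}" for n t
    unfolding C_def by (rule resolvent_bound[OF Kc R _ KB]) (use \<beta> that in auto)
  define F where "F = 2 * (1 + \<beta> * (C * T)) * exp ((2 * (\<beta> * B) + 1) * T)"
  have C0: "0 \<le> C" using order_trans[OF abs_ge_zero rC[of N0 0]] T by simp
  have F: "0 < F" unfolding F_def using C0 \<beta> T by (simp add: add_pos_nonneg)
  have "uniformly_Cauchy_on {0..T} ?r"
    unfolding uniformly_Cauchy_on_def
  proof (intro allI impI)
    fix e :: real assume e: "0 < e"
    \<comment> \<open>Two polynomials, each within d of K, differ by at most 2 d; stability turns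
      this into 2 d F, which is half of e.\<close>
    define d where "d = e / (4 * F)"
    have d: "0 < d" using e F by (simp add: d_def)
    obtain N1 where N1: "\<And>n t. N1 \<le> n \<Longrightarrow> t \<in> {0..T} \<Longrightarrow> \<bar>?K n t - K t\<bar> < d"
      using uniform_limitD[OF lim d] unfolding eventually_sequentially dist_real_def by blast
    have "dist (?r m t) (?r n t) < e" if t: "t \<in> {0..T}" and m: "max N0 N1 \<le> m" and n: "max N0 N1 \<le> n" for t m n
    proof -
      have KL: "\<bar>?K m s - ?K n s\<bar> \<le> 2 * d" if "s \<in> {0..T}" for s
        using N1[of m s] N1[of n s] that m n by simp
      have "\<bar>?r m t - ?r n t\<bar> \<le> 2 * (2 * d * (1 + \<beta> * (C * T))) * exp ((2 * (\<beta> * B) + 1) * T)"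
        by (rule resolvent_stable[OF Kc R _ Kc R KB rC KL t]) (use m n \<beta> in auto)
      also have "\<dots> = 2 * d * F" by (simp add: F_def)
      also have "\<dots> < e" using e F by (simp add: d_def)
      finally show ?thesis by (simp add: dist_real_def)
    qed
    then show "\<exists>M. \<forall>x\<in>{0..T}. \<forall>m\<ge>M. \<forall>n\<ge>M. dist (?r m x) (?r n x) < e" by blast
  qed
  then obtain r where r: "uniform_limit {0..T} ?r r sequentially"
    using Cauchy_uniformly_convergent uniformly_convergent_on_def by blast
  have "continuous_on {0..T} r"
    by (rule uniform_limit_theorem[OF _ r]) (use rc in auto)
  \<comment> \<open>Kernel and resolvent both vary with n. The convolution is split into (K_n - K) *
    r_n, which tends to 0 because the resolvents are bounded, and K * r_n, which has a fixed
    kernel.\<close>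
  moreover have "r t = K t - \<beta> * vconv K r t" if t: "t \<in> {0..T}" for t
  proof -
    have 1: "(\<lambda>n. vconv K (?r n) t) \<longlonglongrightarrow> vconv K r t"
      by (rule vconv_uniform_limit[OF K rc r t])
    have rate: "\<bar>vconv (?K n) (?r n) t - vconv K (?r n) t\<bar> \<le> d * (C * T)"
      if d: "\<And>s. s \<in> {0..T} \<Longrightarrow> \<bar>?K n s - K s\<bar> \<le> d" and n: "N0 \<le> n" for n d
    proof -
      have "vconv (?K n) (?r n) t - vconv K (?r n) t = vconv (\<lambda>s. ?K n s - K s) (?r n) t"
        by (rule vconv_diff_left[OF Kc K set_integrable_continuous_Icc[OF rc] t, symmetric])
      also have "\<bar>\<dots>\<bar> \<le> d * (LINT s:{0..t}|lborel. \<bar>?r n s\<bar>)"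
        by (rule vconv_bound[OF _ set_integrable_continuous_Icc[OF rc] t d]) (intro continuous_intros Kc K)
      also have "\<dots> \<le> d * (LINT s:{0..t}|lborel. C)"
        using t rC[OF n] d[OF t] by (intro mult_left_mono set_integral_mono set_integrable_continuous_Icc continuous_intros continuous_on_subset[OF rc]) auto
      also have "\<dots> = d * (C * t)" using t by (subst set_integral_const) (auto simp: measure_def)
      also have "\<dots> \<le> d * (C * T)" using t C0 d[OF t] by (intro mult_left_mono) auto
      finally show ?thesis .
    qed
    have 2: "(\<lambda>n. vconv (?K n) (?r n) t - vconv K (?r n) t) \<longlonglongrightarrow> 0"
    proof (rule LIMSEQ_I)
      fix e :: real assume e: "0 < e"
      define d where "d = e / (C * T + 1)"
      have CT: "0 \<le> C * T" using C0 T by simp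
      have d: "0 < d" using e CT by (simp add: d_def)
      obtain N1 where N1: "\<And>n t. N1 \<le> n \<Longrightarrow> t \<in> {0..T} \<Longrightarrow> \<bar>?K n t - K t\<bar> < d"
        using uniform_limitD[OF lim d] unfolding eventually_sequentially dist_real_def by blast
      have "norm (vconv (?K n) (?r n) t - vconv K (?r n) t - 0) < e" if "max N0 N1 \<le> n" for n
      proof -
        have "\<bar>vconv (?K n) (?r n) t - vconv K (?r n) t\<bar> \<le> d * (C * T)"
          by (rule rate) (use N1 that in \<open>auto intro!: less_imp_le\<close>)
        also have "\<dots> < d * (C * T + 1)" using d by simp
        also have "\<dots> = e" using CT by (simp add: d_def)
        finally show ?thesis by simp
      qed
      then show "\<exists>no. \<forall>n\<ge>no. norm (vconv (?K n) (?r n) t - vconv K (?r n) t - 0) < e" by blast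
    qed
    have "(\<lambda>n. ?K n t - \<beta> * ((vconv (?K n) (?r n) t - vconv K (?r n) t) + vconv K (?r n) t)) \<longlonglongrightarrow> K t - \<beta> * (0 + vconv K r t)"
      by (intro tendsto_intros 1 2 tendsto_uniform_limitI[OF lim t])
    moreover have "?K n t - \<beta> * ((vconv (?K n) (?r n) t - vconv K (?r n) t) + vconv K (?r n) t) = ?r n t" for n
      using R[of n] t by (simp add: resolvent_on_def)
    ultimately have "(\<lambda>n. ?r n t) \<longlonglongrightarrow> K t - \<beta> * vconv K r t" by simp
    moreover have "(\<lambda>n. ?r n t) \<longlonglongrightarrow> r t"
      by (rule tendsto_uniform_limitI[OF r t])
    ultimately show ?thesis by (simp add: LIMSEQ_unique)
  qed
  ultimately have "resolvent_on T \<beta> K r" by (simp add: resolvent_on_def)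
  with r show thesis by (rule that[rotated])
qed

section \<open>Wiener integrals of Hoelder kernels\<close>

lemma integrable_power2_add:
  fixes f g :: "'a \<Rightarrow> real"
  assumes [measurable]: "f \<in> borel_measurable M" "g \<in> borel_measurable M"
    and f: "integrable M (\<lambda>x. (f x)\<^sup>2)" and g: "integrable M (\<lambda>x. (g x)\<^sup>2)"
  shows "integrable M (\<lambda>x. (f x + g x)\<^sup>2)"
proof -
  have "integrable M (\<lambda>x. (f x)\<^sup>2 + (g x)\<^sup>2 + 2 * (f x * g x))"
    using Cauchy_Schwarz_integral(1)[OF assms] f g by simp
  then show ?thesis by (simp add: power2_sum mult.assoc)
qed

lemma integrable_power2_diff:
  fixes f g :: "'a \<Rightarrow> real"
  assumes "f \<in> borel_measurable M" "g \<in> borel_measurable M"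
    and "integrable M (\<lambda>x. (f x)\<^sup>2)" and "integrable M (\<lambda>x. (g x)\<^sup>2)"
  shows "integrable M (\<lambda>x. (f x - g x)\<^sup>2)"
  using integrable_power2_add[of f M "\<lambda>x. - g x"] assms by simp

locale brownian_motion =
  fixes M :: "'a measure" and W :: "real \<Rightarrow> 'a \<Rightarrow> real"
  assumes bm: "std_BM M W"
begin

sublocale prob_space M
  using bm by (simp add: std_BM_def)

lemma W_measurable: "0 \<le> t \<Longrightarrow> W t \<in> borel_measurable M"
  using bm by (simp add: std_BM_def)

lemma W_continuous: "\<omega> \<in> space M \<Longrightarrow> continuous_on {0..} (\<lambda>t. W t \<omega>)"
  using bm by (simp add: std_BM_def)

lemma increment_moments:
  assumes "0 \<le> s" "s \<le> t"
  shows "integrable M (\<lambda>\<omega>. W t \<omega> - W s \<omega>)" and "(\<integral>\<omega>. W t \<omega> - W s \<omega> \<partial>M) = 0"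
    and "integrable M (\<lambda>\<omega>. (W t \<omega> - W s \<omega>)\<^sup>2)" and "(\<integral>\<omega>. (W t \<omega> - W s \<omega>)\<^sup>2 \<partial>M) = t - s"
proof -
  have "integrable M (\<lambda>\<omega>. W t \<omega> - W s \<omega>) \<and> (\<integral>\<omega>. W t \<omega> - W s \<omega> \<partial>M) = 0 \<and>
    integrable M (\<lambda>\<omega>. (W t \<omega> - W s \<omega>)\<^sup>2) \<and> (\<integral>\<omega>. (W t \<omega> - W s \<omega>)\<^sup>2 \<partial>M) = t - s"
  \<comment> \<open>\<open>std_BM\<close> prescribes a normal law only for s < t. The degenerate
    increment is needed too: at time 0 all partition points coincide.\<close>
  proof (cases "s = t")
    case False
    with assms have st: "s < t" by simp
    have D: "distributed M lborel (\<lambda>\<omega>. W t \<omega> - W s \<omega>) (\<lambda>x. ennreal (normal_density 0 (sqrt (t - s)) x))"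
      using bm st assms by (simp add: std_BM_def)
    have sd: "0 < sqrt (t - s)" using st by simp
    have 1: "integrable M (\<lambda>\<omega>. W t \<omega> - W s \<omega>)"
      using distributed_integrable[OF D, of "\<lambda>x. x"] integrable_normal_moment[OF sd, of 0 1] by simp
    have 2: "(\<integral>\<omega>. W t \<omega> - W s \<omega> \<partial>M) = 0"
      using normal_distributed_expectation[OF sd D] .
    have 3: "integrable M (\<lambda>\<omega>. (W t \<omega> - W s \<omega>)\<^sup>2)"
      using distributed_integrable[OF D, of "\<lambda>x. x\<^sup>2"] integrable_normal_moment[OF sd, of 0 2] by simp
    have 4: "(\<integral>\<omega>. (W t \<omega> - W s \<omega>)\<^sup>2 \<partial>M) = t - s"
      using normal_distributed_variance[OF sd D] 2 st by simp
    from 1 2 3 4 show ?thesis by blast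
  qed simp
  then show "integrable M (\<lambda>\<omega>. W t \<omega> - W s \<omega>)" "(\<integral>\<omega>. W t \<omega> - W s \<omega> \<partial>M) = 0"
    "integrable M (\<lambda>\<omega>. (W t \<omega> - W s \<omega>)\<^sup>2)" "(\<integral>\<omega>. (W t \<omega> - W s \<omega>)\<^sup>2 \<partial>M) = t - s"
    by auto
qed

lemma increments_orthogonal:
  assumes ts: "0 \<le> ts 0" "\<And>i. i < k \<Longrightarrow> ts i \<le> ts (Suc i)" and ij: "i < k" "j < k" "i \<noteq> j"
  shows "integrable M (\<lambda>\<omega>. (W (ts (Suc i)) \<omega> - W (ts i) \<omega>) * (W (ts (Suc j)) \<omega> - W (ts j) \<omega>))"
    and "(\<integral>\<omega>. (W (ts (Suc i)) \<omega> - W (ts i) \<omega>) * (W (ts (Suc j)) \<omega> - W (ts j) \<omega>) \<partial>M) = 0"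
proof -
  have ts0: "0 \<le> ts l" if "l \<le> k" for l
    using that by (induction l) (use ts in \<open>auto intro: order_trans\<close>)
  let ?D = "\<lambda>i \<omega>. W (ts (Suc i)) \<omega> - W (ts i) \<omega>"
  have "indep_vars (\<lambda>_. borel) ?D {..<k}"
    using bm ts unfolding std_BM_def by blast
  then have ind: "indep_vars (\<lambda>_. borel) ?D {i, j}"
    by (rule indep_vars_subset) (use ij in auto)
  have int: "integrable M (?D l)" if "l \<in> {i, j}" for l
    using that ij ts ts0 by (intro increment_moments) auto
  have zero: "(\<integral>\<omega>. ?D i \<omega> \<partial>M) = 0"
    using ij ts ts0 by (intro increment_moments) auto
  show "integrable M (\<lambda>\<omega>. ?D i \<omega> * ?D j \<omega>)"
    using indep_vars_integrable[OF _ ind int] ij by simp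
  show "(\<integral>\<omega>. ?D i \<omega> * ?D j \<omega> \<partial>M) = 0"
    using indep_vars_lebesgue_integral[OF _ ind int] ij zero by simp
qed

text \<open>The Ito isometry for deterministic step integrands: after expanding the square,
  independence and zero mean remove all off-diagonal terms.\<close>

lemma increment_sum_moments:
  assumes ts: "0 \<le> ts 0" "\<And>i. i < k \<Longrightarrow> ts i \<le> ts (Suc i)"
  shows "(\<lambda>\<omega>. \<Sum>i<k. c i * (W (ts (Suc i)) \<omega> - W (ts i) \<omega>)) \<in> borel_measurable M"
    and "(\<integral>\<omega>. (\<Sum>i<k. c i * (W (ts (Suc i)) \<omega> - W (ts i) \<omega>)) \<partial>M) = 0"
    and "integrable M (\<lambda>\<omega>. (\<Sum>i<k. c i * (W (ts (Suc i)) \<omega> - W (ts i) \<omega>))\<^sup>2)"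
    and "(\<integral>\<omega>. (\<Sum>i<k. c i * (W (ts (Suc i)) \<omega> - W (ts i) \<omega>))\<^sup>2 \<partial>M) = (\<Sum>i<k. (c i)\<^sup>2 * (ts (Suc i) - ts i))"
proof -
  have ts0: "0 \<le> ts l" if "l \<le> k" for l
    using that by (induction l) (use ts in \<open>auto intro: order_trans\<close>)
  let ?D = "\<lambda>i \<omega>. W (ts (Suc i)) \<omega> - W (ts i) \<omega>"
  have I1: "integrable M (?D l)" if "l < k" for l
    using that ts ts0 by (intro increment_moments) auto
  show "(\<lambda>\<omega>. \<Sum>i<k. c i * ?D i \<omega>) \<in> borel_measurable M"
    using I1 by (intro borel_measurable_sum borel_measurable_times borel_measurable_const borel_measurable_integrable) auto
  have "(\<integral>\<omega>. (\<Sum>i<k. c i * ?D i \<omega>) \<partial>M) = (\<Sum>i<k. \<integral>\<omega>. c i * ?D i \<omega> \<partial>M)"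
    using I1 by (intro Bochner_Integration.integral_sum integrable_mult_right) auto
  also have "\<dots> = 0"
  proof (rule sum.neutral, rule ballI)
    fix i assume "i \<in> {..<k}"
    then have "(\<integral>\<omega>. ?D i \<omega> \<partial>M) = 0" using ts ts0 by (intro increment_moments) auto
    then show "(\<integral>\<omega>. c i * ?D i \<omega> \<partial>M) = 0" by (subst integral_mult_right_zero) simp
  qed
  finally show "(\<integral>\<omega>. (\<Sum>i<k. c i * ?D i \<omega>) \<partial>M) = 0" .
  have I2: "integrable M (\<lambda>\<omega>. ?D i \<omega> * ?D j \<omega>)" if "i < k" "j < k" for i j
  proof (cases "i = j")
    case True
    have "integrable M (\<lambda>\<omega>. (?D i \<omega>)\<^sup>2)" using that ts ts0 by (intro increment_moments) auto
    then show ?thesis using True by (simp only: power2_eq_square)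
  next
    case False
    then show ?thesis using that by (intro increments_orthogonal(1)[OF ts]) auto
  qed
  have E2: "(\<integral>\<omega>. ?D i \<omega> * ?D j \<omega> \<partial>M) = (if i = j then ts (Suc i) - ts i else 0)" if "i < k" "j < k" for i j
  proof (cases "i = j")
    case True
    have "(\<integral>\<omega>. (?D i \<omega>)\<^sup>2 \<partial>M) = ts (Suc i) - ts i" using that ts ts0 by (intro increment_moments) auto
    then show ?thesis using True by (simp only: power2_eq_square if_True simp_thms)
  next
    case False
    then have "(\<integral>\<omega>. ?D i \<omega> * ?D j \<omega> \<partial>M) = 0"
      using that by (intro increments_orthogonal(2)[OF ts]) auto
    then show ?thesis using False by (simp only: if_False)
  qed
  have sq: "(\<Sum>i<k. c i * ?D i \<omega>)\<^sup>2 = (\<Sum>i<k. \<Sum>j<k. (c i * c j) * (?D i \<omega> * ?D j \<omega>))" for \<omega>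
    unfolding power2_eq_square sum_product by (intro sum.cong refl) (simp only: mult_ac)
  have I3: "integrable M (\<lambda>\<omega>. \<Sum>j<k. (c i * c j) * (?D i \<omega> * ?D j \<omega>))" if "i < k" for i
    using I2 that by (intro Bochner_Integration.integrable_sum integrable_mult_right) auto
  show "integrable M (\<lambda>\<omega>. (\<Sum>i<k. c i * ?D i \<omega>)\<^sup>2)"
    unfolding sq by (rule Bochner_Integration.integrable_sum, rule I3) simp
  have "(\<integral>\<omega>. (\<Sum>i<k. c i * ?D i \<omega>)\<^sup>2 \<partial>M) = (\<Sum>i<k. \<integral>\<omega>. (\<Sum>j<k. (c i * c j) * (?D i \<omega> * ?D j \<omega>)) \<partial>M)"
    unfolding sq by (rule Bochner_Integration.integral_sum, rule I3) simp
  also have "\<dots> = (\<Sum>i<k. (c i)\<^sup>2 * (ts (Suc i) - ts i))"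
  proof (intro sum.cong refl)
    fix i assume i: "i \<in> {..<k}"
    have "(\<integral>\<omega>. (\<Sum>j<k. (c i * c j) * (?D i \<omega> * ?D j \<omega>)) \<partial>M) = (\<Sum>j<k. \<integral>\<omega>. (c i * c j) * (?D i \<omega> * ?D j \<omega>) \<partial>M)"
      using I2 i by (intro Bochner_Integration.integral_sum integrable_mult_right) auto
    also have "\<dots> = (\<Sum>j<k. (c i * c j) * (if i = j then ts (Suc i) - ts i else 0))"
      using E2 i by (intro sum.cong refl) (subst integral_mult_right_zero, auto simp only: lessThan_iff)
    also have "\<dots> = (c i)\<^sup>2 * (ts (Suc i) - ts i)"
      using i by (simp add: if_distrib[of "\<lambda>x. _ * x"] power2_eq_square cong: if_cong)
    finally show "(\<integral>\<omega>. (\<Sum>j<k. (c i * c j) * (?D i \<omega> * ?D j \<omega>)) \<partial>M) = (c i)\<^sup>2 * (ts (Suc i) - ts i)" .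
  qed
  finally show "(\<integral>\<omega>. (\<Sum>i<k. c i * ?D i \<omega>)\<^sup>2 \<partial>M) = (\<Sum>i<k. (c i)\<^sup>2 * (ts (Suc i) - ts i))" .
qed

section \<open>Riemann-Ito sums and refinement of partitions\<close>

lemma uniform_partition:
  assumes "0 \<le> t"
  shows "0 \<le> t * real 0 / real m" "t * real i / real m \<le> t * real (Suc i) / real m"
  using assms by (auto intro!: divide_right_mono mult_left_mono)

lemma riemann_ito_sum_moments:
  assumes "0 \<le> t"
  shows "riemann_ito_sum W f t m \<in> borel_measurable M"
    and "(\<integral>\<omega>. riemann_ito_sum W f t m \<omega> \<partial>M) = 0"
    and "integrable M (\<lambda>\<omega>. (riemann_ito_sum W f t m \<omega>)\<^sup>2)"
  unfolding riemann_ito_sum_def[abs_def]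
  by (rule increment_sum_moments[of "\<lambda>i. t * real i / real m"]; rule uniform_partition[OF assms])+

text \<open>The Riemann-Ito sums have mean zero, and on a probability space the squared difference
  of two means is at most the squared L2 distance.\<close>

lemma wiener_integral_mean:
  assumes Y: "wiener_integral M W f t Y" and t: "0 \<le> t"
  shows "integrable M Y" and "(\<integral>\<omega>. Y \<omega> \<partial>M) = 0"
proof -
  let ?S = "riemann_ito_sum W f t"
  have [measurable]: "Y \<in> borel_measurable M" and Y2: "integrable M (\<lambda>\<omega>. (Y \<omega>)\<^sup>2)"
    and lim: "(\<lambda>m. \<integral>\<omega>. (Y \<omega> - ?S m \<omega>)\<^sup>2 \<partial>M) \<longlonglongrightarrow> 0"
    using Y by (auto simp: wiener_integral_def)
  have [measurable]: "?S m \<in> borel_measurable M" for m by (rule riemann_ito_sum_moments[OF t])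
  show Yint: "integrable M Y"
    by (rule square_integrable_imp_integrable[OF _ Y2]) measurable
  have S: "integrable M (?S m)" for m
    by (rule square_integrable_imp_integrable[OF _ riemann_ito_sum_moments(3)[OF t]]) measurable
  have "(\<integral>\<omega>. Y \<omega> \<partial>M)\<^sup>2 \<le> (\<integral>\<omega>. (Y \<omega> - ?S m \<omega>)\<^sup>2 \<partial>M)" for m
  proof -
    have "(\<integral>\<omega>. Y \<omega> \<partial>M) = (\<integral>\<omega>. 1 * (Y \<omega> - ?S m \<omega>) \<partial>M)"
      using Yint S[of m] riemann_ito_sum_moments(2)[OF t, of f m] by simp
    also have "\<dots>\<^sup>2 \<le> (\<integral>\<omega>. 1\<^sup>2 \<partial>M) * (\<integral>\<omega>. (Y \<omega> - ?S m \<omega>)\<^sup>2 \<partial>M)"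
      by (rule Cauchy_Schwarz_integral(2))
        (auto intro!: integrable_power2_diff Y2 riemann_ito_sum_moments(3)[OF t])
    finally show ?thesis by (simp add: prob_space)
  qed
  then have "(\<integral>\<omega>. Y \<omega> \<partial>M)\<^sup>2 \<le> 0"
    by (intro LIMSEQ_le_const[OF lim]) auto
  then show "(\<integral>\<omega>. Y \<omega> \<partial>M) = 0" by simp
qed

text \<open>Each coarse increment telescopes into p fine ones, and \<open>j div p\<close> is the
  coarse cell that contains the fine cell j. Coarse and fine sums thereby use the same increments
  and can be subtracted coefficientwise.\<close>

lemma riemann_ito_sum_refine:
  assumes m: "0 < m" and p: "0 < p"
  shows "riemann_ito_sum W f t m \<omega> = (\<Sum>j<m * p. f (t * real (j div p) / real m) *
      (W (t * real (Suc j) / real (m * p)) \<omega> - W (t * real j / real (m * p)) \<omega>))"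
proof -
  let ?w = "\<lambda>j. W (t * real j / real (m * p)) \<omega>"
  have "(\<Sum>j<m * p. f (t * real (j div p) / real m) * (?w (Suc j) - ?w j))
      = (\<Sum>i<m. \<Sum>j=i * p..<i * p + p. f (t * real (j div p) / real m) * (?w (Suc j) - ?w j))"
    by (rule sum.nat_group[symmetric])
  also have "\<dots> = (\<Sum>i<m. f (t * real i / real m) * (W (t * real (Suc i) / real m) \<omega> - W (t * real i / real m) \<omega>))"
  proof (intro sum.cong refl)
    fix i
    have "(\<Sum>j=i * p..<i * p + p. f (t * real (j div p) / real m) * (?w (Suc j) - ?w j))
        = (\<Sum>j=i * p..<i * p + p. f (t * real i / real m) * (?w (Suc j) - ?w j))"
    proof (intro sum.cong refl)
      fix j assume "j \<in> {i * p..<i * p + p}"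
      then have "j div p = i" by (intro div_nat_eqI) (auto simp: mult.commute)
      then show "f (t * real (j div p) / real m) * (?w (Suc j) - ?w j) = f (t * real i / real m) * (?w (Suc j) - ?w j)"
        by simp
    qed
    also have "\<dots> = f (t * real i / real m) * (?w (i * p + p) - ?w (i * p))"
      by (simp only: sum_Suc_diff'[of "i * p" "i * p + p" ?w] le_add1 flip: sum_distrib_left)
    also have "?w (i * p + p) = W (t * real (Suc i) / real m) \<omega>"
    proof -
      have "t * real (i * p + p) / real (m * p) = (t * real (Suc i)) * real p / (real m * real p)"
        by (simp add: algebra_simps)
      also have "\<dots> = t * real (Suc i) / real m" using p by simp
      finally show ?thesis by simp
    qed
    also have "?w (i * p) = W (t * real i / real m) \<omega>"
    proof -
      have "t * real (i * p) / real (m * p) = (t * real i) * real p / (real m * real p)"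
        by (simp add: algebra_simps)
      also have "\<dots> = t * real i / real m" using p by simp
      finally show ?thesis by simp
    qed
    finally show "(\<Sum>j=i * p..<i * p + p. f (t * real (j div p) / real m) * (?w (Suc j) - ?w j))
      = f (t * real i / real m) * (W (t * real (Suc i) / real m) \<omega> - W (t * real i / real m) \<omega>)" .
  qed
  finally show ?thesis by (simp add: riemann_ito_sum_def)
qed

text \<open>By the isometry the distance is governed by the difference of the two step integrands.
  The left end point of a fine cell and that of its coarse cell are at most t / m apart, so every
  coefficient is at most e, and the cell lengths add up to t.\<close>

lemma riemann_ito_sum_refine_dist:
  assumes t: "0 \<le> t" and m: "0 < m" and p: "0 < p" and e: "0 \<le> e"
    and f: "\<And>s s'. s \<in> {0..t} \<Longrightarrow> s' \<in> {0..t} \<Longrightarrow> \<bar>s - s'\<bar> \<le> t / real m \<Longrightarrow> \<bar>f s - f s'\<bar> \<le> e"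
  shows "(\<integral>\<omega>. (riemann_ito_sum W f t m \<omega> - riemann_ito_sum W f t (m * p) \<omega>)\<^sup>2 \<partial>M) \<le> e\<^sup>2 * t"
proof -
  let ?ts = "\<lambda>j. t * real j / real (m * p)"
  let ?c = "\<lambda>j. f (t * real (j div p) / real m) - f (?ts j)"
  have eq: "riemann_ito_sum W f t m \<omega> - riemann_ito_sum W f t (m * p) \<omega>
      = (\<Sum>j<m * p. ?c j * (W (?ts (Suc j)) \<omega> - W (?ts j) \<omega>))" for \<omega>
    unfolding riemann_ito_sum_refine[OF m p, of f t] riemann_ito_sum_def[of W f t "m * p"]
    by (simp only: left_diff_distrib flip: sum_subtractf)
  have c: "\<bar>?c j\<bar> \<le> e" if j: "j < m * p" for j
  proof (rule f)
    have "real (j div p) * real p \<le> real j" and "real j < (real (j div p) + 1) * real p"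
    proof -
      have "j div p * p \<le> j" by simp
      then show "real (j div p) * real p \<le> real j" by (simp flip: of_nat_mult)
      have "j < (j div p + 1) * p" using p dividend_less_times_div[of p j] by (simp add: mult.commute)
      then have "real j < real ((j div p + 1) * p)" by (simp only: of_nat_less_iff)
      then show "real j < (real (j div p) + 1) * real p" by (simp add: algebra_simps)
    qed
    then have lo: "real (j div p) / real m \<le> real j / real (m * p)"
      and hi: "real j / real (m * p) \<le> (real (j div p) + 1) / real m"
      using m p by (auto simp: field_simps)
    have jm: "real j / real (m * p) \<le> 1" using j m p by (simp add: divide_le_eq_1 flip: of_nat_mult)
    show 2: "?ts j \<in> {0..t}"
      using t mult_left_mono[OF jm t] by auto
    have "t * (real (j div p) / real m) \<le> t * (real j / real (m * p))" by (rule mult_left_mono[OF lo t])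
    then have le: "t * real (j div p) / real m \<le> ?ts j" by simp
    then show "t * real (j div p) / real m \<in> {0..t}" using 2 t by auto
    have "t * (real j / real (m * p)) \<le> t * ((real (j div p) + 1) / real m)" by (rule mult_left_mono[OF hi t])
    then have "?ts j \<le> t * real (j div p) / real m + t / real m"
      by (simp add: add_divide_distrib distrib_left)
    then show "\<bar>t * real (j div p) / real m - ?ts j\<bar> \<le> t / real m" using le by simp
  qed
  have "(\<integral>\<omega>. (riemann_ito_sum W f t m \<omega> - riemann_ito_sum W f t (m * p) \<omega>)\<^sup>2 \<partial>M)
      = (\<Sum>j<m * p. (?c j)\<^sup>2 * (?ts (Suc j) - ?ts j))"
    unfolding eq by (rule increment_sum_moments(4)[of ?ts]; rule uniform_partition[OF t])
  also have "\<dots> \<le> (\<Sum>j<m * p. e\<^sup>2 * (?ts (Suc j) - ?ts j))"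
  proof (intro sum_mono mult_right_mono)
    fix j assume "j \<in> {..<m * p}"
    then show "(?c j)\<^sup>2 \<le> e\<^sup>2" using c[of j] e by (intro power2_le_iff_abs_le[THEN iffD2]) auto
    show "0 \<le> ?ts (Suc j) - ?ts j" using uniform_partition(2)[OF t, of j "m * p"] by linarith
  qed
  also have "\<dots> = e\<^sup>2 * (?ts (m * p) - ?ts 0)"
    by (simp only: sum_lessThan_telescope[of ?ts] flip: sum_distrib_left)
  also have "\<dots> = e\<^sup>2 * t" using m p by simp
  finally show ?thesis .
qed

end

lemma finite_measure_time_interval: "finite_measure (restrict_space lborel {0..T::real})"
  by (rule finite_measureI) (simp add: emeasure_restrict_space emeasure_lborel_Icc_eq)

section \<open>Joint measurability in \<omega> and time\<close>

context brownian_motion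
begin

text \<open>Path continuity makes W the pointwise limit of W at times rounded down to multiples of 1
  / (n + 1), and a rounded time takes countably many values. \<open>max 0\<close> extends the paths
  continuously to negative times, where \<open>std_BM\<close> says nothing.\<close>

lemma W_joint_measurable: "(\<lambda>z. W (max 0 (snd z)) (fst z)) \<in> borel_measurable (M \<Otimes>\<^sub>M borel)"
proof (rule borel_measurable_LIMSEQ_real)
  let ?u = "\<lambda>n z. W (max 0 (real_of_int \<lfloor>real (Suc n) * snd z\<rfloor> / real (Suc n))) (fst z)"
  fix z assume "z \<in> space (M \<Otimes>\<^sub>M (borel :: real measure))"
  then have z: "fst z \<in> space M" by (auto simp: space_pair_measure)
  have c: "continuous_on UNIV (\<lambda>t. W (max 0 t) (fst z))"
    by (rule continuous_on_compose2[OF W_continuous[OF z]]) (auto intro!: continuous_intros)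
  have "(\<lambda>n. real_of_int \<lfloor>real (Suc n) * snd z\<rfloor> / real (Suc n)) \<longlonglongrightarrow> snd z"
  proof (rule tendsto_sandwich[OF _ _ _ tendsto_const])
    have "(\<lambda>n. snd z - 1 / real (Suc n)) \<longlonglongrightarrow> snd z - 0"
      by (intro tendsto_diff tendsto_const LIMSEQ_Suc[OF lim_1_over_n])
    then show "(\<lambda>n. snd z - 1 / real (Suc n)) \<longlonglongrightarrow> snd z" by simp
    have "snd z - 1 / real (Suc n) \<le> real_of_int \<lfloor>real (Suc n) * snd z\<rfloor> / real (Suc n)" for n
    proof -
      have "real (Suc n) * snd z - 1 \<le> real_of_int \<lfloor>real (Suc n) * snd z\<rfloor>" by linarith
      then have "(real (Suc n) * snd z - 1) / real (Suc n) \<le> real_of_int \<lfloor>real (Suc n) * snd z\<rfloor> / real (Suc n)"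
        by (rule divide_right_mono) simp
      then show ?thesis by (simp add: diff_divide_distrib)
    qed
    then show "\<forall>\<^sub>F n in sequentially. snd z - 1 / real (Suc n) \<le> real_of_int \<lfloor>real (Suc n) * snd z\<rfloor> / real (Suc n)"
      by simp
    have "real_of_int \<lfloor>real (Suc n) * snd z\<rfloor> / real (Suc n) \<le> snd z" for n
    proof -
      have "real_of_int \<lfloor>real (Suc n) * snd z\<rfloor> / real (Suc n) \<le> real (Suc n) * snd z / real (Suc n)"
        by (rule divide_right_mono) simp_all
      then show ?thesis by simp
    qed
    then show "\<forall>\<^sub>F n in sequentially. real_of_int \<lfloor>real (Suc n) * snd z\<rfloor> / real (Suc n) \<le> snd z" by simp
  qed
  then show "(\<lambda>n. ?u n z) \<longlonglongrightarrow> W (max 0 (snd z)) (fst z)"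
    by (rule continuous_on_tendsto_compose[OF c]) auto
next
  fix n
  show "(\<lambda>z. W (max 0 (real_of_int \<lfloor>real (Suc n) * snd z\<rfloor> / real (Suc n))) (fst z)) \<in> borel_measurable (M \<Otimes>\<^sub>M borel)"
  proof (rule measurable_compose_countable[where f = "\<lambda>i z. W (max 0 (real_of_int i / real (Suc n))) (fst z)"
        and g = "\<lambda>z. \<lfloor>real (Suc n) * snd z\<rfloor>"])
    show "(\<lambda>z. W (max 0 (real_of_int i / real (Suc n))) (fst z)) \<in> borel_measurable (M \<Otimes>\<^sub>M borel)" for i
      by (rule measurable_compose[OF measurable_fst W_measurable]) simp
    show "(\<lambda>z. \<lfloor>real (Suc n) * snd z\<rfloor>) \<in> M \<Otimes>\<^sub>M borel \<rightarrow>\<^sub>M count_space UNIV"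
      by measurable
  qed
qed

lemma riemann_ito_sum_joint_measurable:
  assumes K: "continuous_on {0..T} K"
  shows "(\<lambda>z. riemann_ito_sum W (\<lambda>s. K (snd z - s)) (snd z) m (fst z)) \<in> borel_measurable (OT M T)"
proof -
  let ?N = "M \<Otimes>\<^sub>M restrict_space lborel {0..T}"
  have "(\<lambda>s. indicator {0..T} s *\<^sub>R K s) \<in> borel_measurable borel"
    by (rule borel_measurable_continuous_on_indicator[OF _ K]) simp
  then have [measurable]: "(\<lambda>s. indicator {0..T} s * K s) \<in> borel_measurable borel" by simp
  have snd[measurable]: "snd \<in> ?N \<rightarrow>\<^sub>M borel"
    by (rule measurable_compose[OF measurable_snd]) (auto intro!: measurable_restrict_space1)
  have W: "(\<lambda>z. W (max 0 (snd z * c)) (fst z)) \<in> borel_measurable ?N" for c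
  proof -
    have "(\<lambda>z. (fst z, snd z * c)) \<in> ?N \<rightarrow>\<^sub>M M \<Otimes>\<^sub>M borel" by measurable
    from measurable_compose[OF this W_joint_measurable] show ?thesis by simp
  qed
  note W[measurable]
  \<comment> \<open>The indicator and \<open>max 0\<close> are inserted to obtain functions
    measurable on the whole line; they change nothing at the partition points, which lie between 0
    and the current time.\<close>
  have "(\<lambda>z. \<Sum>i<m. (indicator {0..T} (snd z - snd z * (real i / real m)) * K (snd z - snd z * (real i / real m))) *
     (W (max 0 (snd z * (real (Suc i) / real m))) (fst z) - W (max 0 (snd z * (real i / real m))) (fst z))) \<in> borel_measurable ?N"
    by measurable
  also have "?this \<longleftrightarrow> (\<lambda>z. riemann_ito_sum W (\<lambda>s. K (snd z - s)) (snd z) m (fst z)) \<in> borel_measurable ?N"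
  proof (rule measurable_cong)
    fix z assume "z \<in> space ?N"
    then have z: "0 \<le> snd z" "snd z \<le> T" by (auto simp: space_pair_measure space_restrict_space)
    show "(\<Sum>i<m. (indicator {0..T} (snd z - snd z * (real i / real m)) * K (snd z - snd z * (real i / real m))) *
     (W (max 0 (snd z * (real (Suc i) / real m))) (fst z) - W (max 0 (snd z * (real i / real m))) (fst z)))
      = riemann_ito_sum W (\<lambda>s. K (snd z - s)) (snd z) m (fst z)"
      unfolding riemann_ito_sum_def
    proof (intro sum.cong refl)
      fix i assume i: "i \<in> {..<m}"
      have "snd z * (real i / real m) \<le> snd z" using i z by (intro mult_left_le) auto
      moreover have "0 \<le> snd z * (real i / real m)" "0 \<le> snd z * (real (Suc i) / real m)" using z by auto
      moreover from calculation have "indicat_real {0..T} (snd z - snd z * (real i / real m)) = 1"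
        using z by (intro indicator_simps(1)) (simp only: atLeastAtMost_iff; linarith)
      ultimately show "(indicator {0..T} (snd z - snd z * (real i / real m)) * K (snd z - snd z * (real i / real m))) *
        (W (max 0 (snd z * (real (Suc i) / real m))) (fst z) - W (max 0 (snd z * (real i / real m))) (fst z))
        = K (snd z - snd z * real i / real m) * (W (snd z * real (Suc i) / real m) (fst z) - W (snd z * real i / real m) (fst z))"
        using z by (simp add: max_absorb2 del: of_nat_Suc)
    qed
  qed
  finally show ?thesis by (simp add: OT_def)
qed

end

section \<open>The Wiener integral as a jointly measurable process\<close>

locale holder_kernel = brownian_motion +
  fixes T h C :: real and K :: "real \<Rightarrow> real"
  assumes T: "0 < T" and h: "0 < h" and C: "0 \<le> C"
    and holder: "\<And>s t. s \<in> {0..T} \<Longrightarrow> t \<in> {0..T} \<Longrightarrow> \<bar>K s - K t\<bar> \<le> C * \<bar>s - t\<bar> powr h"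
begin

lemma K_continuous: "continuous_on {0..T} K"
  unfolding continuous_on
proof
  fix x assume x: "x \<in> {0..T}"
  have "((\<lambda>y. C * \<bar>y - x\<bar> powr h) \<longlongrightarrow> C * \<bar>x - x\<bar> powr h) (at x within {0..T})"
    using h by (intro tendsto_intros tendsto_powr') auto
  then have "((\<lambda>y. C * \<bar>y - x\<bar> powr h) \<longlongrightarrow> 0) (at x within {0..T})" using h by simp
  moreover have "\<forall>\<^sub>F y in at x within {0..T}. norm (K y - K x) \<le> C * \<bar>y - x\<bar> powr h"
    using holder x by (auto simp: eventually_at_filter)
  ultimately have "((\<lambda>y. K y - K x) \<longlongrightarrow> 0) (at x within {0..T})"
    by (rule Lim_null_comparison[rotated])
  then show "(K \<longlongrightarrow> K x) (at x within {0..T})" by (rule LIM_zero_cancel)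
qed

abbreviation S :: "real \<Rightarrow> nat \<Rightarrow> 'a \<Rightarrow> real" where
  "S t \<equiv> riemann_ito_sum W (\<lambda>s. K (t - s)) t"

text \<open>The Hoelder modulus at mesh T / m times the square root of the interval length, that is,
  the L2 distance that the isometry permits between a partition and its refinements, uniformly in
  t.\<close>

definition rate :: "nat \<Rightarrow> real" where
  "rate m = C * (T / real m) powr h * sqrt T"

lemma rate_nonneg: "0 \<le> rate m"
  using C T by (simp add: rate_def)

lemma rate_antimono: "0 < m \<Longrightarrow> m \<le> n \<Longrightarrow> rate n \<le> rate m"
  unfolding rate_def using C T h
  by (intro mult_right_mono mult_left_mono powr_mono2 divide_left_mono) auto

lemma rate_tendsto: "rate \<longlonglongrightarrow> 0"
proof -
  have "(\<lambda>m. T / real m) \<longlonglongrightarrow> 0" by (rule lim_const_over_n)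
  then have "(\<lambda>m. C * (T / real m) powr h * sqrt T) \<longlonglongrightarrow> C * 0 powr h * sqrt T"
    using h T by (intro tendsto_intros tendsto_powr') auto
  then show ?thesis by (simp add: rate_def[abs_def])
qed

text \<open>The point where the Hoelder exponent enters: along powers of two the rate is geometric
  with ratio 2 to the power -h, and h > 0. Mere convergence of the rate to 0 would not give almost
  sure convergence of the dyadic sums.\<close>

lemma rate_pow2_summable: "summable (\<lambda>n. rate (2 ^ n))"
proof -
  have "rate (2 ^ n) = C * T powr h * sqrt T * (2 powr (- h)) ^ n" for n
  proof -
    have "(2 ^ n :: real) powr h = (2 powr h) ^ n"
      by (simp add: powr_powr mult.commute flip: powr_realpow)
    moreover have "(T / real (2 ^ n)) powr h = T powr h / (2 ^ n) powr h"
      using T by (simp add: powr_divide)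
    ultimately show ?thesis
      by (simp add: rate_def powr_minus power_inverse divide_inverse)
  qed
  moreover have "norm (2 powr (- h) :: real) < 1"
    using h powr_less_mono[of "- h" 0 2] by simp
  ultimately show ?thesis
    by (simp add: summable_mult summable_geometric)
qed

lemma S_moments:
  assumes "t \<in> {0..T}"
  shows "S t m \<in> borel_measurable M" "integrable M (\<lambda>\<omega>. (S t m \<omega>)\<^sup>2)"
  using assms by (auto intro: riemann_ito_sum_moments)

lemma S_refine_dist:
  assumes t: "t \<in> {0..T}" and m: "0 < m" and p: "0 < p"
  shows "(\<integral>\<omega>. (S t m \<omega> - S t (m * p) \<omega>)\<^sup>2 \<partial>M) \<le> (rate m)\<^sup>2"
proof -
  let ?e = "C * (T / real m) powr h"
  have "(\<integral>\<omega>. (S t m \<omega> - S t (m * p) \<omega>)\<^sup>2 \<partial>M) \<le> ?e\<^sup>2 * t"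
  proof (rule riemann_ito_sum_refine_dist[OF _ m p])
    fix s s' assume s: "s \<in> {0..t}" "s' \<in> {0..t}" and d: "\<bar>s - s'\<bar> \<le> t / real m"
    have "\<bar>K (t - s) - K (t - s')\<bar> \<le> C * \<bar>(t - s) - (t - s')\<bar> powr h"
      using s t by (intro holder) auto
    also have "\<dots> \<le> ?e"
    proof (intro mult_left_mono powr_mono2)
      have "t / real m \<le> T / real m" using t by (intro divide_right_mono) auto
      then show "\<bar>(t - s) - (t - s')\<bar> \<le> T / real m" using d by simp
    qed (use C h in auto)
    finally show "\<bar>K (t - s) - K (t - s')\<bar> \<le> ?e" .
  qed (use t C in auto)
  also have "\<dots> \<le> ?e\<^sup>2 * T" using t by (intro mult_left_mono) auto
  also have "\<dots> = (rate m)\<^sup>2" using T by (simp add: rate_def power_mult_distrib)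
  finally show ?thesis .
qed

text \<open>Two partitions are compared through their common refinement.\<close>

lemma S_dist:
  assumes t: "t \<in> {0..T}" and m: "0 < m" and n: "m \<le> n"
  shows "(\<integral>\<omega>. (S t n \<omega> - S t m \<omega>)\<^sup>2 \<partial>M) \<le> 4 * (rate m)\<^sup>2"
proof -
  note [measurable] = S_moments(1)[OF t]
  have i: "integrable M (\<lambda>\<omega>. (S t k \<omega> - S t l \<omega>)\<^sup>2)" for k l
    by (intro integrable_power2_diff S_moments[OF t])
  have "(\<integral>\<omega>. (S t n \<omega> - S t m \<omega>)\<^sup>2 \<partial>M)
      \<le> (\<integral>\<omega>. 2 * (S t n \<omega> - S t (n * m) \<omega>)\<^sup>2 + 2 * (S t m \<omega> - S t (m * n) \<omega>)\<^sup>2 \<partial>M)"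
  proof (rule integral_mono)
    fix \<omega>
    have "(a - b)\<^sup>2 \<le> 2 * (a - c)\<^sup>2 + 2 * (b - c)\<^sup>2" for a b c :: real
      using zero_le_power2[of "a + b - 2 * c"] by (simp add: power2_eq_square algebra_simps)
    then show "(S t n \<omega> - S t m \<omega>)\<^sup>2 \<le> 2 * (S t n \<omega> - S t (n * m) \<omega>)\<^sup>2 + 2 * (S t m \<omega> - S t (m * n) \<omega>)\<^sup>2"
      by (simp only: mult.commute[of n m])
  qed (use i in auto)
  also have "\<dots> = 2 * (\<integral>\<omega>. (S t n \<omega> - S t (n * m) \<omega>)\<^sup>2 \<partial>M) + 2 * (\<integral>\<omega>. (S t m \<omega> - S t (m * n) \<omega>)\<^sup>2 \<partial>M)"
    using i by simp
  also have "\<dots> \<le> 2 * (rate n)\<^sup>2 + 2 * (rate m)\<^sup>2"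
    using m n by (intro add_mono mult_left_mono S_refine_dist[OF t]) auto
  also have "(rate n)\<^sup>2 \<le> (rate m)\<^sup>2"
    by (intro power_mono rate_antimono m n rate_nonneg)
  finally show ?thesis by simp
qed

text \<open>A pathwise \<open>lim\<close> instead of an L2 limit for each t: the latter is fixed
  only up to a null set depending on t and need not be jointly measurable. \<open>lim\<close> also
  has a value where the sums diverge and keeps measurability.\<close>

definition Z :: "real \<Rightarrow> 'a \<Rightarrow> real" where
  "Z t \<omega> = lim (\<lambda>n. S t (2 ^ n) \<omega>)"

lemma Z_joint_measurable: "(\<lambda>z. Z (snd z) (fst z)) \<in> borel_measurable (OT M T)"
  unfolding Z_def
  by (rule borel_measurable_lim_metric) (rule riemann_ito_sum_joint_measurable[OF K_continuous])

lemma Z_measurable: "t \<in> {0..T} \<Longrightarrow> Z t \<in> borel_measurable M"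
  unfolding Z_def[abs_def] by (rule borel_measurable_lim_metric) (rule S_moments)

text \<open>By Cauchy-Schwarz the expected absolute dyadic differences are at most twice the rate,
  hence summable. Their sum has finite expectation, is therefore finite almost surely, and the
  differences telescope.\<close>

lemma S_AE_tendsto:
  assumes t: "t \<in> {0..T}"
  shows "AE \<omega> in M. (\<lambda>n. S t (2 ^ n) \<omega>) \<longlonglongrightarrow> Z t \<omega>"
proof -
  note [measurable] = S_moments(1)[OF t]
  let ?d = "\<lambda>n \<omega>. S t (2 ^ Suc n) \<omega> - S t (2 ^ n) \<omega>"
  have d1: "(\<integral>\<^sup>+\<omega>. ennreal \<bar>?d n \<omega>\<bar> \<partial>M) \<le> ennreal (2 * rate (2 ^ n))" for n
  proof -
    have i: "integrable M (\<lambda>\<omega>. (?d n \<omega>)\<^sup>2)"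
      by (intro integrable_power2_diff S_moments[OF t])
    then have i1: "integrable M (?d n)"
      by (rule square_integrable_imp_integrable[rotated]) measurable
    have "(\<integral>\<omega>. 1 * \<bar>?d n \<omega>\<bar> \<partial>M)\<^sup>2 \<le> (\<integral>\<omega>. 1\<^sup>2 \<partial>M) * (\<integral>\<omega>. \<bar>?d n \<omega>\<bar>\<^sup>2 \<partial>M)"
      using i by (intro Cauchy_Schwarz_integral(2)) auto
    also have "\<dots> = (\<integral>\<omega>. (?d n \<omega>)\<^sup>2 \<partial>M)" by (simp add: prob_space)
    also have "\<dots> \<le> 4 * (rate (2 ^ n))\<^sup>2"
      by (rule S_dist[OF t]) auto
    also have "\<dots> = (2 * rate (2 ^ n))\<^sup>2" by (simp add: power_mult_distrib)
    finally have "(\<integral>\<omega>. 1 * \<bar>?d n \<omega>\<bar> \<partial>M) \<le> 2 * rate (2 ^ n)"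
      by (rule power2_le_imp_le) (simp add: rate_nonneg)
    then have "(\<integral>\<omega>. \<bar>?d n \<omega>\<bar> \<partial>M) \<le> 2 * rate (2 ^ n)" by (simp only: mult_1_left)
    moreover have "(\<integral>\<^sup>+\<omega>. ennreal \<bar>?d n \<omega>\<bar> \<partial>M) = ennreal (\<integral>\<omega>. \<bar>?d n \<omega>\<bar> \<partial>M)"
      using i1 by (intro nn_integral_eq_integral) auto
    ultimately show ?thesis by (simp add: ennreal_leI)
  qed
  have "(\<integral>\<^sup>+\<omega>. (\<Sum>n. ennreal \<bar>?d n \<omega>\<bar>) \<partial>M) = (\<Sum>n. \<integral>\<^sup>+\<omega>. ennreal \<bar>?d n \<omega>\<bar> \<partial>M)"
    by (rule nn_integral_suminf) measurable
  also have "\<dots> \<le> (\<Sum>n. ennreal (2 * rate (2 ^ n)))"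
    by (intro suminf_le d1 summableI)
  also have "\<dots> = ennreal (\<Sum>n. 2 * rate (2 ^ n))"
    using rate_nonneg rate_pow2_summable by (intro suminf_ennreal2 summable_mult) auto
  finally have "(\<integral>\<^sup>+\<omega>. (\<Sum>n. ennreal \<bar>?d n \<omega>\<bar>) \<partial>M) \<noteq> \<infinity>"
    using order_le_less_trans[OF _ ennreal_less_top] less_top by (metis infinity_ennreal_def)
  then have "AE \<omega> in M. (\<Sum>n. ennreal \<bar>?d n \<omega>\<bar>) \<noteq> \<infinity>"
    by (rule nn_integral_PInf_AE[rotated]) measurable
  then show ?thesis
  proof eventually_elim
    case (elim \<omega>)
    then have "summable (\<lambda>n. \<bar>?d n \<omega>\<bar>)"
      by (intro summable_suminf_not_top) auto
    then have "summable (\<lambda>n. ?d n \<omega>)"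
      by (rule summable_rabs_cancel)
    then have "convergent (\<lambda>N. \<Sum>n<N. ?d n \<omega>)" by (simp add: summable_iff_convergent)
    then have "convergent (\<lambda>N. S t (2 ^ N) \<omega> - S t (2 ^ 0) \<omega>)"
      by (simp only: sum_lessThan_telescope[of "\<lambda>n. S t (2 ^ n) \<omega>"])
    then have "convergent (\<lambda>N. (S t (2 ^ N) \<omega> - S t (2 ^ 0) \<omega>) + S t (2 ^ 0) \<omega>)"
      by (rule convergent_add[OF _ convergent_const])
    then show ?case by (simp add: Z_def convergent_LIMSEQ_iff)
  qed
qed

text \<open>Fatou's lemma carries the estimate for two partitions to the almost sure limit. As m is
  arbitrary, the dyadic limit is also the L2 limit along all uniform partitions, as
  \<open>wiener_integral\<close> demands.\<close>

lemma Z_dist: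
  assumes t: "t \<in> {0..T}" and m: "0 < m"
  shows "integrable M (\<lambda>\<omega>. (Z t \<omega> - S t m \<omega>)\<^sup>2)" and "(\<integral>\<omega>. (Z t \<omega> - S t m \<omega>)\<^sup>2 \<partial>M) \<le> 4 * (rate m)\<^sup>2"
proof -
  note [measurable] = S_moments(1)[OF t] Z_measurable[OF t]
  have "(\<integral>\<^sup>+\<omega>. ennreal ((Z t \<omega> - S t m \<omega>)\<^sup>2) \<partial>M)
      = (\<integral>\<^sup>+\<omega>. liminf (\<lambda>n. ennreal ((S t (2 ^ n) \<omega> - S t m \<omega>)\<^sup>2)) \<partial>M)"
  proof (rule nn_integral_cong_AE)
    show "AE \<omega> in M. ennreal ((Z t \<omega> - S t m \<omega>)\<^sup>2) = liminf (\<lambda>n. ennreal ((S t (2 ^ n) \<omega> - S t m \<omega>)\<^sup>2))"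
      using S_AE_tendsto[OF t]
    proof eventually_elim
      case (elim \<omega>)
      then have "(\<lambda>n. ennreal ((S t (2 ^ n) \<omega> - S t m \<omega>)\<^sup>2)) \<longlonglongrightarrow> ennreal ((Z t \<omega> - S t m \<omega>)\<^sup>2)"
        by (intro tendsto_intros)
      then show ?case by (intro lim_imp_Liminf[symmetric]) auto
    qed
  qed
  also have "\<dots> \<le> liminf (\<lambda>n. \<integral>\<^sup>+\<omega>. ennreal ((S t (2 ^ n) \<omega> - S t m \<omega>)\<^sup>2) \<partial>M)"
    by (rule nn_integral_liminf) measurable
  also have "\<dots> \<le> ennreal (4 * (rate m)\<^sup>2)"
  proof (rule Liminf_le)
    have "(\<integral>\<^sup>+\<omega>. ennreal ((S t (2 ^ n) \<omega> - S t m \<omega>)\<^sup>2) \<partial>M) \<le> ennreal (4 * (rate m)\<^sup>2)" if "m \<le> n" for n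
    proof -
      have "(\<integral>\<^sup>+\<omega>. ennreal ((S t (2 ^ n) \<omega> - S t m \<omega>)\<^sup>2) \<partial>M) = ennreal (\<integral>\<omega>. (S t (2 ^ n) \<omega> - S t m \<omega>)\<^sup>2 \<partial>M)"
        by (intro nn_integral_eq_integral integrable_power2_diff S_moments[OF t]) auto
      also have "\<dots> \<le> ennreal (4 * (rate m)\<^sup>2)"
        by (intro ennreal_leI S_dist[OF t m] order_trans[OF that]) (simp add: less_imp_le)
      finally show ?thesis .
    qed
    then show "\<forall>\<^sub>F n in sequentially. (\<integral>\<^sup>+\<omega>. ennreal ((S t (2 ^ n) \<omega> - S t m \<omega>)\<^sup>2) \<partial>M) \<le> ennreal (4 * (rate m)\<^sup>2)"
      by (auto simp: eventually_sequentially)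
  qed simp
  finally have le: "(\<integral>\<^sup>+\<omega>. ennreal ((Z t \<omega> - S t m \<omega>)\<^sup>2) \<partial>M) \<le> ennreal (4 * (rate m)\<^sup>2)" .
  then show i: "integrable M (\<lambda>\<omega>. (Z t \<omega> - S t m \<omega>)\<^sup>2)"
    by (intro integrableI_bounded) (auto simp: less_top[symmetric] top_unique)
  have "ennreal (\<integral>\<omega>. (Z t \<omega> - S t m \<omega>)\<^sup>2 \<partial>M) \<le> ennreal (4 * (rate m)\<^sup>2)"
    using le by (subst nn_integral_eq_integral[OF i, symmetric]) auto
  then show "(\<integral>\<omega>. (Z t \<omega> - S t m \<omega>)\<^sup>2 \<partial>M) \<le> 4 * (rate m)\<^sup>2"
    by simp
qed

lemma Z_square_integrable:
  assumes t: "t \<in> {0..T}"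
  shows "integrable M (\<lambda>\<omega>. (Z t \<omega>)\<^sup>2)"
proof -
  note [measurable] = S_moments(1)[OF t] Z_measurable[OF t]
  have "integrable M (\<lambda>\<omega>. ((Z t \<omega> - S t 1 \<omega>) + S t 1 \<omega>)\<^sup>2)"
    by (intro integrable_power2_add Z_dist S_moments t) auto
  then show ?thesis by simp
qed

lemma Z_wiener_integral:
  assumes t: "t \<in> {0..T}"
  shows "wiener_integral M W (\<lambda>s. K (t - s)) t (Z t)"
  unfolding wiener_integral_def
proof (intro conjI Z_measurable Z_square_integrable t)
  have "(\<lambda>m. 4 * (rate m)\<^sup>2) \<longlonglongrightarrow> 4 * 0\<^sup>2"
    by (intro tendsto_intros rate_tendsto)
  then have lim: "(\<lambda>m. 4 * (rate m)\<^sup>2) \<longlonglongrightarrow> 0" by simp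
  show "(\<lambda>m. \<integral>\<omega>. (Z t \<omega> - S t m \<omega>)\<^sup>2 \<partial>M) \<longlonglongrightarrow> 0"
  proof (rule tendsto_sandwich[OF _ _ tendsto_const lim])
    show "\<forall>\<^sub>F m in sequentially. (\<integral>\<omega>. (Z t \<omega> - S t m \<omega>)\<^sup>2 \<partial>M) \<le> 4 * (rate m)\<^sup>2"
      using eventually_gt_at_top[of 0] by eventually_elim (rule Z_dist[OF t])
  qed simp
qed

text \<open>Comparison with the sum over a single cell, which is K t times the increment of W over
  [0, t], gives a bound independent of t.\<close>

lemma Z_second_moment_bounded:
  obtains c where "0 \<le> c" "\<And>t. t \<in> {0..T} \<Longrightarrow> (\<integral>\<omega>. (Z t \<omega>)\<^sup>2 \<partial>M) \<le> c"
proof -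
  obtain B where B: "0 \<le> B" "\<And>s. s \<in> {0..T} \<Longrightarrow> \<bar>K s\<bar> \<le> B"
    using continuous_on_Icc_bounded[OF K_continuous] by blast
  let ?c = "8 * (rate 1)\<^sup>2 + 2 * (B\<^sup>2 * T)"
  have "(\<integral>\<omega>. (Z t \<omega>)\<^sup>2 \<partial>M) \<le> ?c" if t: "t \<in> {0..T}" for t
  proof -
    have "(\<integral>\<omega>. (Z t \<omega>)\<^sup>2 \<partial>M) \<le> (\<integral>\<omega>. 2 * (Z t \<omega> - S t 1 \<omega>)\<^sup>2 + 2 * (S t 1 \<omega>)\<^sup>2 \<partial>M)"
    proof (rule integral_mono[OF Z_square_integrable[OF t]])
      show "integrable M (\<lambda>\<omega>. 2 * (Z t \<omega> - S t 1 \<omega>)\<^sup>2 + 2 * (S t 1 \<omega>)\<^sup>2)"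
        using Z_dist(1)[OF t, of 1] S_moments(2)[OF t, of 1] by simp
      show "(Z t \<omega>)\<^sup>2 \<le> 2 * (Z t \<omega> - S t 1 \<omega>)\<^sup>2 + 2 * (S t 1 \<omega>)\<^sup>2" for \<omega>
      proof -
        have "a\<^sup>2 \<le> 2 * (a - b)\<^sup>2 + 2 * b\<^sup>2" for a b :: real
          using zero_le_power2[of "a - 2 * b"] by (simp add: power2_eq_square algebra_simps)
        then show ?thesis .
      qed
    qed
    also have "\<dots> = 2 * (\<integral>\<omega>. (Z t \<omega> - S t 1 \<omega>)\<^sup>2 \<partial>M) + 2 * (\<integral>\<omega>. (S t 1 \<omega>)\<^sup>2 \<partial>M)"
      using Z_dist(1)[OF t, of 1] S_moments(2)[OF t, of 1] by simp
    also have "(\<integral>\<omega>. (Z t \<omega> - S t 1 \<omega>)\<^sup>2 \<partial>M) \<le> 4 * (rate 1)\<^sup>2"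
      by (rule Z_dist(2)[OF t]) simp
    also have "(\<integral>\<omega>. (S t 1 \<omega>)\<^sup>2 \<partial>M) = (K t)\<^sup>2 * t"
    proof -
      have "(\<integral>\<omega>. (S t 1 \<omega>)\<^sup>2 \<partial>M) = (K t)\<^sup>2 * (\<integral>\<omega>. (W t \<omega> - W 0 \<omega>)\<^sup>2 \<partial>M)"
        by (simp add: riemann_ito_sum_def power_mult_distrib)
      also have "(\<integral>\<omega>. (W t \<omega> - W 0 \<omega>)\<^sup>2 \<partial>M) = t - 0"
        using t by (intro increment_moments) auto
      finally show ?thesis by simp
    qed
    also have "(K t)\<^sup>2 * t \<le> B\<^sup>2 * T"
      using t B by (intro mult_mono power2_le_iff_abs_le[THEN iffD2]) auto
    finally show ?thesis by simp
  qed
  moreover have "0 \<le> ?c" using T by simp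
  ultimately show ?thesis using that by blast
qed

lemma Z_joint_square_integrable: "integrable (OT M T) (\<lambda>z. (Z (snd z) (fst z))\<^sup>2)"
proof -
  let ?L = "restrict_space lborel {0..T}"
  interpret L: finite_measure ?L by (rule finite_measure_time_interval)
  interpret P: pair_sigma_finite M ?L ..
  note Zm = Z_joint_measurable[unfolded OT_def]
  obtain c where c: "0 \<le> c" "\<And>t. t \<in> {0..T} \<Longrightarrow> (\<integral>\<omega>. (Z t \<omega>)\<^sup>2 \<partial>M) \<le> c"
    using Z_second_moment_bounded by blast
  have "(\<integral>\<^sup>+z. ennreal ((Z (snd z) (fst z))\<^sup>2) \<partial>(M \<Otimes>\<^sub>M ?L))
      = (\<integral>\<^sup>+t. \<integral>\<^sup>+\<omega>. ennreal ((Z t \<omega>)\<^sup>2) \<partial>M \<partial>?L)"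
    using Zm by (subst P.nn_integral_snd[symmetric]) auto
  also have "\<dots> \<le> (\<integral>\<^sup>+t. ennreal c \<partial>?L)"
  proof (rule nn_integral_mono)
    fix t assume "t \<in> space ?L"
    then have t: "t \<in> {0..T}" by (simp add: space_restrict_space)
    have "(\<integral>\<^sup>+\<omega>. ennreal ((Z t \<omega>)\<^sup>2) \<partial>M) = ennreal (\<integral>\<omega>. (Z t \<omega>)\<^sup>2 \<partial>M)"
      by (intro nn_integral_eq_integral Z_square_integrable t) auto
    then show "(\<integral>\<^sup>+\<omega>. ennreal ((Z t \<omega>)\<^sup>2) \<partial>M) \<le> ennreal c"
      using c(2)[OF t] by (simp add: ennreal_leI)
  qed
  also have "\<dots> = ennreal c * emeasure ?L (space ?L)" by simp
  also have "\<dots> < \<infinity>"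
    by (simp add: emeasure_restrict_space space_restrict_space emeasure_lborel_Icc_eq ennreal_mult_less_top)
  finally show ?thesis
    unfolding OT_def using Zm by (intro integrableI_bounded) auto
qed

end

section \<open>The control problem\<close>

abbreviation time_measure :: "real \<Rightarrow> real measure" where
  "time_measure T \<equiv> restrict_space lborel {0..T}"

lemma integral_time_measure: "(\<integral>s. f s \<partial>time_measure T) = (LINT s:{0..T}|lborel. f s :: real)"
  by (simp add: integral_restrict_space set_lebesgue_integral_def)

lemma integrable_time_measure: "integrable (time_measure T) f \<longleftrightarrow> set_integrable lborel {0..T} (f :: real \<Rightarrow> real)"
  by (simp add: integrable_restrict_space set_integrable_def)

lemma continuous_measurable_time_measure:
  fixes f :: "real \<Rightarrow> real"
  assumes "continuous_on {0..T} f"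
  shows "f \<in> borel_measurable (time_measure T)"
  using integrable_time_measure set_integrable_continuous_Icc[OF assms] by blast

lemma vconv_time_measure:
  assumes "t \<le> T"
  shows "vconv f g t = (\<integral>s. (indicator {0..t} s * f (t - s)) * g s \<partial>time_measure T)"
  unfolding integral_time_measure vconv_def set_lebesgue_integral_def
  by (rule Bochner_Integration.integral_cong) (use assms in \<open>auto simp: indicator_def\<close>)

lemma vconv_kernel_bounded:
  fixes f :: "real \<Rightarrow> real"
  assumes "continuous_on {0..T} f" "t \<in> {0..T}"
  obtains B where "\<And>s. \<bar>indicator {0..t} s * f (t - s)\<bar> \<le> B" "0 \<le> B"
    "(\<lambda>s. indicator {0..t} s * f (t - s)) \<in> borel_measurable borel"
proof -
  obtain B where B: "0 \<le> B" "\<And>s. s \<in> {0..T} \<Longrightarrow> \<bar>f s\<bar> \<le> B"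
    using continuous_on_Icc_bounded[OF assms(1)] by blast
  have "continuous_on {0..t} (\<lambda>s. f (t - s))"
    by (rule continuous_on_compose2[OF assms(1)]) (use assms(2) in \<open>auto intro!: continuous_intros\<close>)
  from borel_measurable_continuous_on_indicator[OF _ this]
  have "(\<lambda>s. indicator {0..t} s * f (t - s)) \<in> borel_measurable borel" by simp
  moreover have "\<bar>indicator {0..t} s * f (t - s)\<bar> \<le> B" for s
    using B(1) B(2)[of "t - s"] assms(2) by (auto simp: indicator_def)
  ultimately show ?thesis using that B(1) by blast
qed

section \<open>Volterra convolution of square integrable processes\<close>

context prob_space
begin

lemma finite_measure_OT: "finite_measure (OT M T)"
  unfolding OT_def by (rule finite_measure_pair_measure[OF finite_measure_time_interval]) unfold_locales

lemma pair_sigma_finite_OT: "pair_sigma_finite M (time_measure T)"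
proof -
  interpret L: finite_measure "time_measure T" by (rule finite_measure_time_interval)
  show ?thesis ..
qed

lemma process_square_integrable_imp_integrable:
  assumes "(\<lambda>z. u (snd z) (fst z)) \<in> borel_measurable (OT M T)"
    and "integrable (OT M T) (\<lambda>z. (u (snd z) (fst z))\<^sup>2)"
  shows "integrable (OT M T) (\<lambda>z. u (snd z) (fst z) :: real)"
  using finite_measure.square_integrable_imp_integrable[OF finite_measure_OT assms] .

lemma process_section_measurable:
  assumes "(\<lambda>z. u (snd z) (fst z)) \<in> borel_measurable (OT M T)" and t: "t \<in> {0..T}"
  shows "u t \<in> borel_measurable M"
  using measurable_Pair1[OF assms(1)[unfolded OT_def], of t] t by (simp add: space_restrict_space)

lemma process_AE_integrable:
  fixes u :: "real \<Rightarrow> 'a \<Rightarrow> real"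
  assumes "integrable (OT M T) (\<lambda>z. u (snd z) (fst z))"
  shows "AE \<omega> in M. set_integrable lborel {0..T} (\<lambda>s. u s \<omega>)"
    and "set_integrable lborel {0..T} (\<lambda>s. \<integral>\<omega>. u s \<omega> \<partial>M)"
proof -
  interpret P: pair_sigma_finite M "time_measure T" by (rule pair_sigma_finite_OT)
  have i: "integrable (M \<Otimes>\<^sub>M time_measure T) (\<lambda>(\<omega>, s). u s \<omega>)"
    using assms by (simp add: OT_def case_prod_beta')
  show "AE \<omega> in M. set_integrable lborel {0..T} (\<lambda>s. u s \<omega>)"
    using P.AE_integrable_fst[OF i] by (simp add: integrable_time_measure)
  show "set_integrable lborel {0..T} (\<lambda>s. \<integral>\<omega>. u s \<omega> \<partial>M)"
    using P.integrable_snd[OF i] by (simp add: integrable_time_measure)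
qed

lemma process_mult_integrable:
  fixes u :: "real \<Rightarrow> 'a \<Rightarrow> real"
  assumes u: "integrable (OT M T) (\<lambda>z. u (snd z) (fst z))"
    and f: "f \<in> borel_measurable (time_measure T)" "\<And>s. s \<in> {0..T} \<Longrightarrow> \<bar>f s\<bar> \<le> B"
  shows "integrable (OT M T) (\<lambda>z. f (snd z) * u (snd z) (fst z))"
proof (rule Bochner_Integration.integrable_bound[OF integrable_mult_right[OF u, of B]])
  have "(\<lambda>z. f (snd z)) \<in> borel_measurable (OT M T)"
    unfolding OT_def by (rule measurable_compose[OF measurable_snd f(1)])
  then show "(\<lambda>z. f (snd z) * u (snd z) (fst z)) \<in> borel_measurable (OT M T)"
    using u by (intro borel_measurable_times) auto
  show "AE z in OT M T. norm (f (snd z) * u (snd z) (fst z)) \<le> norm (B * u (snd z) (fst z))"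
  proof (rule AE_I2)
    fix z assume "z \<in> space (OT M T)"
    then have "snd z \<in> {0..T}" by (auto simp: OT_def space_pair_measure space_restrict_space)
    then show "norm (f (snd z) * u (snd z) (fst z)) \<le> norm (B * u (snd z) (fst z))"
      using f(2)[of "snd z"] by (auto simp: abs_mult intro!: mult_right_mono)
  qed
qed

text \<open>Fubini in two readings: the second claim gives the equation of the mean state, and the
  third rewrites a mean as a pairing on the product space, the form in which the objective is
  quadratic.\<close>

lemma process_vconv_integral:
  fixes u :: "real \<Rightarrow> 'a \<Rightarrow> real"
  assumes u: "integrable (OT M T) (\<lambda>z. u (snd z) (fst z))"
    and f: "continuous_on {0..T} f" and t: "t \<in> {0..T}"
  shows "integrable M (\<lambda>\<omega>. vconv f (\<lambda>s. u s \<omega>) t)"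
    and "(\<integral>\<omega>. vconv f (\<lambda>s. u s \<omega>) t \<partial>M) = vconv f (\<lambda>s. \<integral>\<omega>. u s \<omega> \<partial>M) t"
    and "(\<integral>\<omega>. vconv f (\<lambda>s. u s \<omega>) t \<partial>M)
      = (\<integral>z. (indicator {0..t} (snd z) * f (t - snd z)) * u (snd z) (fst z) \<partial>OT M T)"
proof -
  interpret P: pair_sigma_finite M "time_measure T" by (rule pair_sigma_finite_OT)
  obtain B where B: "\<And>s. \<bar>indicator {0..t} s * f (t - s)\<bar> \<le> B"
    and m: "(\<lambda>s. indicator {0..t} s * f (t - s)) \<in> borel_measurable borel"
    using vconv_kernel_bounded[OF f t] by blast
  have "(\<lambda>s. indicator {0..t} s * f (t - s)) \<in> borel_measurable (time_measure T)"
    using m by (intro measurable_restrict_space1) simp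
  from process_mult_integrable[OF u this B]
  have i: "integrable (M \<Otimes>\<^sub>M time_measure T) (\<lambda>(\<omega>, s). (indicator {0..t} s * f (t - s)) * u s \<omega>)"
    by (simp add: OT_def case_prod_beta')
  have tT: "t \<le> T" using t by simp
  show "integrable M (\<lambda>\<omega>. vconv f (\<lambda>s. u s \<omega>) t)"
    unfolding vconv_time_measure[OF tT] by (rule P.integrable_fst[OF i])
  show "(\<integral>\<omega>. vconv f (\<lambda>s. u s \<omega>) t \<partial>M)
      = (\<integral>z. (indicator {0..t} (snd z) * f (t - snd z)) * u (snd z) (fst z) \<partial>OT M T)"
    unfolding vconv_time_measure[OF tT] OT_def using P.integral_fst[OF i] by (simp add: case_prod_beta')
  have "(\<integral>\<omega>. vconv f (\<lambda>s. u s \<omega>) t \<partial>M)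
      = (\<integral>s. (\<integral>\<omega>. (indicator {0..t} s * f (t - s)) * u s \<omega> \<partial>M) \<partial>time_measure T)"
    unfolding vconv_time_measure[OF tT] by (rule P.Fubini_integral[OF i, symmetric])
  then show "(\<integral>\<omega>. vconv f (\<lambda>s. u s \<omega>) t \<partial>M) = vconv f (\<lambda>s. \<integral>\<omega>. u s \<omega> \<partial>M) t"
    unfolding vconv_time_measure[OF tT] by (simp only: integral_mult_right_zero)
qed

lemma process_vconv_measurable:
  fixes u :: "real \<Rightarrow> 'a \<Rightarrow> real"
  assumes u: "(\<lambda>z. u (snd z) (fst z)) \<in> borel_measurable (OT M T)"
    and f: "continuous_on {0..T} f"
  shows "(\<lambda>z. vconv f (\<lambda>s. u s (fst z)) (snd z)) \<in> borel_measurable (OT M T)"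
proof -
  let ?L = "time_measure T" and ?N = "M \<Otimes>\<^sub>M time_measure T"
  interpret L: finite_measure ?L by (rule finite_measure_time_interval)
  have [measurable]: "(\<lambda>s. indicator {0..T} s * f s) \<in> borel_measurable borel"
    using borel_measurable_continuous_on_indicator[OF _ f] by simp
  have s1[measurable]: "(\<lambda>y. snd (fst y)) \<in> ?N \<Otimes>\<^sub>M ?L \<rightarrow>\<^sub>M borel" "snd \<in> ?N \<Otimes>\<^sub>M ?L \<rightarrow>\<^sub>M borel"
    by (auto intro!: measurable_compose[OF measurable_snd] measurable_compose[OF measurable_fst] measurable_restrict_space1)
  have "(\<lambda>y. (fst (fst y), snd y)) \<in> ?N \<Otimes>\<^sub>M ?L \<rightarrow>\<^sub>M ?N"
    by measurable
  from measurable_compose[OF this u[unfolded OT_def]]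
  have [measurable]: "(\<lambda>y. u (snd y) (fst (fst y))) \<in> borel_measurable (?N \<Otimes>\<^sub>M ?L)" by simp
  have "(\<lambda>y. (indicator {0..T} (snd (fst y) - snd y) * f (snd (fst y) - snd y)) * u (snd y) (fst (fst y)))
    \<in> borel_measurable (?N \<Otimes>\<^sub>M ?L)"
    by measurable
  then have "(\<lambda>z. \<integral>s. (indicator {0..T} (snd z - s) * f (snd z - s)) * u s (fst z) \<partial>?L) \<in> borel_measurable ?N"
    by (intro L.borel_measurable_lebesgue_integral) (simp add: case_prod_beta')
  also have "?this \<longleftrightarrow> (\<lambda>z. vconv f (\<lambda>s. u s (fst z)) (snd z)) \<in> borel_measurable ?N"
  proof (rule measurable_cong)
    fix z assume "z \<in> space ?N"
    then have z: "0 \<le> snd z" "snd z \<le> T" by (auto simp: space_pair_measure space_restrict_space)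
    show "(\<integral>s. (indicator {0..T} (snd z - s) * f (snd z - s)) * u s (fst z) \<partial>?L) = vconv f (\<lambda>s. u s (fst z)) (snd z)"
      unfolding vconv_time_measure[OF z(2)]
      by (rule Bochner_Integration.integral_cong) (use z in \<open>auto simp: indicator_def space_restrict_space\<close>)
  qed
  finally show ?thesis by (simp add: OT_def)
qed

text \<open>Pathwise, Cauchy-Schwarz bounds the squared convolution at every time by B^2 T times the
  integral of the squared path. This bound does not depend on t and has finite expectation.\<close>

lemma process_vconv_square_integrable:
  fixes u :: "real \<Rightarrow> 'a \<Rightarrow> real"
  assumes u: "(\<lambda>z. u (snd z) (fst z)) \<in> borel_measurable (OT M T)"
    and u2: "integrable (OT M T) (\<lambda>z. (u (snd z) (fst z))\<^sup>2)"
    and f: "continuous_on {0..T} f" and T: "0 \<le> T"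
  shows "integrable (OT M T) (\<lambda>z. (vconv f (\<lambda>s. u s (fst z)) (snd z))\<^sup>2)"
proof -
  let ?L = "time_measure T"
  interpret L: finite_measure ?L by (rule finite_measure_time_interval)
  interpret P: pair_sigma_finite M ?L by (rule pair_sigma_finite_OT)
  obtain B where B: "0 \<le> B" "\<And>s. s \<in> {0..T} \<Longrightarrow> \<bar>f s\<bar> \<le> B"
    using continuous_on_Icc_bounded[OF f] by blast
  have u1: "integrable (OT M T) (\<lambda>z. u (snd z) (fst z))"
    by (rule process_square_integrable_imp_integrable[OF u u2])
  have u2': "integrable (M \<Otimes>\<^sub>M ?L) (\<lambda>(\<omega>, s). (u s \<omega>)\<^sup>2)"
    using u2 by (simp add: OT_def case_prod_beta')
  define I where "I \<omega> = (\<integral>s. (u s \<omega>)\<^sup>2 \<partial>?L)" for \<omega>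
  have I: "integrable M I" unfolding I_def by (rule P.integrable_fst[OF u2'])
  have bound: "AE \<omega> in M. \<forall>t\<in>{0..T}. (vconv f (\<lambda>s. u s \<omega>) t)\<^sup>2 \<le> B\<^sup>2 * (T * I \<omega>)"
    using process_AE_integrable(1)[OF u1] P.AE_integrable_fst[OF u2']
  proof eventually_elim
    case (elim \<omega>)
    show ?case
    proof
      fix t assume t: "t \<in> {0..T}"
      have abs_int: "integrable ?L (\<lambda>s. \<bar>u s \<omega>\<bar>)"
        using set_integrable_abs[OF elim(1)] by (simp add: integrable_time_measure)
      have "\<bar>vconv f (\<lambda>s. u s \<omega>) t\<bar> \<le> B * (LINT s:{0..t}|lborel. \<bar>u s \<omega>\<bar>)"
        by (rule vconv_bound[OF f elim(1) t B(2)])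
      also have "(LINT s:{0..t}|lborel. \<bar>u s \<omega>\<bar>) = (\<integral>s. (indicator {0..t} s * 1) * \<bar>u s \<omega>\<bar> \<partial>?L)"
        using t vconv_time_measure[of t T "\<lambda>_. 1" "\<lambda>s. \<bar>u s \<omega>\<bar>"] by (simp add: vconv_def)
      also have "\<dots> \<le> (\<integral>s. \<bar>u s \<omega>\<bar> \<partial>?L)"
        by (rule integral_mono'[OF abs_int]) (auto simp: indicator_def)
      finally have "\<bar>vconv f (\<lambda>s. u s \<omega>) t\<bar> \<le> B * (\<integral>s. \<bar>u s \<omega>\<bar> \<partial>?L)"
        using B(1) by (simp add: mult_left_mono)
      from power_mono[OF this abs_ge_zero, of 2]
      have "(vconv f (\<lambda>s. u s \<omega>) t)\<^sup>2 \<le> B\<^sup>2 * (\<integral>s. \<bar>u s \<omega>\<bar> \<partial>?L)\<^sup>2"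
        by (simp add: power_mult_distrib)
      moreover have "(\<integral>s. 1 * \<bar>u s \<omega>\<bar> \<partial>?L)\<^sup>2 \<le> (\<integral>s. 1\<^sup>2 \<partial>?L) * (\<integral>s. \<bar>u s \<omega>\<bar>\<^sup>2 \<partial>?L)"
        using abs_int elim(2) by (intro Cauchy_Schwarz_integral(2)) auto
      moreover have "(\<integral>s. 1\<^sup>2 \<partial>?L) = T"
        using T by (simp add: measure_restrict_space space_restrict_space)
      ultimately have "(\<integral>s. \<bar>u s \<omega>\<bar> \<partial>?L)\<^sup>2 \<le> T * I \<omega>" by (simp add: I_def)
      then have "B\<^sup>2 * (\<integral>s. \<bar>u s \<omega>\<bar> \<partial>?L)\<^sup>2 \<le> B\<^sup>2 * (T * I \<omega>)" by (intro mult_left_mono) auto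
      then show "(vconv f (\<lambda>s. u s \<omega>) t)\<^sup>2 \<le> B\<^sup>2 * (T * I \<omega>)"
        using \<open>(vconv f (\<lambda>s. u s \<omega>) t)\<^sup>2 \<le> B\<^sup>2 * (\<integral>s. \<bar>u s \<omega>\<bar> \<partial>?L)\<^sup>2\<close> by linarith
    qed
  qed
  note V = process_vconv_measurable[OF u f, unfolded OT_def]
  have V2: "(\<lambda>z. (vconv f (\<lambda>s. u s (fst z)) (snd z))\<^sup>2) \<in> borel_measurable (M \<Otimes>\<^sub>M ?L)"
    using V by measurable
  have Vs: "(\<lambda>t. (vconv f (\<lambda>s. u s \<omega>) t)\<^sup>2) \<in> borel_measurable ?L" if "\<omega> \<in> space M" for \<omega>
    using measurable_Pair2[OF V2 that] by simp
  have Vi: "AE \<omega> in M. integrable ?L (\<lambda>t. (vconv f (\<lambda>s. u s \<omega>) t)\<^sup>2)"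
    using bound AE_space
  proof eventually_elim
    case (elim \<omega>)
    show ?case
    proof (rule L.integrable_const_bound[where B = "B\<^sup>2 * (T * I \<omega>)"])
      show "AE t in ?L. norm ((vconv f (\<lambda>s. u s \<omega>) t)\<^sup>2) \<le> B\<^sup>2 * (T * I \<omega>)"
        using elim(1) by (intro AE_I2) (simp add: space_restrict_space)
    qed (rule Vs[OF elim(2)])
  qed
  have "integrable M (\<lambda>\<omega>. \<integral>t. norm ((vconv f (\<lambda>s. u s \<omega>) t)\<^sup>2) \<partial>?L)"
  proof (rule Bochner_Integration.integrable_bound)
    show "integrable M (\<lambda>\<omega>. T * (B\<^sup>2 * (T * I \<omega>)))" using I by simp
    show "(\<lambda>\<omega>. \<integral>t. norm ((vconv f (\<lambda>s. u s \<omega>) t)\<^sup>2) \<partial>?L) \<in> borel_measurable M"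
      using V2 by (intro L.borel_measurable_lebesgue_integral) (simp add: case_prod_beta')
    show "AE \<omega> in M. norm (\<integral>t. norm ((vconv f (\<lambda>s. u s \<omega>) t)\<^sup>2) \<partial>?L) \<le> norm (T * (B\<^sup>2 * (T * I \<omega>)))"
      using bound
    proof eventually_elim
      case (elim \<omega>)
      have I0: "0 \<le> I \<omega>" by (simp add: I_def)
      have "(\<integral>t. norm ((vconv f (\<lambda>s. u s \<omega>) t)\<^sup>2) \<partial>?L) \<le> (\<integral>t. B\<^sup>2 * (T * I \<omega>) \<partial>?L)"
        using elim I0 T by (intro integral_mono') (auto simp: space_restrict_space)
      also have "\<dots> = T * (B\<^sup>2 * (T * I \<omega>))"
        using T by (simp add: measure_restrict_space space_restrict_space)
      finally show ?case using I0 T by simp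
    qed
  qed
  then show ?thesis
    unfolding OT_def using Vi by (intro P.Fubini_integrable[OF V2]) auto
qed

end

section \<open>State equation, objective and maximiser\<close>

locale volterra_control = holder_kernel +
  fixes \<alpha> \<beta> \<sigma> X0 :: real and r :: "real \<Rightarrow> real"
  assumes resolvent: "resolvent_on T \<beta> K r"
begin

lemma r_continuous: "continuous_on {0..T} r"
  using resolvent by (simp add: resolvent_on_def)

lemma L2a_integrable:
  assumes "L2a M W T u"
  shows "integrable (OT M T) (\<lambda>z. u (snd z) (fst z))"
  using assms by (auto simp: L2a_def dest: process_square_integrable_imp_integrable)

text \<open>Gives content to the choice in \<open>Jfun\<close>. The resolvent formula is applied
  path by path to the forcing term F, which collects the initial value, the control and the noise; X
  inherits joint measurability and square integrability from F.\<close>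

lemma state_sol_exists:
  assumes u: "L2a M W T u"
  shows "\<exists>X. state_sol M W T K \<alpha> \<beta> \<sigma> X0 u X"
proof -
  have um: "(\<lambda>z. u (snd z) (fst z)) \<in> borel_measurable (OT M T)"
    and u2: "integrable (OT M T) (\<lambda>z. (u (snd z) (fst z))\<^sup>2)"
    using u by (auto simp: L2a_def)
  have T0: "0 \<le> T" using T by simp
  interpret N: finite_measure "OT M T" by (rule finite_measure_OT)
  define F where "F t \<omega> = X0 + \<alpha> * vconv K (\<lambda>s. u s \<omega>) t + \<sigma> * Z t \<omega>" for t \<omega>
  define X where "X t \<omega> = F t \<omega> - \<beta> * vconv r (\<lambda>s. F s \<omega>) t" for t \<omega>
  have 1: "(\<lambda>z. \<alpha> * vconv K (\<lambda>s. u s (fst z)) (snd z)) \<in> borel_measurable (OT M T)"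
    by (intro borel_measurable_times borel_measurable_const process_vconv_measurable[OF um K_continuous])
  then have 2: "(\<lambda>z. X0 + \<alpha> * vconv K (\<lambda>s. u s (fst z)) (snd z)) \<in> borel_measurable (OT M T)"
    by (rule borel_measurable_add[OF borel_measurable_const])
  have 3: "(\<lambda>z. \<sigma> * Z (snd z) (fst z)) \<in> borel_measurable (OT M T)"
    by (intro borel_measurable_times borel_measurable_const Z_joint_measurable)
  have Fm: "(\<lambda>z. F (snd z) (fst z)) \<in> borel_measurable (OT M T)"
    unfolding F_def by (rule borel_measurable_add[OF 2 3])
  have "integrable (OT M T) (\<lambda>z. (\<alpha> * vconv K (\<lambda>s. u s (fst z)) (snd z))\<^sup>2)"
    using process_vconv_square_integrable[OF um u2 K_continuous T0] by (simp add: power_mult_distrib)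
  then have "integrable (OT M T) (\<lambda>z. (X0 + \<alpha> * vconv K (\<lambda>s. u s (fst z)) (snd z))\<^sup>2)"
    by (intro integrable_power2_add[OF borel_measurable_const 1]) simp_all
  moreover have "integrable (OT M T) (\<lambda>z. (\<sigma> * Z (snd z) (fst z))\<^sup>2)"
    using Z_joint_square_integrable by (simp add: power_mult_distrib)
  ultimately have F2: "integrable (OT M T) (\<lambda>z. (F (snd z) (fst z))\<^sup>2)"
    unfolding F_def by (rule integrable_power2_add[OF 2 3])
  have 4: "(\<lambda>z. \<beta> * vconv r (\<lambda>s. F s (fst z)) (snd z)) \<in> borel_measurable (OT M T)"
    by (intro borel_measurable_times borel_measurable_const process_vconv_measurable[OF Fm r_continuous])
  have Xm: "(\<lambda>z. X (snd z) (fst z)) \<in> borel_measurable (OT M T)"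
    unfolding X_def by (rule borel_measurable_diff[OF Fm 4])
  have "integrable (OT M T) (\<lambda>z. (\<beta> * vconv r (\<lambda>s. F s (fst z)) (snd z))\<^sup>2)"
    using process_vconv_square_integrable[OF Fm F2 r_continuous T0] by (simp add: power_mult_distrib)
  then have X2: "integrable (OT M T) (\<lambda>z. (X (snd z) (fst z))\<^sup>2)"
    unfolding X_def by (rule integrable_power2_diff[OF Fm 4 F2])
  have "AE \<omega> in M. set_integrable lborel {0..t} (\<lambda>s. K (t - s) * (\<alpha> * u s \<omega> - \<beta> * X s \<omega>))
      \<and> X t \<omega> = X0 + (LINT s:{0..t}|lborel. K (t - s) * (\<alpha> * u s \<omega> - \<beta> * X s \<omega>)) + \<sigma> * Z t \<omega>"
    if t: "t \<in> {0..T}" for t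
    using process_AE_integrable(1)[OF process_square_integrable_imp_integrable[OF um u2]]
      process_AE_integrable(1)[OF process_square_integrable_imp_integrable[OF Fm F2]]
      process_AE_integrable(1)[OF process_square_integrable_imp_integrable[OF Xm X2]]
  proof eventually_elim
    case (elim \<omega>)
    have i: "set_integrable lborel {0..T} (\<lambda>s. \<alpha> * u s \<omega>)" "set_integrable lborel {0..T} (\<lambda>s. \<beta> * X s \<omega>)"
      using elim by auto
    have "vconv K (\<lambda>s. \<alpha> * u s \<omega> - \<beta> * X s \<omega>) t = \<alpha> * vconv K (\<lambda>s. u s \<omega>) t - \<beta> * vconv K (\<lambda>s. X s \<omega>) t"
      using vconv_diff_right[OF K_continuous i t] by (simp only: vconv_scale_right)
    moreover have "X t \<omega> = F t \<omega> - \<beta> * vconv K (\<lambda>s. X s \<omega>) t"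
      unfolding X_def by (rule volterra_solution[OF K_continuous resolvent elim(2) t])
    ultimately have "X t \<omega> = X0 + vconv K (\<lambda>s. \<alpha> * u s \<omega> - \<beta> * X s \<omega>) t + \<sigma> * Z t \<omega>"
      by (simp add: F_def)
    moreover have "set_integrable lborel {0..t} (\<lambda>s. K (t - s) * (\<alpha> * u s \<omega> - \<beta> * X s \<omega>))"
      using i by (intro set_integrable_vconv[OF K_continuous _ t] set_integral_diff(1))
    ultimately show ?case by (simp add: vconv_def)
  qed
  then have "state_sol M W T K \<alpha> \<beta> \<sigma> X0 u X"
    unfolding state_sol_def
    using Xm X2 process_section_measurable[OF Xm] Z_wiener_integral by blast
  then show ?thesis by (rule exI[where x = X])
qed

text \<open>Taking expectations removes the noise, and the mean state solves a deterministic Volterra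
  equation that the resolvent inverts.\<close>

lemma state_sol_mean:
  assumes u: "L2a M W T u" and X: "state_sol M W T K \<alpha> \<beta> \<sigma> X0 u X"
  shows "integrable M (X T)"
    and "(\<integral>\<omega>. X T \<omega> \<partial>M) = X0 - \<beta> * (X0 * vconv r (\<lambda>_. 1) T)
      + \<alpha> * (\<integral>z. r (T - snd z) * u (snd z) (fst z) \<partial>OT M T)"
proof -
  have TT: "T \<in> {0..T}" using T by simp
  have u1: "integrable (OT M T) (\<lambda>z. u (snd z) (fst z))" by (rule L2a_integrable[OF u])
  have X1: "integrable (OT M T) (\<lambda>z. X (snd z) (fst z))"
    using X by (auto simp: state_sol_def dest: process_square_integrable_imp_integrable)
  define m where "m t = (\<integral>\<omega>. X t \<omega> \<partial>M)" for t
  define v where "v t = (\<integral>\<omega>. u t \<omega> \<partial>M)" for t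
  have m_int: "set_integrable lborel {0..T} m" and v_int: "set_integrable lborel {0..T} v"
    unfolding m_def v_def using process_AE_integrable(2)[OF X1] process_AE_integrable(2)[OF u1] by auto
  have main: "integrable M (X t) \<and> m t = (X0 + \<alpha> * vconv K v t) - \<beta> * vconv K m t" if t: "t \<in> {0..T}" for t
  proof -
    \<comment> \<open>\<open>state_sol\<close> asks for some Wiener integral at each t, so
      \<open>Y\<close> need not be \<open>Z t\<close>; it enters through its integrability and its
      zero mean.\<close>
    obtain Y where Xt: "X t \<in> borel_measurable M" and Y: "wiener_integral M W (\<lambda>s. K (t - s)) t Y"
      and eq: "AE \<omega> in M. X t \<omega> = X0 + (LINT s:{0..t}|lborel. K (t - s) * (\<alpha> * u s \<omega> - \<beta> * X s \<omega>)) + \<sigma> * Y \<omega>"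
      using X t unfolding state_sol_def AE_conj_iff by blast
    have t0: "0 \<le> t" using t by simp
    note Ym = wiener_integral_mean[OF Y t0]
    note Vu = process_vconv_integral[OF u1 K_continuous t]
    note VX = process_vconv_integral[OF X1 K_continuous t]
    let ?R = "\<lambda>\<omega>. X0 + \<alpha> * vconv K (\<lambda>s. u s \<omega>) t - \<beta> * vconv K (\<lambda>s. X s \<omega>) t + \<sigma> * Y \<omega>"
    have AE: "AE \<omega> in M. X t \<omega> = ?R \<omega>"
      using eq process_AE_integrable(1)[OF u1] process_AE_integrable(1)[OF X1]
    proof eventually_elim
      case (elim \<omega>)
      have i: "set_integrable lborel {0..T} (\<lambda>s. \<alpha> * u s \<omega>)" "set_integrable lborel {0..T} (\<lambda>s. \<beta> * X s \<omega>)"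
        using elim by auto
      have "vconv K (\<lambda>s. \<alpha> * u s \<omega> - \<beta> * X s \<omega>) t = \<alpha> * vconv K (\<lambda>s. u s \<omega>) t - \<beta> * vconv K (\<lambda>s. X s \<omega>) t"
        using vconv_diff_right[OF K_continuous i t] by (simp only: vconv_scale_right)
      then show ?case using elim(1) by (simp add: vconv_def)
    qed
    have Ri: "integrable M ?R" using Ym(1) Vu(1) VX(1) by simp
    have "integrable M (X t)"
    proof (rule integrable_cong_AE_imp[OF Ri Xt])
      show "AE \<omega> in M. ?R \<omega> = X t \<omega>" using AE by eventually_elim (rule sym)
    qed
    moreover have "m t = (\<integral>\<omega>. ?R \<omega> \<partial>M)"
      unfolding m_def using AE Xt Ri by (intro integral_cong_AE) auto
    moreover have "(\<integral>\<omega>. ?R \<omega> \<partial>M) = (X0 + \<alpha> * vconv K v t) - \<beta> * vconv K m t"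
      using Ym Vu(1,2) VX(1,2) unfolding m_def v_def by (simp add: prob_space)
    ultimately show ?thesis by simp
  qed
  then show "integrable M (X T)" using TT by blast
  let ?f = "\<lambda>t. X0 + \<alpha> * vconv K v t"
  \<comment> \<open>Uniqueness for the deterministic equation makes the mean the same for every
    state, so the choice made in \<open>Jfun\<close> does not influence its value.\<close>
  have "m T = ?f T - \<beta> * vconv r ?f T"
    by (rule volterra_unique[OF K_continuous resolvent m_int TT]) (use main in blast)
  also have "vconv r ?f T = vconv r (\<lambda>_. X0) T + vconv r (\<lambda>s. \<alpha> * vconv K v s) T"
    by (rule vconv_add_right[OF r_continuous _ _ TT])
      (simp_all add: set_integrable_continuous_Icc vconv_integrable[OF K_continuous v_int])
  also have "vconv r (\<lambda>_. X0) T = X0 * vconv r (\<lambda>_. 1) T"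
    using vconv_scale_right[of r X0 "\<lambda>_. 1" T] by simp
  also have "vconv r (\<lambda>s. \<alpha> * vconv K v s) T = \<alpha> * vconv r (vconv K v) T"
    by (rule vconv_scale_right)
  \<comment> \<open>K gives way to r here: K * v - \<beta> r * (K * v) equals r * v.\<close>
  also have "?f T - \<beta> * (X0 * vconv r (\<lambda>_. 1) T + \<alpha> * vconv r (vconv K v) T)
      = X0 - \<beta> * (X0 * vconv r (\<lambda>_. 1) T) + \<alpha> * vconv r v T"
    using vconv_resolvent(2)[OF K_continuous resolvent v_int TT] by (simp add: algebra_simps)
  also have "vconv r v T = (\<integral>z. (indicator {0..T} (snd z) * r (T - snd z)) * u (snd z) (fst z) \<partial>OT M T)"
    unfolding v_def using process_vconv_integral(2,3)[OF u1 r_continuous TT] by simp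
  also have "\<dots> = (\<integral>z. r (T - snd z) * u (snd z) (fst z) \<partial>OT M T)"
    by (rule Bochner_Integration.integral_cong) (auto simp: OT_def space_pair_measure space_restrict_space)
  finally show "(\<integral>\<omega>. X T \<omega> \<partial>M) = X0 - \<beta> * (X0 * vconv r (\<lambda>_. 1) T)
      + \<alpha> * (\<integral>z. r (T - snd z) * u (snd z) (fst z) \<partial>OT M T)"
    by (simp add: m_def)
qed

lemma Jfun_eq:
  assumes u: "L2a M W T u"
  shows "Jfun M W T K \<alpha> \<beta> \<sigma> X0 a1 a2 u = a2 * (X0 - \<beta> * (X0 * vconv r (\<lambda>_. 1) T))
    + a2 * \<alpha> * (\<integral>z. r (T - snd z) * u (snd z) (fst z) \<partial>OT M T)
    - a1 * (\<integral>z. (u (snd z) (fst z))\<^sup>2 \<partial>OT M T)"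
proof -
  interpret P: pair_sigma_finite M "time_measure T" by (rule pair_sigma_finite_OT)
  define X where "X = (SOME X. state_sol M W T K \<alpha> \<beta> \<sigma> X0 u X)"
  have X: "state_sol M W T K \<alpha> \<beta> \<sigma> X0 u X"
    unfolding X_def by (rule someI_ex[OF state_sol_exists[OF u]])
  note mean = state_sol_mean[OF u X]
  have i: "integrable (M \<Otimes>\<^sub>M time_measure T) (\<lambda>(\<omega>, s). (u s \<omega>)\<^sup>2)"
    using u by (simp add: L2a_def OT_def case_prod_beta')
  have "Jfun M W T K \<alpha> \<beta> \<sigma> X0 a1 a2 u = (\<integral>\<omega>. - (a1 * (\<integral>s. (u s \<omega>)\<^sup>2 \<partial>time_measure T)) + a2 * X T \<omega> \<partial>M)"
    by (simp add: Jfun_def Let_def integral_time_measure flip: X_def)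
  also have "\<dots> = - (a1 * (\<integral>\<omega>. (\<integral>s. (u s \<omega>)\<^sup>2 \<partial>time_measure T) \<partial>M)) + a2 * (\<integral>\<omega>. X T \<omega> \<partial>M)"
    using P.integrable_fst[OF i] mean(1) by simp
  also have "(\<integral>\<omega>. (\<integral>s. (u s \<omega>)\<^sup>2 \<partial>time_measure T) \<partial>M) = (\<integral>z. (u (snd z) (fst z))\<^sup>2 \<partial>OT M T)"
    using P.integral_fst[OF i] by (simp add: OT_def case_prod_beta')
  finally show ?thesis by (simp add: mean(2) algebra_simps)
qed

text \<open>For each t this is the vertex of the parabola a2 \<alpha> r(T - t) x - a1 x^2 in x. It
  is deterministic, hence adapted.\<close>

definition opt_control :: "real \<Rightarrow> real \<Rightarrow> real \<Rightarrow> 'a \<Rightarrow> real" where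
  "opt_control a1 a2 t \<omega> = \<alpha> * a2 / (2 * a1) * r (T - t)"

lemma r_reflect_measurable: "(\<lambda>z. r (T - snd z)) \<in> borel_measurable (OT M T)"
proof -
  have "continuous_on {0..T} (\<lambda>s. r (T - s))"
    by (rule continuous_on_compose2[OF r_continuous]) (auto intro!: continuous_intros)
  then show ?thesis
    unfolding OT_def by (rule measurable_compose[OF measurable_snd continuous_measurable_time_measure])
qed

lemma opt_control_L2a: "L2a M W T (opt_control a1 a2)"
proof -
  interpret N: finite_measure "OT M T" by (rule finite_measure_OT)
  note [measurable] = r_reflect_measurable
  obtain B where B: "\<And>s. s \<in> {0..T} \<Longrightarrow> \<bar>r s\<bar> \<le> B"
    using continuous_on_Icc_bounded[OF r_continuous] by blast
  have "integrable (OT M T) (\<lambda>z. (r (T - snd z))\<^sup>2)"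
  proof (rule N.integrable_const_bound[where B = "B\<^sup>2"])
    show "AE z in OT M T. norm ((r (T - snd z))\<^sup>2) \<le> B\<^sup>2"
    proof (rule AE_I2)
      fix z assume "z \<in> space (OT M T)"
      then have "T - snd z \<in> {0..T}" by (auto simp: OT_def space_pair_measure space_restrict_space)
      from power_mono[OF B[OF this] abs_ge_zero, of 2]
      show "norm ((r (T - snd z))\<^sup>2) \<le> B\<^sup>2" by simp
    qed
  qed measurable
  then have "integrable (OT M T) (\<lambda>z. (opt_control a1 a2 (snd z) (fst z))\<^sup>2)"
    unfolding opt_control_def power_mult_distrib by (rule integrable_mult_right)
  then show ?thesis
    unfolding L2a_def by (simp add: opt_control_def[abs_def])
qed

text \<open>The linear term of the objective is 2 a1 times the pairing of the control with
  \<open>opt_control\<close>. Since \<open>opt_control\<close> is itself admissible, the maximiser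
  over the full L2 space of the product is also the maximiser over adapted controls.\<close>

lemma Jfun_complete_square:
  assumes u: "L2a M W T u" and a1: "0 < a1"
  shows "Jfun M W T K \<alpha> \<beta> \<sigma> X0 a1 a2 u = Jfun M W T K \<alpha> \<beta> \<sigma> X0 a1 a2 (opt_control a1 a2)
    - a1 * (\<integral>z. (u (snd z) (fst z) - opt_control a1 a2 (snd z) (fst z))\<^sup>2 \<partial>OT M T)"
proof -
  let ?N = "OT M T" and ?U = "\<lambda>z. u (snd z) (fst z)" and ?O = "\<lambda>z. opt_control a1 a2 (snd z) (fst z)"
  let ?c = "a2 * (X0 - \<beta> * (X0 * vconv r (\<lambda>_. 1) T))"
  have m: "?U \<in> borel_measurable ?N" "?O \<in> borel_measurable ?N"
    and i: "integrable ?N (\<lambda>z. (?U z)\<^sup>2)" "integrable ?N (\<lambda>z. (?O z)\<^sup>2)"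
    using u opt_control_L2a by (auto simp: L2a_def)
  have J: "Jfun M W T K \<alpha> \<beta> \<sigma> X0 a1 a2 w = ?c + 2 * a1 * (\<integral>z. ?O z * w (snd z) (fst z) \<partial>?N)
      - a1 * (\<integral>z. (w (snd z) (fst z))\<^sup>2 \<partial>?N)" if "L2a M W T w" for w
  proof -
    have "(\<integral>z. ?O z * w (snd z) (fst z) \<partial>?N) = \<alpha> * a2 / (2 * a1) * (\<integral>z. r (T - snd z) * w (snd z) (fst z) \<partial>?N)"
      unfolding opt_control_def mult.assoc by (rule integral_mult_right_zero)
    then show ?thesis using Jfun_eq[OF that, of a1 a2] a1 by simp
  qed
  have iO: "integrable ?N (\<lambda>z. ?O z * ?U z)"
    by (rule Cauchy_Schwarz_integral(1)[OF m(2,1) i(2,1)])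
  have "(\<integral>z. (?U z - ?O z)\<^sup>2 \<partial>?N) = (\<integral>z. (?U z)\<^sup>2 - 2 * (?O z * ?U z) + (?O z)\<^sup>2 \<partial>?N)"
    by (simp add: power2_diff algebra_simps)
  also have "\<dots> = (\<integral>z. (?U z)\<^sup>2 \<partial>?N) - 2 * (\<integral>z. ?O z * ?U z \<partial>?N) + (\<integral>z. (?O z)\<^sup>2 \<partial>?N)"
    using i iO by simp
  finally have E: "(\<integral>z. (?U z - ?O z)\<^sup>2 \<partial>?N) = (\<integral>z. (?U z)\<^sup>2 \<partial>?N) - 2 * (\<integral>z. ?O z * ?U z \<partial>?N) + (\<integral>z. (?O z)\<^sup>2 \<partial>?N)" .
  show ?thesis
    unfolding E J[OF u] J[OF opt_control_L2a[of a1 a2]] power2_eq_square[of "?O _", symmetric]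
    by (simp add: algebra_simps)
qed

end

theorem theorem3p3:
  fixes M :: "'a measure" and W :: "real \<Rightarrow> 'a \<Rightarrow> real"
    and T \<alpha> \<beta> \<sigma> a1 a2 X0 h :: real and K :: "real \<Rightarrow> real"
  assumes "std_BM M W"
    and "T > 0" and "\<alpha> > 0" and "\<beta> > 0" and "\<sigma> > 0" and "a1 > 0" and "a2 > 0"
    and "0 < h" and "h < 1" and "holder_on h {0..T} K"
  shows "\<exists>u_hat. L2a M W T u_hat
     \<and> (\<forall>u. L2a M W T u \<longrightarrow> Jfun M W T K \<alpha> \<beta> \<sigma> X0 a1 a2 u \<le> Jfun M W T K \<alpha> \<beta> \<sigma> X0 a1 a2 u_hat)
     \<and> (\<forall>v. L2a M W T v \<and>
           (\<forall>u. L2a M W T u \<longrightarrow> Jfun M W T K \<alpha> \<beta> \<sigma> X0 a1 a2 u \<le> Jfun M W T K \<alpha> \<beta> \<sigma> X0 a1 a2 v)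
           \<longrightarrow> (AE z in OT M T. v (snd z) (fst z) = u_hat (snd z) (fst z)))
     \<and> (\<forall>\<phi>. \<phi> \<in> borel_measurable (OT M T) \<and> integrable (OT M T) (\<lambda>z. (\<phi> z)\<^sup>2) \<longrightarrow>
          (\<lambda>n. \<integral>z. u_hat_n T K \<alpha> \<beta> a1 a2 n (snd z) * \<phi> z \<partial>OT M T)
            \<longlonglongrightarrow> (\<integral>z. u_hat (snd z) (fst z) * \<phi> z \<partial>OT M T))"
proof -
  obtain C where C: "\<forall>s\<in>{0..T}. \<forall>t\<in>{0..T}. \<bar>K s - K t\<bar> \<le> C * \<bar>s - t\<bar> powr h"
    using assms(10) by (auto simp: holder_on_def)
  \<comment> \<open>The locale wants a nonnegative constant, which \<open>holder_on\<close> does not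
    state.\<close>
  interpret holder_kernel M W T h "max C 0" K
  proof
    fix s t assume "s \<in> {0..T}" "t \<in> {0..T}"
    then have "\<bar>K s - K t\<bar> \<le> C * \<bar>s - t\<bar> powr h" using C by blast
    also have "\<dots> \<le> max C 0 * \<bar>s - t\<bar> powr h" by (intro mult_right_mono) auto
    finally show "\<bar>K s - K t\<bar> \<le> max C 0 * \<bar>s - t\<bar> powr h" .
  qed (use assms in auto)
  obtain r where r: "resolvent_on T \<beta> K r"
    and lim: "uniform_limit {0..T} (resolvent_bernstein T K \<beta>) r sequentially"
    using resolvent_bernstein_limit[OF assms(2) K_continuous assms(4)] .
  interpret volterra_control M W T h "max C 0" K \<alpha> \<beta> \<sigma> X0 r
    by unfold_locales (rule r)
  interpret N: finite_measure "OT M T" by (rule finite_measure_OT)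
  let ?J = "Jfun M W T K \<alpha> \<beta> \<sigma> X0 a1 a2" and ?O = "opt_control a1 a2"
  have sq: "integrable (OT M T) (\<lambda>z. (v (snd z) (fst z) - ?O (snd z) (fst z))\<^sup>2)" if "L2a M W T v" for v
    using that opt_control_L2a by (intro integrable_power2_diff) (auto simp: L2a_def)
  have opt: "?J u \<le> ?J ?O" if "L2a M W T u" for u
    using Jfun_complete_square[OF that assms(6), of a2] assms(6) by simp
  have uniq: "AE z in OT M T. v (snd z) (fst z) = ?O (snd z) (fst z)"
    if v: "L2a M W T v" and max: "\<forall>u. L2a M W T u \<longrightarrow> ?J u \<le> ?J v" for v
  proof -
    let ?I = "\<integral>z. (v (snd z) (fst z) - ?O (snd z) (fst z))\<^sup>2 \<partial>OT M T"
    have "?J ?O \<le> ?J v" using max opt_control_L2a by blast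
    then have "a1 * ?I \<le> 0"
      using Jfun_complete_square[OF v assms(6), of a2] by linarith
    then have "?I \<le> 0" using assms(6) by (simp add: mult_le_0_iff)
    moreover have "0 \<le> ?I" by simp
    ultimately have "?I = 0" by (rule antisym)
    then have "AE z in OT M T. (v (snd z) (fst z) - ?O (snd z) (fst z))\<^sup>2 = 0"
      using integral_nonneg_eq_0_iff_AE[OF sq[OF v]] by simp
    then show ?thesis by eventually_elim simp
  qed
  have weak: "(\<lambda>n. \<integral>z. u_hat_n T K \<alpha> \<beta> a1 a2 n (snd z) * \<phi> z \<partial>OT M T)
      \<longlonglongrightarrow> (\<integral>z. ?O (snd z) (fst z) * \<phi> z \<partial>OT M T)"
    if \<phi>m: "\<phi> \<in> borel_measurable (OT M T)" and \<phi>2: "integrable (OT M T) (\<lambda>z. (\<phi> z)\<^sup>2)" for \<phi>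
  proof -
    let ?c = "\<alpha> * a2 / (2 * a1)"
    have \<phi>: "integrable (OT M T) \<phi>"
      by (rule N.square_integrable_imp_integrable[OF \<phi>m \<phi>2])
    have kernel: "integrable (OT M T) (\<lambda>z. q (T - snd z) * \<phi> z)" if q: "continuous_on {0..T} q" for q :: "real \<Rightarrow> real"
    proof -
      have qc: "continuous_on {0..T} (\<lambda>s. q (T - s))"
        by (rule continuous_on_compose2[OF q]) (auto intro!: continuous_intros)
      obtain B where B: "\<And>s. s \<in> {0..T} \<Longrightarrow> \<bar>q (T - s)\<bar> \<le> B"
        using continuous_on_Icc_bounded[OF qc] by blast
      show ?thesis
        using process_mult_integrable[OF _ continuous_measurable_time_measure[OF qc] B, of "\<lambda>s \<omega>. \<phi> (\<omega>, s)"] \<phi> by simp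
    qed
    have rn: "continuous_on {0..T} (resolvent_bernstein T K \<beta> n)" for n
      using resolvent_bernstein[OF assms(4)] by (simp add: resolvent_on_def)
    \<comment> \<open>On the finite measure \<open>OT M T\<close> the test function is integrable,
      so uniform convergence of the resolvents bounds the difference of the pairings by d times its
      L1 norm.\<close>
    have "(\<lambda>n. \<integral>z. resolvent_bernstein T K \<beta> n (T - snd z) * \<phi> z \<partial>OT M T) \<longlonglongrightarrow> (\<integral>z. r (T - snd z) * \<phi> z \<partial>OT M T)"
    proof (rule LIMSEQ_I)
      fix e :: real assume e: "0 < e"
      define A where "A = (\<integral>z. \<bar>\<phi> z\<bar> \<partial>OT M T)"
      have A: "0 \<le> A" by (simp add: A_def)
      define d where "d = e / (A + 1)"
      have d: "0 < d" using e A by (simp add: d_def)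
      obtain n0 where n0: "\<And>n s. n0 \<le> n \<Longrightarrow> s \<in> {0..T} \<Longrightarrow> \<bar>resolvent_bernstein T K \<beta> n s - r s\<bar> < d"
        using uniform_limitD[OF lim d] unfolding eventually_sequentially dist_real_def by blast
      have "norm ((\<integral>z. resolvent_bernstein T K \<beta> n (T - snd z) * \<phi> z \<partial>OT M T) - (\<integral>z. r (T - snd z) * \<phi> z \<partial>OT M T)) < e"
        if n: "n0 \<le> n" for n
      proof -
        let ?D = "\<lambda>z. (resolvent_bernstein T K \<beta> n (T - snd z) - r (T - snd z)) * \<phi> z"
        have eq: "(\<integral>z. resolvent_bernstein T K \<beta> n (T - snd z) * \<phi> z \<partial>OT M T) - (\<integral>z. r (T - snd z) * \<phi> z \<partial>OT M T)
            = (\<integral>z. ?D z \<partial>OT M T)"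
          unfolding left_diff_distrib
          by (rule Bochner_Integration.integral_diff[OF kernel[OF rn] kernel[OF r_continuous], symmetric])
        have "\<bar>\<integral>z. ?D z \<partial>OT M T\<bar> \<le> (\<integral>z. \<bar>?D z\<bar> \<partial>OT M T)" by (rule integral_abs_bound)
        also have "\<dots> \<le> (\<integral>z. d * \<bar>\<phi> z\<bar> \<partial>OT M T)"
        proof (rule integral_mono')
          fix z assume "z \<in> space (OT M T)"
          then have "T - snd z \<in> {0..T}" by (auto simp: OT_def space_pair_measure space_restrict_space)
          from less_imp_le[OF n0[OF n this]] show "\<bar>?D z\<bar> \<le> d * \<bar>\<phi> z\<bar>"
            by (simp add: abs_mult mult_right_mono)
        qed (use \<phi> d in auto)
        also have "\<dots> = d * A" by (simp add: A_def)
        also have "\<dots> < d * (A + 1)" using d by simp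
        also have "\<dots> = e" using A by (simp add: d_def)
        finally show ?thesis unfolding eq by simp
      qed
      then show "\<exists>no. \<forall>n\<ge>no. norm ((\<integral>z. resolvent_bernstein T K \<beta> n (T - snd z) * \<phi> z \<partial>OT M T) - (\<integral>z. r (T - snd z) * \<phi> z \<partial>OT M T)) < e"
        by blast
    qed
    from tendsto_mult_left[OF this, of ?c]
    show ?thesis
      unfolding u_hat_n_def opt_control_def resolvent_bernstein_def[symmetric] mult.assoc
      by (simp only: integral_mult_right_zero)
  qed
  show ?thesis
    using opt_control_L2a[of a1 a2] opt uniq weak by blast
qed

end
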